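(* Let $\mathbb F_q$ be a finite field with $q$ elements and let $Y=\{y_1,\ldots,y_{|Y|}\}$ with $|Y|=q-2$. The linear space $\mathrm{SCB}=\bigoplus_{n\ge 0}\mathrm{SCB}_n$ of superclass functions on the triangular groups $\mathrm B_n=\mathrm T(n,\mathbb F_q)$ is a Hopf algebra with respect to the multiplication given by inflation and the comultiplication given by the sum of restrictions (both defined in the context). The map $\kappa_{\mathcal P}\mapsto m_{\mathcal P}$, where $n\geq 0$ and $\mathcal P$ runs through the set of all rigged partitions of $[n]$, extends linearly to an isomorphism of the Hopf algebra $\mathrm{SCB}$ onto the Hopf algebra $\mathrm{NPS}(X,Y)$ of partially symmetric functions in non-commuting variables.
   Context: Notation: $[n]=\{1,\ldots,n\}$, $[0]=\varnothing$. **Superclasses of the triangular group.** $\mathrm B_n=\mathrm T(n,\mathbb F_q)$ is the group of invertible upper triangular $n\times n$ matrices over $\mathbb F_q$; $H$ is its subgroup of diagonal matrices and $\mathrm{UT}_n$ its subgroup of upper triangular matrices with ones on the diagonal. The superclasses of $\mathrm B_n$ are the orbits in $\mathrm B_n$ of the transformations $g\mapsto 1+ta(g-1)b^{-1}t^{-1}$, with $t\in H$, $a,b\in \mathrm{UT}_n$. $\mathrm{SCB}_n$ is the complex vector space of functions $\mathrm B_n\to\mathbb C$ constant on superclasses; $\mathrm{SCB}_0=\mathbb C$. **Multiplication in $\mathrm{SCB}$.** For $\phi\in\mathrm{SCB}_k$, $\psi\in\mathrm{SCB}_m$, $n=k+m$, the product $\phi\cdot\psi\in\mathrm{SCB}_n$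 is the inflation of $\phi\times\psi$, i.e. the composition of $\phi\times\psi$ (the function $(u,v)\mapsto\phi(u)\psi(v)$) with the natural projection $\mathrm B_n\to\mathrm B_k\times\mathrm B_m$ onto the two diagonal blocks. **Comultiplication in $\mathrm{SCB}$.** For an ordered pair $T=(A_1|A_2)$ of disjoint (possibly empty) subsets with union $[n]$, let $\mathrm B_{A_1}\times\mathrm B_{A_2}\subseteq\mathrm B_n$ be the subgroup of all matrices $(a_{ij})\in\mathrm B_n$ such that $a_{ij}\neq0$ implies that $i,j$ lie in the same $A_s$. The order preserving bijections $A_s\to[|A_s|]$ induce an isomorphism $\pi_T:\mathrm B_{A_1}\times\mathrm B_{A_2}\to\mathrm B_{|A_1|}\times\mathrm B_{|A_2|}$. For $\chi\in\mathrm{SCB}_n$ set $$\Delta(\chi)=\sum_{T=(A_1|A_2)}{}^T\mathrm{Res}(\chi),\qquad {}^T\mathrm{Res}(\chi)(g)=\chi(\pi_T^{-1}(g)),\quad g\in \mathrm B_{|A_1|}\times\mathrm B_{|A_2|},$$ where ${}^T\mathrm{Res}(\chi)$ is regarded as an element of $\mathrm{SCB}_{|A_1|}\otimes\mathrm{SCB}_{|A_2|}$. The unit is $1\in\mathrm{SCB}_0=\mathbb C$ and the counit is the projection onto $\mathrm{SCB}_0$. **Rigged partitions.** For a finite set $A$ of positive integers, a rigged partition of $A$, written $\mathcal P\vDash A$, is a pair $\mathcal P=(P,\Phi_{\mathcal P})$ where $P$ is a set partition of some subset $\mathrm{supp}(P)\subseteq A$ and $\Phi_{\mathcal P}$ is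 a map $A\setminus\mathrm{supp}(P)\to[|Y|]$. For $\mathcal P\vDash A$, $\mathcal P_i=(P_i,\Phi_{\mathcal P_i})\vDash A_i$ ($i=1,2$), one writes $\mathcal P=\mathcal P_1+\mathcal P_2$ if $A=A_1\sqcup A_2$, the set of blocks of $P$ is the disjoint union of the sets of blocks of $P_1$ and $P_2$, and $\Phi_{\mathcal P}$ restricted to $A_i\setminus\mathrm{supp}(P_i)$ equals $\Phi_{\mathcal P_i}$ for $i=1,2$. If $\mathcal P\vDash A$, then $\mathrm{st}(\mathcal P)\vDash[|A|]$ is the rigged partition obtained by transport along the order preserving bijection $A\to[|A|]$. **The functions $\kappa_{\mathcal P}$.** Fix an enumeration $\mathbb F_q^*\setminus\{1\}=\{u_1,\ldots,u_{q-2}\}$. For $\mathcal P=(P,\Phi_{\mathcal P})\vDash[n]$ let $D_P$ be the set of pairs $(i,j)$, $1\le i<j\le n$, such that $i,j$ are adjacent (consecutive in increasing order) elements of one block of $P$; let $x_{D_P}=\sum_{(i,j)\in D_P}E_{ij}$ ($E_{ij}$ matrix units); let $h_{\mathcal P}$ be the diagonal matrix whose $i$-th diagonal entry is $u_{\Phi_{\mathcal P}(i)}$ for $i\in[n]\setminus\mathrm{supp}(P)$ and $1$ for $i\in\mathrm{supp}(P)$. $K_{\mathcal P}$ is the superclass of $h_{\mathcal P}+x_{D_P}$ in $\mathrm B_n$, and $\kappa_{\mathcal P}$ is its characteristic function. For the empty rigged partition of $[0]$, $\kappa_\varnothing=1\in\mathrm{SCB}_0$. **The Hopf algebra $\mathrm{NPS}(X,Y)$.**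 Let $X=\{x_1,x_2,\ldots\}$ be an infinite and $Y=\{y_1,\ldots,y_{|Y|}\}$ a finite set of variables, all variables of $X\cup Y$ being non-commuting. The group $S_\infty=\varinjlim S_n$ acts by finite permutations of $X$ and trivially on $Y$. $\mathrm{NPS}(X,Y)$ is the space of all complex formal power series of bounded degree in the non-commuting variables $X\cup Y$ that are invariant under $S_\infty$; it is a graded algebra $\bigoplus_{n\ge0}\mathrm{NPS}_n(X,Y)$ (by degree) under the natural multiplication, with $\mathrm{NPS}_0(X,Y)=\mathbb C$. For $\mathcal P=(P,\Phi_{\mathcal P})\vDash[n]$ with $P=\{\Pi_1,\ldots,\Pi_s\}$, let $m_{\mathcal P}\in\mathrm{NPS}_n(X,Y)$ be the sum of all distinct monomials in the $S_\infty$-orbit of $z_1\cdots z_n$, where $z_i=y_{\Phi_{\mathcal P}(i)}$ for $i\in[n]\setminus\mathrm{supp}(P)$ and $z_i=x_j$ for $i\in\Pi_j$. The elements $m_{\mathcal P}$, $\mathcal P\vDash[n]$, form a basis of $\mathrm{NPS}_n(X,Y)$. The comultiplication is the linear map with $$\Delta(m_{\mathcal P})=\sum_{\mathcal P=\mathcal P_1+\mathcal P_2}m_{\mathrm{st}(\mathcal P_1)}\otimes m_{\mathrm{st}(\mathcal P_2)},$$ the sum being over all ordered pairs $(\mathcal P_1,\mathcal P_2)$ with $\mathcal P=\mathcal P_1+\mathcal P_2$, and the counit sends a series to its constant term. *)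

theory Defs
  imports
    "Jordan_Normal_Form.Gauss_Jordan_Elimination"
    "Jordan_Normal_Form.DL_Submatrix"
    "HOL-Library.Function_Algebras"
    "HOL-Library.Disjoint_Sets"
    "HOL-Library.Cardinality"
begin

(* Conventions.  Both SCB and NPS(X,Y) are spaces of complex functions on a set (square matrices of
   all sizes, respectively words in the variables), so all vector spaces below are linear subspaces
   of some 'i => complex.  All index sets are 0-based, as in the matrix library: [n] is {..<n}. *)

section \<open>Spaces of complex functions and their algebraic tensor products\<close>

definition fscale :: "complex \<Rightarrow> ('i \<Rightarrow> complex) \<Rightarrow> 'i \<Rightarrow> complex" where
  "fscale c f = (\<lambda>i. c * f i)"

global_interpretation fvs: vector_space "fscale :: complex \<Rightarrow> ('i \<Rightarrow> complex) \<Rightarrow> _"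
  by unfold_locales (auto simp: fscale_def fun_eq_iff algebra_simps)

definition linear_on ::
  "('i \<Rightarrow> complex) set \<Rightarrow> ('j \<Rightarrow> complex) set \<Rightarrow> (('i \<Rightarrow> complex) \<Rightarrow> 'j \<Rightarrow> complex) \<Rightarrow> bool" where
  "linear_on V W F \<longleftrightarrow>
     (\<forall>v\<in>V. F v \<in> W) \<and>
     (\<forall>v\<in>V. \<forall>w\<in>V. F (v + w) = F v + F w) \<and>
     (\<forall>c. \<forall>v\<in>V. F (fscale c v) = fscale c (F v))"

definition linear_form_on :: "('i \<Rightarrow> complex) set \<Rightarrow> (('i \<Rightarrow> complex) \<Rightarrow> complex) \<Rightarrow> bool" where
  "linear_form_on V e \<longleftrightarrow>
     (\<forall>v\<in>V. \<forall>w\<in>V. e (v + w) = e v + e w) \<and> (\<forall>c. \<forall>v\<in>V. e (fscale c v) = c * e v)"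

definition bilinear_on ::
  "('i \<Rightarrow> complex) set \<Rightarrow> ('j \<Rightarrow> complex) set \<Rightarrow>
   (('i \<Rightarrow> complex) \<Rightarrow> ('j \<Rightarrow> complex) \<Rightarrow> 'k \<Rightarrow> complex) \<Rightarrow> bool" where
  "bilinear_on V W \<beta> \<longleftrightarrow>
     (\<forall>v\<in>V. linear_on W UNIV (\<beta> v)) \<and> (\<forall>w\<in>W. linear_on V UNIV (\<lambda>v. \<beta> v w))"

(* The algebraic tensor product of two function spaces V and W, realised (via the canonical
   injective map) as the span of the functions (i,j) |-> f i * g j, with f in V and g in W. *)
definition tens :: "('i \<Rightarrow> complex) \<Rightarrow> ('j \<Rightarrow> complex) \<Rightarrow> 'i \<times> 'j \<Rightarrow> complex" where
  "tens f g = (\<lambda>(i, j). f i * g j)"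

definition tensor_space ::
  "('i \<Rightarrow> complex) set \<Rightarrow> ('j \<Rightarrow> complex) set \<Rightarrow> ('i \<times> 'j \<Rightarrow> complex) set" where
  "tensor_space V W = fvs.span {tens f g |f g. f \<in> V \<and> g \<in> W}"

(* The linear map on the tensor product of V and W induced by a bilinear map \<beta> on V x W.
   Lemma tensor_lift_eq below shows that it is well defined. *)
definition tensor_lift ::
  "('i \<Rightarrow> complex) set \<Rightarrow> ('j \<Rightarrow> complex) set \<Rightarrow>
   (('i \<Rightarrow> complex) \<Rightarrow> ('j \<Rightarrow> complex) \<Rightarrow> 'k \<Rightarrow> complex) \<Rightarrow> ('i \<times> 'j \<Rightarrow> complex) \<Rightarrow> 'k \<Rightarrow> complex" where
  "tensor_lift V W \<beta> t =
     (THE r. \<exists>(n::nat) a b. (\<forall>i<n. a i \<in> V \<and> b i \<in> W) \<and>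
        t = (\<Sum>i<n. tens (a i) (b i)) \<and> r = (\<Sum>i<n. \<beta> (a i) (b i)))"

lemma sum_fun_apply: "(\<Sum>i\<in>A. (f i :: 'a \<Rightarrow> complex)) x = (\<Sum>i\<in>A. f i x)"
  by (induction A rule: infinite_finite_induct) auto

lemma linear_on_sum:
  assumes "linear_on V W F" "fvs.subspace V" "\<And>i. i \<in> A \<Longrightarrow> f i \<in> V"
  shows "F (\<Sum>i\<in>A. f i) = (\<Sum>i\<in>A. F (f i))"
proof -
  have F0: "F 0 = 0"
  proof -
    have "F (fscale 0 0) = fscale 0 (F 0)"
      using assms(1,2) fvs.subspace_0 unfolding linear_on_def by blast
    thus ?thesis by (simp add: fscale_def fun_eq_iff zero_fun_def)
  qed
  show ?thesis using assms(3)
  proof (induction A rule: infinite_finite_induct)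
    case (insert x A)
    then have "(\<Sum>i\<in>A. f i) \<in> V" using assms(2) by (intro fvs.subspace_sum) auto
    with insert.prems assms(1) have "F (f x + (\<Sum>i\<in>A. f i)) = F (f x) + F (\<Sum>i\<in>A. f i)"
      unfolding linear_on_def by blast
    moreover have "F (\<Sum>i\<in>A. f i) = (\<Sum>i\<in>A. F (f i))" using insert.prems by (intro insert.IH) auto
    ultimately show ?case by (simp only: sum.insert[OF insert.hyps(1,2)])
  qed (simp_all add: F0)
qed

lemma tensor_relation:
  assumes V: "fvs.subspace V" and W: "fvs.subspace W" and \<beta>: "bilinear_on V W \<beta>"
  shows "(\<And>i. i < (n::nat) \<Longrightarrow> a i \<in> V \<and> b i \<in> W) \<Longrightarrow> (\<Sum>i<n. tens (a i) (b i)) = 0 \<Longrightarrow>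
           (\<Sum>i<n. \<beta> (a i) (b i)) = 0"
proof (induction n arbitrary: b)
  case (Suc n)
  have an: "a n \<in> V" "b n \<in> W" using Suc.prems(1) by auto
  have lv: "linear_on W UNIV (\<beta> v)" if "v \<in> V" for v using \<beta> that by (auto simp: bilinear_on_def)
  have lw: "linear_on V UNIV (\<lambda>v. \<beta> v w)" if "w \<in> W" for w using \<beta> that by (auto simp: bilinear_on_def)
  have eq: "(\<Sum>i<n. a i x * b i y) + a n x * b n y = 0" for x y
    using fun_cong[OF Suc.prems(2), of "(x, y)"] by (simp add: sum_fun_apply tens_def)
  show ?case
  proof (cases "b n = 0")
    case True
    have "\<beta> (a n) (fscale 0 0) = fscale 0 (\<beta> (a n) 0)"
      using lv[OF an(1)] fvs.subspace_0[OF W] unfolding linear_on_def by blast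
    hence z: "\<beta> (a n) 0 = 0" by (simp add: fscale_def fun_eq_iff zero_fun_def)
    have "(\<Sum>i<n. tens (a i) (b i)) = 0"
      using Suc.prems(2) True by (simp add: tens_def fun_eq_iff sum_fun_apply)
    from Suc.IH[OF _ this] Suc.prems(1) have "(\<Sum>i<n. \<beta> (a i) (b i)) = 0" by (metis less_SucI)
    thus ?thesis using z True by simp
  next
    case False
    then obtain j where j: "b n j \<noteq> 0" by (auto simp: fun_eq_iff)
    define c where "c i = - (b i j / b n j)" for i
    have "a n x = (\<Sum>i<n. c i * a i x)" for x
    proof -
      have "a n x * b n j = - (\<Sum>i<n. a i x * b i j)"
        using eq[of x j] by (simp add: add_eq_0_iff)
      hence "a n x = - (\<Sum>i<n. a i x * b i j) / b n j" using j by (simp add: field_simps)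
      also have "\<dots> = (\<Sum>i<n. c i * a i x)"
        by (simp add: c_def sum_divide_distrib mult.commute sum_negf)
      finally show ?thesis .
    qed
    hence an_eq: "a n = (\<Sum>i<n. fscale (c i) (a i))"
      by (simp add: fun_eq_iff sum_fun_apply fscale_def)
    define b' where "b' i = b i + fscale (c i) (b n)" for i
    have b'W: "b' i \<in> W" if "i < n" for i
      unfolding b'_def using Suc.prems(1)[of i] that an
      by (intro fvs.subspace_add[OF W] fvs.subspace_scale[OF W]) auto
    have "(\<Sum>i<n. tens (a i) (b' i)) = 0"
    proof
      fix p :: "'a \<times> 'b"
      obtain x y where p: "p = (x, y)" by force
      have "(\<Sum>i<n. tens (a i) (b' i)) p = (\<Sum>i<n. a i x * b i y) + (\<Sum>i<n. c i * a i x) * b n y"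
        by (simp add: p sum_fun_apply tens_def b'_def fscale_def distrib_left sum.distrib
              sum_distrib_left mult_ac)
      also have "(\<Sum>i<n. c i * a i x) = a n x"
        by (subst an_eq) (simp add: sum_fun_apply fscale_def)
      finally show "(\<Sum>i<n. tens (a i) (b' i)) p = 0 p" using eq by simp
    qed
    with Suc.IH[of b'] Suc.prems(1) b'W have ih: "(\<Sum>i<n. \<beta> (a i) (b' i)) = 0"
      by (meson less_SucI)
    have "\<beta> (a i) (b' i) = \<beta> (a i) (b i) + fscale (c i) (\<beta> (a i) (b n))" if "i < n" for i
    proof -
      have "a i \<in> V" "b i \<in> W" "fscale (c i) (b n) \<in> W"
        using Suc.prems(1)[of i] that an fvs.subspace_scale[OF W] by auto
      thus ?thesis using lv[of "a i"] an unfolding b'_def linear_on_def by simp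
    qed
    hence "(\<Sum>i<n. \<beta> (a i) (b i)) + (\<Sum>i<n. fscale (c i) (\<beta> (a i) (b n))) = 0"
      using ih by (simp add: sum.distrib)
    moreover have "\<beta> (a n) (b n) = (\<Sum>i<n. fscale (c i) (\<beta> (a i) (b n)))"
    proof -
      have "\<beta> (a n) (b n) = (\<Sum>i<n. \<beta> (fscale (c i) (a i)) (b n))"
        unfolding an_eq using Suc.prems(1)
        by (intro linear_on_sum[OF lw[OF an(2)] V]) (auto intro!: fvs.subspace_scale[OF V])
      also have "\<dots> = (\<Sum>i<n. fscale (c i) (\<beta> (a i) (b n)))"
        using lw[OF an(2)] Suc.prems(1) by (intro sum.cong) (auto simp: linear_on_def)
      finally show ?thesis .
    qed
    ultimately show ?thesis by simp
  qed
qed simp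

lemma tensor_lift_eq:
  assumes V: "fvs.subspace V" and W: "fvs.subspace W" and \<beta>: "bilinear_on V W \<beta>"
    and ab: "\<And>i. i < (n::nat) \<Longrightarrow> a i \<in> V \<and> b i \<in> W"
  shows "tensor_lift V W \<beta> (\<Sum>i<n. tens (a i) (b i)) = (\<Sum>i<n. \<beta> (a i) (b i))"
  unfolding tensor_lift_def
proof (rule the_equality)
  show "\<exists>(m::nat) a' b'. (\<forall>i<m. a' i \<in> V \<and> b' i \<in> W) \<and>
      (\<Sum>i<n. tens (a i) (b i)) = (\<Sum>i<m. tens (a' i) (b' i)) \<and>
      (\<Sum>i<n. \<beta> (a i) (b i)) = (\<Sum>i<m. \<beta> (a' i) (b' i))"
    using ab by blast
next
  fix r
  assume "\<exists>(m::nat) a' b'. (\<forall>i<m. a' i \<in> V \<and> b' i \<in> W) \<and>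
      (\<Sum>i<n. tens (a i) (b i)) = (\<Sum>i<m. tens (a' i) (b' i)) \<and>
      r = (\<Sum>i<m. \<beta> (a' i) (b' i))"
  then obtain m :: nat and a' b' where ab': "\<And>i. i < m \<Longrightarrow> a' i \<in> V \<and> b' i \<in> W"
    and t: "(\<Sum>i<n. tens (a i) (b i)) = (\<Sum>i<m. tens (a' i) (b' i))"
    and r: "r = (\<Sum>i<m. \<beta> (a' i) (b' i))" by blast
  define a2 where "a2 i = (if i < n then a i else - a' (i - n))" for i
  define b2 where "b2 i = (if i < n then b i else b' (i - n))" for i
  have split: "(\<Sum>i<n+m. f i) = (\<Sum>i<n. f i) + (\<Sum>i<m. f (n + i))" for f :: "nat \<Rightarrow> 'z::comm_monoid_add"
    by (induction m) (simp_all add: add.assoc)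
  have mem: "a2 i \<in> V \<and> b2 i \<in> W" if "i < n + m" for i
    using that ab[of i] ab'[of "i - n"] fvs.subspace_neg[OF V]
    by (auto simp: a2_def b2_def)
  have neg: "tens (- a' i) (b' i) = - tens (a' i) (b' i)" for i
    by (simp add: tens_def fscale_def fun_eq_iff)
  have negb: "\<beta> (- a' i) (b' i) = - \<beta> (a' i) (b' i)" if "i < m" for i
  proof -
    have "\<beta> (fscale (-1) (a' i)) (b' i) = fscale (-1) (\<beta> (a' i) (b' i))"
      using \<beta> ab'[OF that] unfolding bilinear_on_def linear_on_def by blast
    thus ?thesis by simp
  qed
  have "(\<Sum>i<n+m. tens (a2 i) (b2 i)) = 0"
    unfolding split by (simp add: a2_def b2_def neg sum_negf t)
  from tensor_relation[OF V W \<beta> mem this]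
  have "(\<Sum>i<n+m. \<beta> (a2 i) (b2 i)) = 0" by simp
  hence "(\<Sum>i<n. \<beta> (a i) (b i)) + (\<Sum>i<m. - \<beta> (a' i) (b' i)) = 0"
    unfolding split by (simp add: a2_def b2_def negb)
  thus "r = (\<Sum>i<n. \<beta> (a i) (b i))" by (simp add: r sum_negf)
qed


section \<open>Hopf algebras\<close>

record 'i hopf_data =
  hspace :: "('i \<Rightarrow> complex) set"
  hmult :: "('i \<Rightarrow> complex) \<Rightarrow> ('i \<Rightarrow> complex) \<Rightarrow> 'i \<Rightarrow> complex"
  hunit :: "'i \<Rightarrow> complex"
  hcomult :: "('i \<Rightarrow> complex) \<Rightarrow> 'i \<times> 'i \<Rightarrow> complex"
  hcounit :: "('i \<Rightarrow> complex) \<Rightarrow> complex"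

locale unital_algebra =
  fixes H :: "'i hopf_data"
  assumes subspace: "fvs.subspace (hspace H)"
    and mult_closed: "\<lbrakk>x \<in> hspace H; y \<in> hspace H\<rbrakk> \<Longrightarrow> hmult H x y \<in> hspace H"
    and mult_bilinear: "bilinear_on (hspace H) (hspace H) (hmult H)"
    and mult_assoc: "\<lbrakk>x \<in> hspace H; y \<in> hspace H; z \<in> hspace H\<rbrakk> \<Longrightarrow>
          hmult H (hmult H x y) z = hmult H x (hmult H y z)"
    and unit_closed: "hunit H \<in> hspace H"
    and unit_left: "x \<in> hspace H \<Longrightarrow> hmult H (hunit H) x = x"
    and unit_right: "x \<in> hspace H \<Longrightarrow> hmult H x (hunit H) = x"

definition reassoc :: "(('i \<times> 'j) \<times> 'k \<Rightarrow> complex) \<Rightarrow> 'i \<times> 'j \<times> 'k \<Rightarrow> complex" where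
  "reassoc t = (\<lambda>(i, j, k). t ((i, j), k))"

locale counital_coalgebra =
  fixes H :: "'i hopf_data"
  assumes subspace: "fvs.subspace (hspace H)"
    and comult_linear: "linear_on (hspace H) (tensor_space (hspace H) (hspace H)) (hcomult H)"
    and counit_linear: "linear_form_on (hspace H) (hcounit H)"
    and coassoc: "x \<in> hspace H \<Longrightarrow>
          tensor_lift (hspace H) (hspace H) (\<lambda>a b. reassoc (tens (hcomult H a) b)) (hcomult H x) =
          tensor_lift (hspace H) (hspace H) (\<lambda>a b. tens a (hcomult H b)) (hcomult H x)"
    and counit_left: "x \<in> hspace H \<Longrightarrow>
          tensor_lift (hspace H) (hspace H) (\<lambda>a b. fscale (hcounit H a) b) (hcomult H x) = x"
    and counit_right: "x \<in> hspace H \<Longrightarrow>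
          tensor_lift (hspace H) (hspace H) (\<lambda>a b. fscale (hcounit H b) a) (hcomult H x) = x"

(* The product on the tensor square: (a (x) b) (c (x) d) = ac (x) bd. *)
definition tensor_mult ::
  "'i hopf_data \<Rightarrow> ('i \<times> 'i \<Rightarrow> complex) \<Rightarrow> ('i \<times> 'i \<Rightarrow> complex) \<Rightarrow> 'i \<times> 'i \<Rightarrow> complex" where
  "tensor_mult H s t =
     tensor_lift (hspace H) (hspace H)
       (\<lambda>a b. tensor_lift (hspace H) (hspace H)
          (\<lambda>c d. tens (hmult H a c) (hmult H b d)) t) s"

locale bialgebra = unital_algebra H + counital_coalgebra H for H :: "'i hopf_data" +
  assumes comult_mult: "\<lbrakk>x \<in> hspace H; y \<in> hspace H\<rbrakk> \<Longrightarrow>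
          hcomult H (hmult H x y) = tensor_mult H (hcomult H x) (hcomult H y)"
    and comult_unit: "hcomult H (hunit H) = tens (hunit H) (hunit H)"
    and counit_mult: "\<lbrakk>x \<in> hspace H; y \<in> hspace H\<rbrakk> \<Longrightarrow>
          hcounit H (hmult H x y) = hcounit H x * hcounit H y"
    and counit_unit: "hcounit H (hunit H) = 1"

definition is_antipode :: "'i hopf_data \<Rightarrow> (('i \<Rightarrow> complex) \<Rightarrow> 'i \<Rightarrow> complex) \<Rightarrow> bool" where
  "is_antipode H S \<longleftrightarrow>
     linear_on (hspace H) (hspace H) S \<and>
     (\<forall>x\<in>hspace H.
        tensor_lift (hspace H) (hspace H) (\<lambda>a b. hmult H (S a) b) (hcomult H x) =
          fscale (hcounit H x) (hunit H) \<and>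
        tensor_lift (hspace H) (hspace H) (\<lambda>a b. hmult H a (S b)) (hcomult H x) =
          fscale (hcounit H x) (hunit H))"

locale hopf_algebra = bialgebra H for H :: "'i hopf_data" +
  assumes antipode: "\<exists>S. is_antipode H S"

(* As usual, compatibility with the antipodes is not required: it is automatic. *)
definition hopf_isomorphism ::
  "'i hopf_data \<Rightarrow> 'j hopf_data \<Rightarrow> (('i \<Rightarrow> complex) \<Rightarrow> 'j \<Rightarrow> complex) \<Rightarrow> bool" where
  "hopf_isomorphism H K F \<longleftrightarrow>
     linear_on (hspace H) (hspace K) F \<and>
     bij_betw F (hspace H) (hspace K) \<and>
     (\<forall>x\<in>hspace H. \<forall>y\<in>hspace H. F (hmult H x y) = hmult K (F x) (F y)) \<and>
     F (hunit H) = hunit K \<and>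
     (\<forall>x\<in>hspace H. hcomult K (F x) =
        tensor_lift (hspace H) (hspace H) (\<lambda>a b. tens (F a) (F b)) (hcomult H x)) \<and>
     (\<forall>x\<in>hspace H. hcounit K (F x) = hcounit H x)"


section \<open>Superclass functions on the triangular groups\<close>

definition tri_group :: "nat \<Rightarrow> 'q::field mat set" where
  "tri_group n = {g \<in> carrier_mat n n. upper_triangular g \<and> invertible_mat g}"

definition diag_group :: "nat \<Rightarrow> 'q::field mat set" where
  "diag_group n = {t \<in> tri_group n. diagonal_mat t}"

definition unitri_group :: "nat \<Rightarrow> 'q::field mat set" where
  "unitri_group n = {a \<in> carrier_mat n n. upper_triangular a \<and> (\<forall>i<n. a $$ (i, i) = 1)}"

definition superclass :: "nat \<Rightarrow> 'q::field mat \<Rightarrow> 'q mat set" where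
  "superclass n g =
     {1\<^sub>m n + t * a * (g - 1\<^sub>m n) * the (mat_inverse b) * the (mat_inverse t) |t a b.
        t \<in> diag_group n \<and> a \<in> unitri_group n \<and> b \<in> unitri_group n}"

(* A function on B_n is extended by zero to all matrices. *)
definition SCB_deg :: "nat \<Rightarrow> ('q::field mat \<Rightarrow> complex) set" where
  "SCB_deg n = {\<phi>. (\<forall>g. g \<notin> tri_group n \<longrightarrow> \<phi> g = 0) \<and>
                   (\<forall>g\<in>tri_group n. \<forall>h\<in>superclass n g. \<phi> h = \<phi> g)}"

(* The sum over n is direct since the supports are disjoint. *)
definition SCB_space :: "('q::field mat \<Rightarrow> complex) set" where
  "SCB_space = fvs.span (\<Union>n. SCB_deg n)"

definition inflation ::
  "nat \<Rightarrow> nat \<Rightarrow> ('q::field mat \<Rightarrow> complex) \<Rightarrow> ('q mat \<Rightarrow> complex) \<Rightarrow> 'q mat \<Rightarrow> complex" where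
  "inflation k m \<phi> \<psi> =
     (\<lambda>g. if g \<in> tri_group (k + m)
          then (case split_block g k k of (g1, _, _, g2) \<Rightarrow> \<phi> g1 * \<psi> g2) else 0)"

(* Bilinear extension of inflation: only the components of \<phi> in degree k and of \<psi> in degree n - k
   contribute to the k-th summand, where n is the size of g. *)
definition SCB_mult ::
  "('q::field mat \<Rightarrow> complex) \<Rightarrow> ('q mat \<Rightarrow> complex) \<Rightarrow> 'q mat \<Rightarrow> complex" where
  "SCB_mult \<phi> \<psi> = (\<lambda>g. \<Sum>k\<le>dim_row g. inflation k (dim_row g - k) \<phi> \<psi> g)"

definition levi_group :: "nat \<Rightarrow> nat set \<Rightarrow> nat set \<Rightarrow> 'q::field mat set" where
  "levi_group n A1 A2 =
     {g \<in> tri_group n. \<forall>i<n. \<forall>j<n. g $$ (i, j) \<noteq> 0 \<longrightarrow>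
        (i \<in> A1 \<and> j \<in> A1) \<or> (i \<in> A2 \<and> j \<in> A2)}"

definition levi_iso :: "nat set \<Rightarrow> nat set \<Rightarrow> 'q mat \<Rightarrow> 'q mat \<times> 'q mat" where
  "levi_iso A1 A2 g = (submatrix g A1 A1, submatrix g A2 A2)"

definition TRes ::
  "nat \<Rightarrow> nat set \<Rightarrow> nat set \<Rightarrow> ('q::field mat \<Rightarrow> complex) \<Rightarrow> 'q mat \<times> 'q mat \<Rightarrow> complex" where
  "TRes n A1 A2 \<chi> =
     (\<lambda>g. if g \<in> tri_group (card A1) \<times> tri_group (card A2)
          then \<chi> (the_inv_into (levi_group n A1 A2) (levi_iso A1 A2) g) else 0)"

definition SCB_comult_deg ::
  "nat \<Rightarrow> ('q::field mat \<Rightarrow> complex) \<Rightarrow> 'q mat \<times> 'q mat \<Rightarrow> complex" where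
  "SCB_comult_deg n \<chi> =
     (\<Sum>(A1, A2) \<in> {(A1, A2). A1 \<union> A2 = {..<n} \<and> A1 \<inter> A2 = {}}. TRes n A1 A2 \<chi>)"

(* Linear extension: on pairs of matrices whose sizes add up to n, only the degree n component
   of \<chi> contributes. *)
definition SCB_comult :: "('q::field mat \<Rightarrow> complex) \<Rightarrow> 'q mat \<times> 'q mat \<Rightarrow> complex" where
  "SCB_comult \<chi> = (\<lambda>(u, v). SCB_comult_deg (dim_row u + dim_row v) \<chi> (u, v))"

definition SCB_unit :: "'q::field mat \<Rightarrow> complex" where
  "SCB_unit = (\<lambda>g. if g \<in> tri_group 0 then 1 else 0)"

definition SCB_counit :: "('q::field mat \<Rightarrow> complex) \<Rightarrow> complex" where
  "SCB_counit \<chi> = \<chi> (1\<^sub>m 0)"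

definition SCB :: "'q::field mat hopf_data" where
  "SCB = \<lparr>hspace = SCB_space, hmult = SCB_mult, hunit = SCB_unit,
          hcomult = SCB_comult, hcounit = SCB_counit\<rparr>"


section \<open>Rigged partitions and the functions \<open>\<kappa>\<^sub>\<P>\<close>\<close>

type_synonym rigged = "nat set set \<times> (nat \<rightharpoonup> nat)"

definition supp :: "rigged \<Rightarrow> nat set" where
  "supp \<P> = \<Union> (fst \<P>)"

(* rigged_partition r A \<P> says that \<P> is a rigged partition of A, with r = |Y|. *)
definition rigged_partition :: "nat \<Rightarrow> nat set \<Rightarrow> rigged \<Rightarrow> bool" where
  "rigged_partition r A \<P> \<longleftrightarrow>
     finite A \<and> supp \<P> \<subseteq> A \<and> partition_on (supp \<P>) (fst \<P>) \<and>
     dom (snd \<P>) = A - supp \<P> \<and> ran (snd \<P>) \<subseteq> {..<r}"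

(* The set A of which \<P> is a rigged partition. *)
definition ground :: "rigged \<Rightarrow> nat set" where
  "ground \<P> = supp \<P> \<union> dom (snd \<P>)"

definition rigged_sum :: "nat \<Rightarrow> rigged \<Rightarrow> rigged \<Rightarrow> rigged \<Rightarrow> bool" where
  "rigged_sum r \<P> \<P>1 \<P>2 \<longleftrightarrow>
     (\<exists>A A1 A2. rigged_partition r A \<P> \<and> rigged_partition r A1 \<P>1 \<and> rigged_partition r A2 \<P>2 \<and>
        A = A1 \<union> A2 \<and> A1 \<inter> A2 = {} \<and>
        fst \<P> = fst \<P>1 \<union> fst \<P>2 \<and> fst \<P>1 \<inter> fst \<P>2 = {} \<and>
        snd \<P> |` (A1 - supp \<P>1) = snd \<P>1 \<and> snd \<P> |` (A2 - supp \<P>2) = snd \<P>2)"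

(* pick A is the increasing enumeration of A, i.e. the order preserving bijection from [|A|] to A. *)
definition standardize :: "rigged \<Rightarrow> rigged" where
  "standardize \<P> =
     (let A = ground \<P> in
       ((\<lambda>B. {i. i < card A \<and> pick A i \<in> B}) ` fst \<P>,
        (\<lambda>i. if i < card A then snd \<P> (pick A i) else None)))"

definition arcs :: "nat set set \<Rightarrow> (nat \<times> nat) set" where
  "arcs P = {(i, j). i < j \<and> (\<exists>B\<in>P. i \<in> B \<and> j \<in> B \<and> (\<forall>k\<in>B. \<not> (i < k \<and> k < j)))}"

definition arc_mat :: "nat \<Rightarrow> nat set set \<Rightarrow> 'q::field mat" where
  "arc_mat n P = mat n n (\<lambda>(i, j). if (i, j) \<in> arcs P then 1 else 0)"

definition rig_mat :: "(nat \<Rightarrow> 'q::field) \<Rightarrow> nat \<Rightarrow> rigged \<Rightarrow> 'q mat" where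
  "rig_mat u n \<P> =
     mat n n (\<lambda>(i, j). if i = j then (if i \<in> supp \<P> then 1 else u (the (snd \<P> i))) else 0)"

(* Here u enumerates the elements of the field other than 0 and 1. *)
definition kappa :: "(nat \<Rightarrow> 'q::field) \<Rightarrow> nat \<Rightarrow> rigged \<Rightarrow> 'q mat \<Rightarrow> complex" where
  "kappa u n \<P> =
     (\<lambda>g. if g \<in> superclass n (rig_mat u n \<P> + arc_mat n (fst \<P>)) then 1 else 0)"


section \<open>Partially symmetric functions in non-commuting variables\<close>

datatype nc_var = Xvar nat | Yvar nat

primrec act_var :: "(nat \<Rightarrow> nat) \<Rightarrow> nc_var \<Rightarrow> nc_var" where
  "act_var \<sigma> (Xvar i) = Xvar (\<sigma> i)"
| "act_var \<sigma> (Yvar i) = Yvar i"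

definition finite_perm :: "(nat \<Rightarrow> nat) \<Rightarrow> bool" where
  "finite_perm \<sigma> \<longleftrightarrow> bij \<sigma> \<and> finite {i. \<sigma> i \<noteq> i}"

(* A formal power series is the function assigning to each word its coefficient;
   Y consists of the variables Yvar i with i < r. *)
definition NPS_space :: "nat \<Rightarrow> (nc_var list \<Rightarrow> complex) set" where
  "NPS_space r = {f.
     (\<forall>w. f w \<noteq> 0 \<longrightarrow> set w \<subseteq> range Xvar \<union> Yvar ` {..<r}) \<and>
     (\<exists>N. \<forall>w. f w \<noteq> 0 \<longrightarrow> length w \<le> N) \<and>
     (\<forall>\<sigma> w. finite_perm \<sigma> \<longrightarrow> f (map (act_var \<sigma>) w) = f w)}"

definition NPS_mult ::
  "(nc_var list \<Rightarrow> complex) \<Rightarrow> (nc_var list \<Rightarrow> complex) \<Rightarrow> nc_var list \<Rightarrow> complex" where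
  "NPS_mult f g = (\<lambda>w. \<Sum>k\<le>length w. f (take k w) * g (drop k w))"

definition NPS_unit :: "nc_var list \<Rightarrow> complex" where
  "NPS_unit = (\<lambda>w. if w = [] then 1 else 0)"

definition NPS_counit :: "(nc_var list \<Rightarrow> complex) \<Rightarrow> complex" where
  "NPS_counit f = f []"

(* An arbitrary enumeration of the blocks; the orbit of the word below does not depend on it. *)
definition block_label :: "nat set set \<Rightarrow> nat set \<Rightarrow> nat" where
  "block_label P = (SOME e. bij_betw e P {..<card P})"

definition rigged_word :: "nat \<Rightarrow> rigged \<Rightarrow> nc_var list" where
  "rigged_word n \<P> =
     map (\<lambda>i. if i \<in> supp \<P> then Xvar (block_label (fst \<P>) (THE B. B \<in> fst \<P> \<and> i \<in> B))
              else Yvar (the (snd \<P> i))) [0..<n]"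

definition m_rigged :: "nat \<Rightarrow> rigged \<Rightarrow> nc_var list \<Rightarrow> complex" where
  "m_rigged n \<P> =
     (\<lambda>w. if \<exists>\<sigma>. finite_perm \<sigma> \<and> w = map (act_var \<sigma>) (rigged_word n \<P>) then 1 else 0)"

(* The linear map sending b i to c i for i in I (well defined if the family b is linearly
   independent), on the span of the family b. *)
definition linear_extension ::
  "'x set \<Rightarrow> ('x \<Rightarrow> 'i \<Rightarrow> complex) \<Rightarrow> ('x \<Rightarrow> 'j \<Rightarrow> complex) \<Rightarrow> ('i \<Rightarrow> complex) \<Rightarrow> 'j \<Rightarrow> complex" where
  "linear_extension I b c v =
     (THE w. \<exists>J a. finite J \<and> J \<subseteq> I \<and>
        v = (\<Sum>i\<in>J. fscale (a i) (b i)) \<and> w = (\<Sum>i\<in>J. fscale (a i) (c i)))"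

definition NPS_comult :: "nat \<Rightarrow> (nc_var list \<Rightarrow> complex) \<Rightarrow> nc_var list \<times> nc_var list \<Rightarrow> complex" where
  "NPS_comult r =
     linear_extension {(n, \<P>). rigged_partition r {..<n} \<P>}
       (\<lambda>(n, \<P>). m_rigged n \<P>)
       (\<lambda>(n, \<P>). \<Sum>(\<P>1, \<P>2) \<in> {(\<P>1, \<P>2). rigged_sum r \<P> \<P>1 \<P>2}.
          tens (m_rigged (card (ground \<P>1)) (standardize \<P>1))
               (m_rigged (card (ground \<P>2)) (standardize \<P>2)))"

definition NPS :: "nat \<Rightarrow> nc_var list hopf_data" where
  "NPS r = \<lparr>hspace = NPS_space r, hmult = NPS_mult, hunit = NPS_unit,
            hcomult = NPS_comult r, hcounit = NPS_counit\<rparr>"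

end

theory Submission
  imports Defs "Jordan_Normal_Form.Determinant"
begin

text \<open>
  Both algebras consist of class functions for the same set of classes. Row and column operations that
  respect triangularity bring \<open>g - 1\<close>, for \<open>g\<close> in a triangular group, to a form with at most one nonzero entry
  in each row and column, and conjugation by diagonal matrices turns the entries off the diagonal into
  ones. Such a form is a word in \<open>X \<union> Y\<close> up to renaming of the variables \<open>X\<close>: the letter \<open>Yvar c\<close> at position
  \<open>i\<close> records the diagonal entry \<open>u c\<close> of \<open>g\<close>, and consecutive occurrences of one \<open>X\<close>-letter record the entries
  off the diagonal. This is \<open>word_mat\<close> below; every superclass contains the matrix of a word
  (\<open>word_normal_form\<close>), and words that are not renamings of each other give different superclasses
  (\<open>tri_equiv_word_rook_imp_type\<close>). Hence \<open>f \<mapsto> (\<lambda>w. f (word_mat u w))\<close> is a linear bijection from superclass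
  functions to functions of words that are invariant under renaming, and it sends \<open>\<kappa>\<^sub>\<P>\<close> to \<open>m\<^sub>\<P>\<close>.

  It respects products because the diagonal blocks of the matrix of a word are the matrices of a prefix
  and a suffix. For the coproducts, the matrices of two words placed on complementary index sets form
  the matrix of a shuffle of the two words, after their \<open>X\<close>-letters have been made distinct
  (\<open>levi_embed_word_mat\<close>). So a sum of restrictions becomes a sum over shuffles, \<open>word_comult\<close>; and the
  coproduct prescribed on the monomial functions is the same sum over shuffles (\<open>NPS_comult_eq\<close>).

  The axioms are verified for words only. There all maps are finite sums of evaluations:
  coassociativity is the associativity of shuffling, compatibility of product and coproduct says that
  cutting a shuffle cuts the two shuffled words, and the antipode is defined by recursion on the length
  of a word. Pulling functions back along \<open>g \<mapsto>\<close> normal form of \<open>g\<close> transports the axioms to superclass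
  functions (locale \<open>hopf_transport\<close>).
\<close>

section \<open>Tensor products of function spaces\<close>

lemma fscale_apply: "fscale c f x = c * f x"
  by (simp add: fscale_def)

lemma linear_onD:
  assumes "linear_on V W F"
  shows "v \<in> V \<Longrightarrow> F v \<in> W"
    and "v \<in> V \<Longrightarrow> w \<in> V \<Longrightarrow> F (v + w) = F v + F w"
    and "v \<in> V \<Longrightarrow> F (fscale c v) = fscale c (F v)"
  using assms by (auto simp: linear_on_def)

lemma linear_onI:
  assumes "\<And>v. v \<in> V \<Longrightarrow> F v \<in> W"
    and "\<And>v w. v \<in> V \<Longrightarrow> w \<in> V \<Longrightarrow> F (v + w) = F v + F w"
    and "\<And>c v. v \<in> V \<Longrightarrow> F (fscale c v) = fscale c (F v)"
  shows "linear_on V W F"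
  using assms by (auto simp: linear_on_def)

lemma bilinear_onI:
  assumes "\<And>v w w'. v \<in> V \<Longrightarrow> w \<in> W \<Longrightarrow> w' \<in> W \<Longrightarrow> \<beta> v (w + w') = \<beta> v w + \<beta> v w'"
    and "\<And>v w c. v \<in> V \<Longrightarrow> w \<in> W \<Longrightarrow> \<beta> v (fscale c w) = fscale c (\<beta> v w)"
    and "\<And>v v' w. v \<in> V \<Longrightarrow> v' \<in> V \<Longrightarrow> w \<in> W \<Longrightarrow> \<beta> (v + v') w = \<beta> v w + \<beta> v' w"
    and "\<And>v w c. v \<in> V \<Longrightarrow> w \<in> W \<Longrightarrow> \<beta> (fscale c v) w = fscale c (\<beta> v w)"
  shows "bilinear_on V W \<beta>"
  using assms by (auto simp: bilinear_on_def linear_on_def)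

lemma bilinear_onD:
  assumes "bilinear_on V W \<beta>"
  shows "v \<in> V \<Longrightarrow> w \<in> W \<Longrightarrow> w' \<in> W \<Longrightarrow> \<beta> v (w + w') = \<beta> v w + \<beta> v w'"
    and "v \<in> V \<Longrightarrow> w \<in> W \<Longrightarrow> \<beta> v (fscale c w) = fscale c (\<beta> v w)"
    and "v \<in> V \<Longrightarrow> v' \<in> V \<Longrightarrow> w \<in> W \<Longrightarrow> \<beta> (v + v') w = \<beta> v w + \<beta> v' w"
    and "v \<in> V \<Longrightarrow> w \<in> W \<Longrightarrow> \<beta> (fscale c v) w = fscale c (\<beta> v w)"
  using assms by (auto simp: bilinear_on_def linear_on_def)

lemma tens_in_tensor_space: "f \<in> V \<Longrightarrow> g \<in> W \<Longrightarrow> tens f g \<in> tensor_space V W"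
  unfolding tensor_space_def by (rule fvs.span_base) blast

lemma subspace_tensor_space: "fvs.subspace (tensor_space V W)"
  unfolding tensor_space_def by (rule fvs.subspace_span)

lemma tensor_spaceE:
  assumes t: "t \<in> tensor_space V W" and V: "fvs.subspace V"
  obtains n :: nat and a b
  where "\<And>i. i < n \<Longrightarrow> a i \<in> V" "\<And>i. i < n \<Longrightarrow> b i \<in> W" "t = (\<Sum>i<n. tens (a i) (b i))"
proof -
  have "\<exists>(n::nat) a b. (\<forall>i<n. a i \<in> V \<and> b i \<in> W) \<and> t = (\<Sum>i<n. tens (a i) (b i))"
    using t unfolding tensor_space_def
  proof (induction rule: fvs.span_induct_alt)
    case base
    show ?case by (intro exI[of _ 0]) simp
  next
    case (step c x y)
    then obtain f g n a b where fg: "x = tens f g" "f \<in> V" "g \<in> W"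
      and ab: "\<forall>i<(n::nat). a i \<in> V \<and> b i \<in> W" "y = (\<Sum>i<n. tens (a i) (b i))" by blast
    define a' where "a' = a(n := fscale c f)"
    define b' where "b' = b(n := g)"
    have "\<forall>i<Suc n. a' i \<in> V \<and> b' i \<in> W"
      using ab fg fvs.subspace_scale[OF V] by (auto simp: a'_def b'_def less_Suc_eq)
    moreover have "fscale c x + y = (\<Sum>i<Suc n. tens (a' i) (b' i))"
    proof -
      have "(\<Sum>i<n. tens (a' i) (b' i)) = y"
        unfolding ab(2) by (intro sum.cong) (auto simp: a'_def b'_def)
      moreover have "tens (a' n) (b' n) = fscale c x"
        by (auto simp: a'_def b'_def fg tens_def fscale_def fun_eq_iff)
      ultimately show ?thesis by (simp add: add.commute)
    qed
    ultimately show ?case by blast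
  qed
  thus thesis using that by blast
qed

lemma tens_simps:
  "tens (a + a') c = tens a c + tens a' c"
  "tens (fscale k a) c = fscale k (tens a c)"
  by (auto simp: tens_def fscale_def fun_eq_iff algebra_simps)

lemma tens_simps':
  "tens a (c + c') = tens a c + tens a c'"
  "tens a (fscale k c) = fscale k (tens a c)"
  by (auto simp: tens_def fscale_def fun_eq_iff algebra_simps)

lemma reassoc_simps:
  "reassoc (s + t) = reassoc s + reassoc t"
  "reassoc (fscale k s) = fscale k (reassoc s)"
  by (auto simp: reassoc_def fscale_def fun_eq_iff)

lemma fscale_simps:
  "fscale k (a + b) = fscale k a + fscale k b" "fscale (k + l) a = fscale k a + fscale l a"
  "fscale k (fscale l a) = fscale (k * l) a"
  by (auto simp: fscale_def fun_eq_iff algebra_simps)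

lemma bilinear_on_sum:
  assumes "\<And>i. i \<in> A \<Longrightarrow> bilinear_on V W (\<beta> i)"
  shows "bilinear_on V W (\<lambda>a b. \<Sum>i\<in>A. \<beta> i a b)"
  by (rule bilinear_onI)
     (simp_all add: bilinear_onD[OF assms] sum.distrib fun_eq_iff sum_fun_apply fscale_apply
        sum_distrib_left)

lemma (in unital_algebra) tensor_mult_expansion:
  assumes ab: "\<And>i. i < (n::nat) \<Longrightarrow> a i \<in> hspace H \<and> b i \<in> hspace H"
    and cd: "\<And>j. j < (m::nat) \<Longrightarrow> c j \<in> hspace H \<and> d j \<in> hspace H"
  shows "tensor_mult H (\<Sum>i<n. tens (a i) (b i)) (\<Sum>j<m. tens (c j) (d j)) =
    (\<Sum>i<n. \<Sum>j<m. tens (hmult H (a i) (c j)) (hmult H (b i) (d j)))"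
proof -
  note bi = bilinear_onD[OF mult_bilinear]
  let ?\<beta> = "\<lambda>a b. tensor_lift (hspace H) (hspace H) (\<lambda>c d. tens (hmult H a c) (hmult H b d))
                  (\<Sum>j<m. tens (c j) (d j))"
  have \<beta>: "?\<beta> x y = (\<Sum>j<m. tens (hmult H x (c j)) (hmult H y (d j)))"
    if "x \<in> hspace H" "y \<in> hspace H" for x y
    by (rule tensor_lift_eq[OF subspace subspace _ cd])
       (auto intro!: bilinear_onI simp: bi tens_simps tens_simps' that)
  have "bilinear_on (hspace H) (hspace H)
          (\<lambda>x y. \<Sum>j<m. tens (hmult H x (c j)) (hmult H y (d j)))"
    by (rule bilinear_on_sum)
       (auto intro!: bilinear_onI simp: bi tens_simps tens_simps' cd)
  hence "bilinear_on (hspace H) (hspace H) ?\<beta>"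
    by (simp add: bilinear_on_def linear_on_def \<beta> fvs.subspace_add[OF subspace]
        fvs.subspace_scale[OF subspace])
  hence "tensor_mult H (\<Sum>i<n. tens (a i) (b i)) (\<Sum>j<m. tens (c j) (d j)) =
      (\<Sum>i<n. ?\<beta> (a i) (b i))"
    unfolding tensor_mult_def by (intro tensor_lift_eq[OF subspace subspace] ab) auto
  thus ?thesis using ab by (simp add: \<beta>)
qed

section \<open>Transport of a Hopf algebra structure\<close>

text \<open>Pulling back functions along \<open>p\<close>, with value zero off \<open>D\<close>, is multiplicative with respect
  to \<^const>\<open>tens\<close>. So an iterated tensor identity can be pulled back pointwise, without choosing
  bases or forming tensor powers of the linear isomorphism.\<close>

definition pull :: "'i set \<Rightarrow> ('i \<Rightarrow> 'j) \<Rightarrow> ('j \<Rightarrow> complex) \<Rightarrow> 'i \<Rightarrow> complex" where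
  "pull D p y = (\<lambda>i. if i \<in> D then y (p i) else 0)"

lemma pull_add: "pull D p (x + y) = pull D p x + pull D p y"
  and pull_fscale: "pull D p (fscale c x) = fscale c (pull D p x)"
  by (auto simp: pull_def fun_eq_iff fscale_apply)

lemma pull_sum: "pull D p (\<Sum>i\<in>A. f i) = (\<Sum>i\<in>A. pull D p (f i))"
  by (rule ext) (simp add: pull_def sum_fun_apply)

lemma pull_tens: "pull (D \<times> D') (map_prod p p') (tens x y) = tens (pull D p x) (pull D' p' y)"
  by (auto simp: pull_def tens_def fun_eq_iff)

lemma pull_reassoc:
  "pull (D \<times> D' \<times> D'') (map_prod p (map_prod p' p'')) (reassoc t) =
     reassoc (pull ((D \<times> D') \<times> D'') (map_prod (map_prod p p') p'') t)"
  by (auto simp: pull_def reassoc_def fun_eq_iff)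

text \<open>The space of \<open>H\<close> consists of the functions pulled back from that of \<open>K\<close>, and \<open>F\<close> is inverse to the
  pullback. The structure maps of \<open>H\<close> are given by those of \<open>K\<close>.\<close>

locale hopf_transport = K: hopf_algebra K for K :: "'j hopf_data" +
  fixes H :: "'i hopf_data" and F :: "('i \<Rightarrow> complex) \<Rightarrow> 'j \<Rightarrow> complex"
    and D :: "'i set" and p :: "'i \<Rightarrow> 'j"
  assumes sub: "fvs.subspace (hspace H)"
    and lin: "linear_on (hspace H) (hspace K) F"
    and bij: "bij_betw F (hspace H) (hspace K)"
    and inv: "x \<in> hspace H \<Longrightarrow> x = pull D p (F x)"
    and mult: "\<lbrakk>x \<in> hspace H; y \<in> hspace H\<rbrakk> \<Longrightarrow> hmult H x y = pull D p (hmult K (F x) (F y))"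
    and unit: "hunit H = pull D p (hunit K)"
    and comult: "x \<in> hspace H \<Longrightarrow>
          hcomult H x = pull (D \<times> D) (map_prod p p) (hcomult K (F x))"
    and counit: "x \<in> hspace H \<Longrightarrow> hcounit H x = hcounit K (F x)"
begin

abbreviation "V \<equiv> hspace H"
abbreviation "W \<equiv> hspace K"
abbreviation "G \<equiv> pull D p"

lemma F_in: "x \<in> V \<Longrightarrow> F x \<in> W"
  using linear_onD(1)[OF lin] .

lemma F_onto:
  assumes "y \<in> W"
  obtains x where "x \<in> V" "y = F x" "G y = x"
proof -
  from assms bij obtain x where x: "x \<in> V" "y = F x"
    by (auto simp: bij_betw_def)
  from that[OF x] show thesis unfolding x(2) by (simp only: inv[OF x(1), symmetric])
qed

lemma G_in: "y \<in> W \<Longrightarrow> G y \<in> V" and FG: "y \<in> W \<Longrightarrow> F (G y) = y"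
  by (auto elim: F_onto)

lemma F_mult: "x \<in> V \<Longrightarrow> y \<in> V \<Longrightarrow> F (hmult H x y) = hmult K (F x) (F y)"
  by (simp add: mult FG K.mult_closed F_in)

lemma mult_in: "x \<in> V \<Longrightarrow> y \<in> V \<Longrightarrow> hmult H x y \<in> V"
  by (simp add: mult G_in K.mult_closed F_in)

lemma unit_in: "hunit H \<in> V" and F_unit: "F (hunit H) = hunit K"
  by (simp_all add: unit G_in FG K.unit_closed)

lemma mult_GG: "a \<in> W \<Longrightarrow> b \<in> W \<Longrightarrow> hmult H (G a) (G b) = G (hmult K a b)"
  by (simp add: mult G_in FG)

lemma comult_G: "a \<in> W \<Longrightarrow> hcomult H (G a) = pull (D \<times> D) (map_prod p p) (hcomult K a)"
  by (simp add: comult G_in FG)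

lemma G_tensor_expansion:
  assumes "y \<in> W"
  shows "\<exists>(n::nat) a b. (\<forall>i<n. a i \<in> W \<and> b i \<in> W) \<and>
    hcomult K y = (\<Sum>i<n. tens (a i) (b i)) \<and>
    hcomult H (G y) = (\<Sum>i<n. tens (G (a i)) (G (b i)))"
proof -
  have "hcomult K y \<in> tensor_space W W"
    using linear_onD(1)[OF K.comult_linear assms] .
  then obtain n :: nat and a b where *: "\<And>i. i < n \<Longrightarrow> a i \<in> W" "\<And>i. i < n \<Longrightarrow> b i \<in> W"
    "hcomult K y = (\<Sum>i<n. tens (a i) (b i))"
    by (rule tensor_spaceE[OF _ K.unital_algebra_axioms[THEN unital_algebra.subspace]]) blast
  have "hcomult H (G y) = (\<Sum>i<n. tens (G (a i)) (G (b i)))"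
    by (simp add: comult_G[OF assms] * pull_sum pull_tens)
  with * show ?thesis by blast
qed

lemma subK: "fvs.subspace W"
  by (rule K.unital_algebra_axioms[THEN unital_algebra.subspace])

lemma comult_linear_H: "linear_on V (tensor_space V V) (hcomult H)"
proof (rule linear_onI)
  fix v assume v: "v \<in> V"
  obtain n :: nat and a b where *: "\<forall>i<n. a i \<in> W \<and> b i \<in> W"
    "hcomult H (G (F v)) = (\<Sum>i<n. tens (G (a i)) (G (b i)))"
    using G_tensor_expansion[OF F_in[OF v]] by blast
  have "hcomult H v = (\<Sum>i<n. tens (G (a i)) (G (b i)))"
    using *(2) unfolding inv[OF v, symmetric] .
  moreover have "(\<Sum>i<n. tens (G (a i)) (G (b i))) \<in> tensor_space V V"
    by (rule fvs.subspace_sum[OF subspace_tensor_space])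
       (simp add: tens_in_tensor_space G_in *(1))
  ultimately show "hcomult H v \<in> tensor_space V V" by simp
next
  fix v w assume "v \<in> V" "w \<in> V"
  thus "hcomult H (v + w) = hcomult H v + hcomult H w"
    by (simp add: comult fvs.subspace_add[OF sub] linear_onD(2)[OF lin] F_in
        linear_onD(2)[OF K.comult_linear] pull_add)
next
  fix c v assume "v \<in> V"
  thus "hcomult H (fscale c v) = fscale c (hcomult H v)"
    by (simp add: comult fvs.subspace_scale[OF sub] linear_onD(3)[OF lin] F_in
        linear_onD(3)[OF K.comult_linear] pull_fscale)
qed

text \<open>Both sides of an axiom of the form ``a bilinear map applied to the coproduct'' are evaluated
  on one expansion of the coproduct, which serves \<open>K\<close> and, pulled back, \<open>H\<close>.\<close>

lemma lift_transport:
  assumes x: "x \<in> V" and b: "bilinear_on W W \<beta>" and b': "bilinear_on V V \<beta>'"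
    and eq: "\<And>a b. a \<in> W \<Longrightarrow> b \<in> W \<Longrightarrow> \<beta>' (G a) (G b) = pull E q (\<beta> a b)"
  shows "tensor_lift V V \<beta>' (hcomult H x) = pull E q (tensor_lift W W \<beta> (hcomult K (F x)))"
proof -
  obtain n :: nat and a b where *: "\<forall>i<n. a i \<in> W \<and> b i \<in> W"
    "hcomult K (F x) = (\<Sum>i<n. tens (a i) (b i))"
    "hcomult H (G (F x)) = (\<Sum>i<n. tens (G (a i)) (G (b i)))"
    using G_tensor_expansion[OF F_in[OF x]] by blast
  have "hcomult H x = (\<Sum>i<n. tens (G (a i)) (G (b i)))"
    using *(3) unfolding inv[OF x, symmetric] .
  hence "tensor_lift V V \<beta>' (hcomult H x) = (\<Sum>i<n. \<beta>' (G (a i)) (G (b i)))"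
    using * by (simp only:) (rule tensor_lift_eq[OF sub sub b'], simp add: G_in)
  also have "\<dots> = pull E q (\<Sum>i<n. \<beta> (a i) (b i))"
    using *(1) by (simp add: pull_sum eq)
  also have "(\<Sum>i<n. \<beta> (a i) (b i)) = tensor_lift W W \<beta> (hcomult K (F x))"
    unfolding *(2) using *(1) by (intro tensor_lift_eq[symmetric, OF subK subK b]) auto
  finally show ?thesis .
qed

lemmas K_comult_add = linear_onD(2)[OF K.comult_linear]
lemmas K_comult_scale = linear_onD(3)[OF K.comult_linear]
lemmas H_comult_add = linear_onD(2)[OF comult_linear_H]
lemmas H_comult_scale = linear_onD(3)[OF comult_linear_H]
lemmas K_mult_bi = bilinear_onD[OF K.mult_bilinear]

lemma F_add: "x \<in> V \<Longrightarrow> y \<in> V \<Longrightarrow> F (x + y) = F x + F y"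
  and F_scale: "x \<in> V \<Longrightarrow> F (fscale c x) = fscale c (F x)"
  by (simp_all add: linear_onD[OF lin])

lemma mult_bilinear_H: "bilinear_on V V (hmult H)"
  by (rule bilinear_onI)
     (simp_all add: mult fvs.subspace_add[OF sub] fvs.subspace_scale[OF sub] F_add F_scale
        K_mult_bi F_in pull_add pull_fscale)

lemma unital_algebra_H: "unital_algebra H"
proof
  fix x y z assume "x \<in> V" "y \<in> V" "z \<in> V"
  thus "hmult H (hmult H x y) z = hmult H x (hmult H y z)"
    by (simp add: mult[OF mult_in] mult[OF _ mult_in] F_mult K.mult_assoc F_in)
next
  fix x assume x: "x \<in> V"
  show "hmult H (hunit H) x = x" and "hmult H x (hunit H) = x"
    using inv[OF x] by (simp_all add: mult x unit_in F_unit K.unit_left K.unit_right F_in)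
qed (simp_all add: sub mult_in mult_bilinear_H unit_in)

lemmas counit_K = K.counit_linear[unfolded linear_form_on_def]

lemma counital_coalgebra_H: "counital_coalgebra H"
proof
  show "fvs.subspace V" by (rule sub)
  show "linear_on V (tensor_space V V) (hcomult H)" by (rule comult_linear_H)
  show cl: "linear_form_on V (hcounit H)"
    using counit_K by (auto simp: linear_form_on_def counit F_add F_scale F_in
        fvs.subspace_add[OF sub] fvs.subspace_scale[OF sub])
  fix x assume x: "x \<in> V"
  have "tensor_lift V V (\<lambda>a b. reassoc (tens (hcomult H a) b)) (hcomult H x) =
      pull (D \<times> D \<times> D) (map_prod p (map_prod p p))
        (tensor_lift W W (\<lambda>a b. reassoc (tens (hcomult K a) b)) (hcomult K (F x)))"
    by (rule lift_transport[OF x])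
       (auto intro!: bilinear_onI simp: tens_simps tens_simps' reassoc_simps K_comult_add K_comult_scale H_comult_add
         H_comult_scale comult_G pull_reassoc pull_tens)
  also have "\<dots> = pull (D \<times> D \<times> D) (map_prod p (map_prod p p))
        (tensor_lift W W (\<lambda>a b. tens a (hcomult K b)) (hcomult K (F x)))"
    by (simp add: K.coassoc F_in x)
  also have "\<dots> = tensor_lift V V (\<lambda>a b. tens a (hcomult H b)) (hcomult H x)"
    by (rule lift_transport[OF x, symmetric])
       (auto intro!: bilinear_onI simp: tens_simps tens_simps' reassoc_simps K_comult_add K_comult_scale H_comult_add
         H_comult_scale comult_G pull_tens)
  finally show "tensor_lift V V (\<lambda>a b. reassoc (tens (hcomult H a) b)) (hcomult H x) =
    tensor_lift V V (\<lambda>a b. tens a (hcomult H b)) (hcomult H x)" .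
  have cK: "hcounit K (a + b) = hcounit K a + hcounit K b" "hcounit K (fscale c a) = c * hcounit K a"
    if "a \<in> W" "b \<in> W" for a b c using counit_K that by auto
  have cH: "hcounit H (a + b) = hcounit H a + hcounit H b" "hcounit H (fscale c a) = c * hcounit H a"
    if "a \<in> V" "b \<in> V" for a b c using cl that by (auto simp: linear_form_on_def)
  have "tensor_lift V V (\<lambda>a b. fscale (hcounit H a) b) (hcomult H x) =
    pull D p (tensor_lift W W (\<lambda>a b. fscale (hcounit K a) b) (hcomult K (F x)))"
    by (rule lift_transport[OF x])
       (auto intro!: bilinear_onI simp: fscale_simps cK cH mult.commute counit G_in FG pull_fscale)
  thus "tensor_lift V V (\<lambda>a b. fscale (hcounit H a) b) (hcomult H x) = x"
    using inv[OF x] by (simp add: K.counit_left F_in x)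
  have "tensor_lift V V (\<lambda>a b. fscale (hcounit H b) a) (hcomult H x) =
    pull D p (tensor_lift W W (\<lambda>a b. fscale (hcounit K b) a) (hcomult K (F x)))"
    by (rule lift_transport[OF x])
       (auto intro!: bilinear_onI simp: fscale_simps cK cH mult.commute counit G_in FG pull_fscale)
  thus "tensor_lift V V (\<lambda>a b. fscale (hcounit H b) a) (hcomult H x) = x"
    using inv[OF x] by (simp add: K.counit_right F_in x)
qed

interpretation H: unital_algebra H by (rule unital_algebra_H)
interpretation H: counital_coalgebra H by (rule counital_coalgebra_H)

lemma bialgebra_H: "bialgebra H"
proof
  fix x y assume x: "x \<in> V" and y: "y \<in> V"
  obtain n :: nat and a b where ab: "\<forall>i<n. a i \<in> W \<and> b i \<in> W"
    "hcomult K (F x) = (\<Sum>i<n. tens (a i) (b i))"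
    "hcomult H (G (F x)) = (\<Sum>i<n. tens (G (a i)) (G (b i)))"
    using G_tensor_expansion[OF F_in[OF x]] by blast
  obtain m :: nat and c d where cd: "\<forall>i<m. c i \<in> W \<and> d i \<in> W"
    "hcomult K (F y) = (\<Sum>i<m. tens (c i) (d i))"
    "hcomult H (G (F y)) = (\<Sum>i<m. tens (G (c i)) (G (d i)))"
    using G_tensor_expansion[OF F_in[OF y]] by blast
  have "hcomult H (hmult H x y) = pull (D \<times> D) (map_prod p p) (hcomult K (hmult K (F x) (F y)))"
    by (simp add: comult mult_in x y F_mult)
  also have "hcomult K (hmult K (F x) (F y)) =
      (\<Sum>i<n. \<Sum>j<m. tens (hmult K (a i) (c j)) (hmult K (b i) (d j)))"
    unfolding K.comult_mult[OF F_in[OF x] F_in[OF y]] ab cd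
    using ab(1) cd(1) by (intro K.tensor_mult_expansion) auto
  also have "pull (D \<times> D) (map_prod p p) \<dots> =
      (\<Sum>i<n. \<Sum>j<m. tens (hmult H (G (a i)) (G (c j))) (hmult H (G (b i)) (G (d j))))"
    using ab(1) cd(1) by (simp add: pull_sum pull_tens mult_GG)
  also have "\<dots> = tensor_mult H (hcomult H (G (F x))) (hcomult H (G (F y)))"
    unfolding ab cd using ab(1) cd(1)
    by (intro H.tensor_mult_expansion[symmetric]) (auto simp: G_in)
  also have "\<dots> = tensor_mult H (hcomult H x) (hcomult H y)"
    unfolding inv[OF x, symmetric] inv[OF y, symmetric] ..
  finally show "hcomult H (hmult H x y) = tensor_mult H (hcomult H x) (hcomult H y)" .
  show "hcounit H (hmult H x y) = hcounit H x * hcounit H y"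
    by (simp add: counit mult_in x y F_mult F_in K.counit_mult)
next
  show "hcomult H (hunit H) = tens (hunit H) (hunit H)"
    by (simp add: comult unit_in F_unit K.comult_unit pull_tens unit[symmetric])
  show "hcounit H (hunit H) = 1"
    by (simp add: counit unit_in F_unit K.counit_unit)
qed

lemma hopf_algebra_H: "hopf_algebra H"
proof -
  obtain S where S: "is_antipode K S" using K.antipode by blast
  hence Sl: "linear_on W W S" by (simp add: is_antipode_def)
  note S_simps = linear_onD[OF Sl]
  let ?S = "\<lambda>x. G (S (F x))"
  have S_in: "?S x \<in> V" if "x \<in> V" for x
    using that by (simp add: G_in S_simps F_in)
  have "is_antipode H ?S"
    unfolding is_antipode_def
  proof (intro conjI ballI)
    show "linear_on V V ?S"
      by (rule linear_onI) (simp_all add: S_in F_add F_scale S_simps F_in pull_add pull_fscale)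
    fix x assume x: "x \<in> V"
    have bi: "bilinear_on V V (\<lambda>a b. hmult H (?S a) b)" "bilinear_on V V (\<lambda>a b. hmult H a (?S b))"
      "bilinear_on W W (\<lambda>a b. hmult K (S a) b)" "bilinear_on W W (\<lambda>a b. hmult K a (S b))"
      by (auto intro!: bilinear_onI simp: S_in F_add F_scale S_simps F_in pull_add pull_fscale
          bilinear_onD[OF mult_bilinear_H] K_mult_bi G_in)
    have "tensor_lift V V (\<lambda>a b. hmult H (?S a) b) (hcomult H x) =
        pull D p (tensor_lift W W (\<lambda>a b. hmult K (S a) b) (hcomult K (F x)))"
      by (rule lift_transport[OF x bi(3) bi(1)]) (simp add: FG mult_GG S_simps)
    thus "tensor_lift V V (\<lambda>a b. hmult H (?S a) b) (hcomult H x) =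
        fscale (hcounit H x) (hunit H)"
      using S by (simp add: is_antipode_def F_in x pull_fscale unit counit)
    have "tensor_lift V V (\<lambda>a b. hmult H a (?S b)) (hcomult H x) =
        pull D p (tensor_lift W W (\<lambda>a b. hmult K a (S b)) (hcomult K (F x)))"
      by (rule lift_transport[OF x bi(4) bi(2)]) (simp add: FG mult_GG S_simps)
    thus "tensor_lift V V (\<lambda>a b. hmult H a (?S b)) (hcomult H x) =
        fscale (hcounit H x) (hunit H)"
      using S by (simp add: is_antipode_def F_in x pull_fscale unit counit)
  qed
  thus ?thesis
    using bialgebra_H by (simp add: hopf_algebra_def hopf_algebra_axioms_def) blast
qed

lemma hopf_isomorphism_F: "hopf_isomorphism H K F"
  unfolding hopf_isomorphism_def
proof (intro conjI ballI lin bij F_unit)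
  fix x assume x: "x \<in> V"
  show "hcounit K (F x) = hcounit H x" by (simp add: counit x)
  fix y assume y: "y \<in> V"
  show "F (hmult H x y) = hmult K (F x) (F y)" by (simp add: F_mult x y)
next
  fix x assume x: "x \<in> V"
  obtain n :: nat and a b where ab: "\<forall>i<n. a i \<in> W \<and> b i \<in> W"
    "hcomult K (F x) = (\<Sum>i<n. tens (a i) (b i))"
    "hcomult H (G (F x)) = (\<Sum>i<n. tens (G (a i)) (G (b i)))"
    using G_tensor_expansion[OF F_in[OF x]] by blast
  have "hcomult H x = (\<Sum>i<n. tens (G (a i)) (G (b i)))"
    using ab(3) unfolding inv[OF x, symmetric] .
  hence "tensor_lift V V (\<lambda>a b. tens (F a) (F b)) (hcomult H x) =
      (\<Sum>i<n. tens (F (G (a i))) (F (G (b i))))"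
    using ab(1) by (simp only:) (rule tensor_lift_eq[OF sub sub],
       auto intro!: bilinear_onI simp: tens_simps tens_simps' F_add F_scale G_in)
  thus "hcomult K (F x) = tensor_lift V V (\<lambda>a b. tens (F a) (F b)) (hcomult H x)"
    using ab(1) by (simp add: FG ab(2))
qed

end

section \<open>Summation over shuffles\<close>

text \<open>The sum of \<open>f\<close> over all shuffles of two words, counted with multiplicity: equal letters of the two
  words still give different shuffles. The recursion on first letters turns identities between sums over
  shuffles into inductions.\<close>

fun shuf_sum :: "('a list \<Rightarrow> complex) \<Rightarrow> 'a list \<Rightarrow> 'a list \<Rightarrow> complex" where
  "shuf_sum f [] v = f v"
| "shuf_sum f (x # u) [] = f (x # u)"
| "shuf_sum f (x # u) (y # v) =
     shuf_sum (\<lambda>w. f (x # w)) u (y # v) + shuf_sum (\<lambda>w. f (y # w)) (x # u) v"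

lemma shuf_sum_Nil2 [simp]: "shuf_sum f u [] = f u"
  by (cases u) auto

lemma shuf_sum_Nil1: "shuf_sum f [] = f"
  by (rule ext) simp

text \<open>For fixed words this is a finite sum of evaluations, so it commutes with additive functionals.\<close>

lemma shuf_sum_additive:
  assumes A: "\<And>g h. A (\<lambda>z. g z + h z) = A g + A h"
  shows "shuf_sum (\<lambda>w. A (h w)) u v = A (\<lambda>z. shuf_sum (\<lambda>w. h w z) u v)"
  by (induction u v arbitrary: h rule: shuffles.induct) (simp_all add: A)

lemma shuf_sum_add: "shuf_sum (\<lambda>w. f w + g w) u v = shuf_sum f u v + shuf_sum g u v"
  by (induction f u v arbitrary: g rule: shuf_sum.induct) simp_all

lemma shuf_sum_cmult: "shuf_sum (\<lambda>w. c * f w) u v = c * shuf_sum f u v"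
  by (induction f u v rule: shuf_sum.induct) (simp_all add: algebra_simps)

lemma shuf_sum_zero [simp]: "shuf_sum (\<lambda>w. 0) u v = 0"
  using shuf_sum_cmult[of 0 "\<lambda>w. 0" u v] by simp

lemma shuf_sum_cong:
  assumes "\<And>w. length w = length u + length v \<Longrightarrow> set w = set u \<union> set v \<Longrightarrow> f w = g w"
  shows "shuf_sum f u v = shuf_sum g u v"
  using assms
proof (induction f u v arbitrary: g rule: shuf_sum.induct)
  case (3 f x u y v)
  have "shuf_sum (\<lambda>w. f (x # w)) u (y # v) = shuf_sum (\<lambda>w. g (x # w)) u (y # v)"
    by (rule 3(1)) (auto intro!: 3(3))
  moreover have "shuf_sum (\<lambda>w. f (y # w)) (x # u) v = shuf_sum (\<lambda>w. g (y # w)) (x # u) v"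
    by (rule 3(2)) (auto intro!: 3(3))
  ultimately show ?case by simp
qed auto

lemma shuf_sum_map: "shuf_sum f (map h u) (map h v) = shuf_sum (\<lambda>w. f (map h w)) u v"
  by (induction u v arbitrary: f rule: shuffles.induct) simp_all

text \<open>The first letter of a shuffle of three words is the first letter of one of them, in either
  bracketing.\<close>

lemma shuf_sum_assoc:
  "shuf_sum (\<lambda>s. shuf_sum f s w) u v = shuf_sum (\<lambda>s. shuf_sum f u s) v w"
proof (induction "length u + length v + length w" arbitrary: u v w f rule: less_induct)
  case less
  show ?case
  proof (cases "u = [] \<or> v = [] \<or> w = []")
    case True
    thus ?thesis by (auto simp: shuf_sum_Nil1)
  next
    case False
    then obtain x u' y v' z w' where [simp]: "u = x # u'" "v = y # v'" "w = z # w'"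
      by (metis neq_Nil_conv)
    have 1: "shuf_sum (\<lambda>s. shuf_sum (\<lambda>t. f (x # t)) s w) u' v =
          shuf_sum (\<lambda>s. shuf_sum (\<lambda>t. f (x # t)) u' s) v w" by (rule less) simp
    have 2: "shuf_sum (\<lambda>s. shuf_sum (\<lambda>t. f (y # t)) s w) u v' =
          shuf_sum (\<lambda>s. shuf_sum (\<lambda>t. f (y # t)) u s) v' w" by (rule less) simp
    have 3: "shuf_sum (\<lambda>s. shuf_sum (\<lambda>t. f (z # t)) s w') u v =
          shuf_sum (\<lambda>s. shuf_sum (\<lambda>t. f (z # t)) u s) v w'" by (rule less) simp
    show ?thesis
      using 1 2 3 by (simp add: shuf_sum_add algebra_simps)
  qed
qed

lemma NPS_mult_Nil [simp]: "NPS_mult f g [] = f [] * g []"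
  by (simp add: NPS_mult_def)

lemma NPS_mult_Cons:
  "NPS_mult f g (x # w) = f [] * g (x # w) + NPS_mult (\<lambda>v. f (x # v)) g w"
  by (simp add: NPS_mult_def sum.atMost_Suc_shift del: sum.atMost_Suc)

text \<open>Cutting a shuffle of two words cuts both words, and the two parts are shuffles of the
  corresponding pieces. This is the compatibility of product and coproduct.\<close>

lemma shuf_sum_NPS_mult:
  "shuf_sum (NPS_mult f g) u v =
     (\<Sum>k\<le>length u. \<Sum>l\<le>length v.
        shuf_sum f (take k u) (take l v) * shuf_sum g (drop k u) (drop l v))"
proof (induction "length u + length v" arbitrary: u v f rule: less_induct)
  case less
  show ?case
  proof (cases "u = [] \<or> v = []")
    case True
    thus ?thesis by (auto simp: NPS_mult_def)
  next
    case False
    then obtain x u' y v' where uv: "u = x # u'" "v = y # v'"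
      by (metis neq_Nil_conv)
    have 1: "shuf_sum (NPS_mult (\<lambda>v. f (x # v)) g) u' v =
     (\<Sum>k\<le>length u'. \<Sum>l\<le>length v.
        shuf_sum (\<lambda>v. f (x # v)) (take k u') (take l v) * shuf_sum g (drop k u') (drop l v))"
      by (rule less) (simp add: uv)
    have 2: "shuf_sum (NPS_mult (\<lambda>v. f (y # v)) g) u v' =
     (\<Sum>k\<le>length u. \<Sum>l\<le>length v'.
        shuf_sum (\<lambda>v. f (y # v)) (take k u) (take l v') * shuf_sum g (drop k u) (drop l v'))"
      by (rule less) (simp add: uv)
    have "shuf_sum (NPS_mult f g) u v = f [] * shuf_sum g u v +
       shuf_sum (NPS_mult (\<lambda>v. f (x # v)) g) u' v + shuf_sum (NPS_mult (\<lambda>v. f (y # v)) g) u v'"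
      by (simp add: uv NPS_mult_Cons shuf_sum_add shuf_sum_cmult algebra_simps)
    also have "\<dots> = (\<Sum>k\<le>length u. \<Sum>l\<le>length v.
        shuf_sum f (take k u) (take l v) * shuf_sum g (drop k u) (drop l v))"
      unfolding 1 2 unfolding uv
      by (simp add: sum.atMost_Suc_shift sum.distrib algebra_simps del: sum.atMost_Suc)
    finally show ?thesis .
  qed
qed

section \<open>Words and renaming of variables\<close>

abbreviation var_words :: "nat \<Rightarrow> nc_var list set" where
  "var_words r \<equiv> {w. set w \<subseteq> range Xvar \<union> Yvar ` {..<r}}"

lemma var_words_nth: "w \<in> var_words r \<Longrightarrow> i < length w \<Longrightarrow> w ! i \<in> range Xvar \<union> Yvar ` {..<r}"
  by (rule subsetD[OF _ nth_mem]) simp_all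

definition renaming_invariant :: "(nc_var list \<Rightarrow> complex) \<Rightarrow> bool" where
  "renaming_invariant f \<longleftrightarrow> (\<forall>\<rho> w. inj \<rho> \<longrightarrow> f (map (act_var \<rho>) w) = f w)"

lemma renaming_invariantD: "renaming_invariant f \<Longrightarrow> inj \<rho> \<Longrightarrow> f (map (act_var \<rho>) w) = f w"
  by (simp add: renaming_invariant_def)

lemma act_var_comp [simp]: "act_var \<sigma> (act_var \<rho> x) = act_var (\<sigma> \<circ> \<rho>) x"
  by (cases x) auto

lemma act_var_comp' [simp]: "act_var \<sigma> \<circ> act_var \<rho> = act_var (\<sigma> \<circ> \<rho>)"
  by auto

lemma act_var_in [simp]:
  "act_var \<sigma> x \<in> range Xvar \<union> Yvar ` {..<r} \<longleftrightarrow> x \<in> range Xvar \<union> Yvar ` {..<r}"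
  by (cases x) auto

lemma map_act_var_in_words [simp]: "map (act_var \<sigma>) w \<in> var_words r \<longleftrightarrow> w \<in> var_words r"
  unfolding mem_Collect_eq subset_iff set_map by (metis (no_types) act_var_in image_iff)

text \<open>The parts of \<open>A \<union> \<rho> ` A\<close> outside \<open>A\<close> and outside \<open>\<rho> ` A\<close> have equal size, so a bijection between them
  completes \<open>\<rho>\<close>.\<close>

lemma finite_perm_extends:
  assumes fin: "finite A" and inj: "inj_on \<rho> A"
  obtains \<sigma> where "finite_perm \<sigma>" "\<And>i. i \<in> A \<Longrightarrow> \<sigma> i = \<rho> i"
proof -
  let ?B = "A \<union> \<rho> ` A"
  have "card (?B - A) = card (?B - \<rho> ` A)"
    using fin card_image[OF inj] by (simp add: card_Diff_subset)
  then obtain h where h: "bij_betw h (?B - A) (?B - \<rho> ` A)"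
    using fin finite_same_card_bij[of "?B - A" "?B - \<rho> ` A"] by auto
  define \<sigma> where "\<sigma> i = (if i \<in> A then \<rho> i else if i \<in> ?B then h i else i)" for i
  have 1: "bij_betw \<sigma> A (\<rho> ` A)"
    using inj by (auto simp: \<sigma>_def bij_betw_def inj_on_def)
  have 2: "bij_betw \<sigma> (?B - A) (?B - \<rho> ` A)"
    using h by (subst bij_betw_cong[of _ _ h]) (auto simp: \<sigma>_def)
  have 3: "bij_betw \<sigma> (- ?B) (- ?B)"
    by (subst bij_betw_cong[of _ _ id]) (auto simp: \<sigma>_def)
  have "bij_betw \<sigma> (A \<union> (?B - A)) (\<rho> ` A \<union> (?B - \<rho> ` A))"
    by (rule bij_betw_combine[OF 1 2]) auto
  hence "bij_betw \<sigma> ?B ?B" by (simp add: Un_absorb1 Un_commute)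
  hence "bij_betw \<sigma> (?B \<union> - ?B) (?B \<union> - ?B)" by (rule bij_betw_combine[OF _ 3]) blast
  hence "bij \<sigma>" by (simp only: Compl_partition)
  moreover have "{i. \<sigma> i \<noteq> i} \<subseteq> ?B" by (auto simp: \<sigma>_def)
  hence "finite {i. \<sigma> i \<noteq> i}" using fin by (meson finite_UnI finite_imageI finite_subset)
  moreover have "\<sigma> i = \<rho> i" if "i \<in> A" for i using that by (simp add: \<sigma>_def)
  ultimately show thesis by (intro that[of \<sigma>]) (simp_all add: finite_perm_def)
qed

lemma map_act_var_cong:
  "(\<And>i. Xvar i \<in> set w \<Longrightarrow> \<sigma> i = \<rho> i) \<Longrightarrow> map (act_var \<sigma>) w = map (act_var \<rho>) w"
  by (rule map_cong[OF refl]) (metis act_var.simps nc_var.exhaust)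

lemma finite_Xvar_indices: "finite {i. Xvar i \<in> set w}"
  by (rule finite_vimageI[of "set w" Xvar, unfolded vimage_def]) (auto simp: inj_def)

text \<open>On one word, an injective renaming agrees with a finite permutation.\<close>

lemma renaming_invariantI:
  assumes "\<And>\<sigma> w. finite_perm \<sigma> \<Longrightarrow> f (map (act_var \<sigma>) w) = f w"
  shows "renaming_invariant f"
  unfolding renaming_invariant_def
proof (intro allI impI)
  fix \<rho> :: "nat \<Rightarrow> nat" and w assume "inj \<rho>"
  then obtain \<sigma> where "finite_perm \<sigma>" "\<And>i. i \<in> {i. Xvar i \<in> set w} \<Longrightarrow> \<sigma> i = \<rho> i"
    using finite_perm_extends[OF finite_Xvar_indices] by (metis inj_on_subset subset_UNIV)
  thus "f (map (act_var \<rho>) w) = f w"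
    using assms[of \<sigma> w] map_act_var_cong[of w \<sigma> \<rho>] by simp
qed

lemma NPS_space_iff:
  "f \<in> NPS_space r \<longleftrightarrow> (\<forall>w. w \<notin> var_words r \<longrightarrow> f w = 0) \<and>
     (\<exists>N. \<forall>w. length w > N \<longrightarrow> f w = 0) \<and> renaming_invariant f"
  (is "_ \<longleftrightarrow> ?A \<and> ?B \<and> ?C")
proof
  assume f: "f \<in> NPS_space r"
  show "?A \<and> ?B \<and> ?C"
  proof (intro conjI)
    show ?A using f unfolding NPS_space_def by blast
    from f obtain N where "\<forall>w. f w \<noteq> 0 \<longrightarrow> length w \<le> N" unfolding NPS_space_def by blast
    thus ?B by (intro exI[of _ N]) (metis not_less)
    show ?C using f unfolding NPS_space_def by (intro renaming_invariantI) blast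
  qed
next
  assume *: "?A \<and> ?B \<and> ?C"
  then obtain N where N: "\<forall>w. length w > N \<longrightarrow> f w = 0" by blast
  show "f \<in> NPS_space r"
    unfolding NPS_space_def mem_Collect_eq
  proof (intro conjI allI impI)
    fix w assume "f w \<noteq> 0"
    thus "set w \<subseteq> range Xvar \<union> Yvar ` {..<r}" using * by blast
  next
    show "\<exists>N. \<forall>w. f w \<noteq> 0 \<longrightarrow> length w \<le> N" using N by (metis not_less)
  next
    fix \<sigma> w assume "finite_perm \<sigma>"
    hence "inj \<sigma>" by (simp add: finite_perm_def bij_is_inj)
    with * show "f (map (act_var \<sigma>) w) = f w" by (simp add: renaming_invariant_def)
  qed
qed

lemma NPS_spaceD:
  assumes "f \<in> NPS_space r"
  shows "w \<notin> var_words r \<Longrightarrow> f w = 0" "renaming_invariant f"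
    "\<exists>N. \<forall>w. length w > N \<longrightarrow> f w = 0"
  using assms unfolding NPS_space_iff by blast+

lemma subspace_NPS_space: "fvs.subspace (NPS_space r)"
proof (rule fvs.subspaceI)
  fix f g assume f: "f \<in> NPS_space r" and g: "g \<in> NPS_space r"
  obtain N M where "\<forall>w. length w > N \<longrightarrow> f w = 0" "\<forall>w. length w > M \<longrightarrow> g w = 0"
    using NPS_spaceD(3) f g by metis
  hence "\<exists>N. \<forall>w. length w > N \<longrightarrow> (f + g) w = 0" by (intro exI[of _ "max N M"]) auto
  with f g show "f + g \<in> NPS_space r"
    unfolding NPS_space_iff renaming_invariant_def by simp
qed (auto simp: NPS_space_iff renaming_invariant_def fscale_apply)

section \<open>The coproduct of words\<close>

text \<open>Letting the variables \<open>X\<close> split into two disjoint commuting copies, here the even and the odd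
  ones, is the coproduct of symmetric functions. Each \<open>Y\<close>-letter goes to either side.\<close>

definition evens :: "nc_var list \<Rightarrow> nc_var list" where
  "evens = map (act_var (\<lambda>i. 2 * i))"

definition odds :: "nc_var list \<Rightarrow> nc_var list" where
  "odds = map (act_var (\<lambda>i. 2 * i + 1))"

definition word_comult :: "(nc_var list \<Rightarrow> complex) \<Rightarrow> nc_var list \<times> nc_var list \<Rightarrow> complex" where
  "word_comult f = (\<lambda>(u, v). shuf_sum f (evens u) (odds v))"

lemma inj_evens: "inj (\<lambda>i::nat. 2 * i)" and inj_odds: "inj (\<lambda>i::nat. 2 * i + 1)"
  by (auto simp: inj_def)

lemma evens_Nil [simp]: "evens [] = []" and odds_Nil [simp]: "odds [] = []"
  and length_evens [simp]: "length (evens u) = length u"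
  and length_odds [simp]: "length (odds u) = length u"
  by (simp_all add: evens_def odds_def)

lemma word_comult_add: "word_comult (f + g) = word_comult f + word_comult g"
  and word_comult_fscale: "word_comult (fscale c f) = fscale c (word_comult f)"
  by (auto simp: word_comult_def fun_eq_iff shuf_sum_add shuf_sum_cmult fscale_def plus_fun_def)

lemma word_comult_Nil1: "renaming_invariant f \<Longrightarrow> word_comult f ([], v) = f v"
  and word_comult_Nil2: "renaming_invariant f \<Longrightarrow> word_comult f (u, []) = f u"
  by (simp_all add: word_comult_def evens_def odds_def renaming_invariantD inj_evens inj_odds
        del: One_nat_def)

lemma word_comult_additive:
  assumes A: "\<And>g h. A (\<lambda>z. g z + h z) = A g + A h"
  shows "word_comult (\<lambda>s. A (h s)) (u, v) = A (\<lambda>z. word_comult (\<lambda>s. h s z) (u, v))"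
  by (simp add: word_comult_def shuf_sum_additive[of A, OF A])

text \<open>Renaming only the even or only the odd variables is again injective, so the coproduct is
  invariant in each argument separately.\<close>

lemma word_comult_rename1:
  assumes f: "renaming_invariant f" and \<rho>: "inj \<rho>"
  shows "word_comult f (map (act_var \<rho>) u, v) = word_comult f (u, v)"
proof -
  define \<rho>' where "\<rho>' n = (if even n then 2 * \<rho> (n div 2) else n)" for n
  have "inj \<rho>'"
  proof (rule injI)
    fix a b assume eq: "\<rho>' a = \<rho>' b"
    moreover have "even (\<rho>' n) = even n" for n by (simp add: \<rho>'_def)
    ultimately have par: "even a = even b" by metis
    show "a = b"
    proof (cases "even a")
      case True
      with eq par have "\<rho> (a div 2) = \<rho> (b div 2)" by (simp add: \<rho>'_def)
      hence "a div 2 = b div 2" by (rule injD[OF \<rho>])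
      thus ?thesis using True par by presburger
    qed (use eq par in \<open>simp add: \<rho>'_def\<close>)
  qed
  have "evens (map (act_var \<rho>) u) = map (act_var \<rho>') (evens u)" "odds v = map (act_var \<rho>') (odds v)"
    by (auto simp: evens_def odds_def \<rho>'_def o_def)
  hence "word_comult f (map (act_var \<rho>) u, v) =
      shuf_sum f (map (act_var \<rho>') (evens u)) (map (act_var \<rho>') (odds v))"
    by (simp add: word_comult_def)
  also have "\<dots> = word_comult f (u, v)"
    by (simp add: word_comult_def shuf_sum_map renaming_invariantD[OF f \<open>inj \<rho>'\<close>])
  finally show ?thesis .
qed

lemma word_comult_rename2:
  assumes f: "renaming_invariant f" and \<rho>: "inj \<rho>"
  shows "word_comult f (u, map (act_var \<rho>) v) = word_comult f (u, v)"
proof -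
  define \<rho>' where "\<rho>' n = (if odd n then 2 * \<rho> (n div 2) + 1 else n)" for n
  have "inj \<rho>'"
  proof (rule injI)
    fix a b assume eq: "\<rho>' a = \<rho>' b"
    moreover have "even (\<rho>' n) = even n" for n by (simp add: \<rho>'_def)
    ultimately have par: "even a = even b" by metis
    show "a = b"
    proof (cases "odd a")
      case True
      with eq par have "\<rho> (a div 2) = \<rho> (b div 2)" by (simp add: \<rho>'_def)
      hence "a div 2 = b div 2" by (rule injD[OF \<rho>])
      thus ?thesis using True par by presburger
    qed (use eq par in \<open>simp add: \<rho>'_def\<close>)
  qed
  have "odds (map (act_var \<rho>) v) = map (act_var \<rho>') (odds v)" "evens u = map (act_var \<rho>') (evens u)"
    by (auto simp: evens_def odds_def \<rho>'_def o_def)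
  hence "word_comult f (u, map (act_var \<rho>) v) =
      shuf_sum f (map (act_var \<rho>') (evens u)) (map (act_var \<rho>') (odds v))"
    by (simp add: word_comult_def)
  also have "\<dots> = word_comult f (u, v)"
    by (simp add: word_comult_def shuf_sum_map renaming_invariantD[OF f \<open>inj \<rho>'\<close>])
  finally show ?thesis .
qed

lemma renaming_invariant_word_comult:
  assumes "renaming_invariant f"
  shows "renaming_invariant (\<lambda>u. word_comult f (u, v))" "renaming_invariant (\<lambda>v. word_comult f (u, v))"
  using word_comult_rename1[OF assms] word_comult_rename2[OF assms]
  by (auto simp: renaming_invariant_def)

text \<open>Splitting twice makes three disjoint copies of \<open>X\<close>, namely \<open>4i\<close>, \<open>4i + 2\<close>, \<open>2i + 1\<close> in one
  order of splitting and \<open>2i\<close>, \<open>4i + 1\<close>, \<open>4i + 3\<close> in the other.\<close>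

lemma word_comult_coassoc:
  assumes f: "renaming_invariant f"
  shows "word_comult (\<lambda>s. word_comult f (s, w)) (u, v) = word_comult (\<lambda>t. word_comult f (u, t)) (v, w)"
proof -
  \<comment> \<open>The renaming that takes the three copies of \<open>X\<close> in the first order to those in the second.\<close>
  define \<rho> :: "nat \<Rightarrow> nat" where
    "\<rho> n = (if n mod 4 = 0 then n div 2 else if n mod 4 = 2 then n - 1 else 2 * n + 1)" for n
  have \<rho>1: "\<rho> (4 * i) = 2 * i" and \<rho>2: "\<rho> (4 * i + 2) = 4 * i + 1"
    and \<rho>3: "\<rho> (2 * i + 1) = 4 * i + 3" for i
  proof -
    have "(2 * i + 1) mod 4 \<noteq> 0" "(2 * i + 1) mod 4 \<noteq> 2" by presburger+
    thus "\<rho> (2 * i + 1) = 4 * i + 3" by (simp add: \<rho>_def)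
    have "(4 * i + 2) mod 4 = 2" by presburger
    thus "\<rho> (4 * i + 2) = 4 * i + 1" by (simp add: \<rho>_def)
  qed (simp add: \<rho>_def)
  have "inj \<rho>"
  proof (rule injI)
    fix a b assume eq: "\<rho> a = \<rho> b"
    have cases4: "\<exists>k. n = 4 * k \<or> n = 4 * k + 2 \<or> n = 2 * k + 1" for n :: nat by presburger
    obtain k where k: "a = 4 * k \<or> a = 4 * k + 2 \<or> a = 2 * k + 1" using cases4 by blast
    obtain l where l: "b = 4 * l \<or> b = 4 * l + 2 \<or> b = 2 * l + 1" using cases4 by blast
    have "2 * k \<noteq> 4 * l + 1" "2 * k \<noteq> 4 * l + 3" "2 * l \<noteq> 4 * k + 1" "2 * l \<noteq> 4 * k + 3"
      "4 * k + 1 \<noteq> 4 * l + 3" "4 * k + 3 \<noteq> 4 * l + 1" by presburger+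
    thus "a = b"
      using k l eq by (elim disjE; hypsubst; simp only: \<rho>1 \<rho>2 \<rho>3; simp)
  qed
  have r1: "map (act_var \<rho>) (evens (evens u)) = evens u"
    using \<rho>1 by (simp add: evens_def o_def)
  have r2: "map (act_var \<rho>) (evens (odds v)) = odds (evens v)"
    using \<rho>2 by (simp add: evens_def odds_def o_def algebra_simps)
  have r3: "map (act_var \<rho>) (odds w) = odds (odds w)"
  proof -
    have "\<rho> \<circ> (\<lambda>i. 2 * i + 1) = (\<lambda>i. 2 * i + 1) \<circ> (\<lambda>i. 2 * i + 1)"
      by (rule ext) (simp only: o_def \<rho>3, simp)
    thus ?thesis by (simp only: odds_def map_map act_var_comp')
  qed
  have ev: "shuf_sum g (evens a) (evens b) = shuf_sum (\<lambda>s. g (evens s)) a b" for g a b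
    unfolding evens_def by (rule shuf_sum_map)
  have od: "shuf_sum g (odds a) (odds b) = shuf_sum (\<lambda>s. g (odds s)) a b" for g a b
    unfolding odds_def by (rule shuf_sum_map)
  have inv: "shuf_sum f (map (act_var \<rho>) a) (map (act_var \<rho>) b) = shuf_sum f a b" for a b
    by (simp add: shuf_sum_map renaming_invariantD[OF f \<open>inj \<rho>\<close>])
  have "word_comult (\<lambda>s. word_comult f (s, w)) (u, v) =
      shuf_sum (\<lambda>s. shuf_sum f s (odds w)) (evens (evens u)) (evens (odds v))"
    by (simp add: word_comult_def ev)
  also have "\<dots> = shuf_sum (\<lambda>s. shuf_sum f (map (act_var \<rho>) s) (map (act_var \<rho>) (odds w)))
                    (evens (evens u)) (evens (odds v))"
    by (simp add: inv)
  also have "\<dots> = shuf_sum (\<lambda>s. shuf_sum f s (map (act_var \<rho>) (odds w)))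
                    (map (act_var \<rho>) (evens (evens u))) (map (act_var \<rho>) (evens (odds v)))"
    by (simp add: shuf_sum_map)
  also have "\<dots> = shuf_sum (\<lambda>s. shuf_sum f s (odds (odds w))) (evens u) (odds (evens v))"
    by (simp only: r1 r2 r3)
  also have "\<dots> = shuf_sum (\<lambda>s. shuf_sum f (evens u) s) (odds (evens v)) (odds (odds w))"
    by (rule shuf_sum_assoc)
  also have "\<dots> = word_comult (\<lambda>t. word_comult f (u, t)) (v, w)"
    by (simp add: word_comult_def od)
  finally show ?thesis .
qed

lemma evens_take_drop: "evens (take k u) = take k (evens u)" "evens (drop k u) = drop k (evens u)"
  and odds_take_drop: "odds (take k u) = take k (odds u)" "odds (drop k u) = drop k (odds u)"
  by (simp_all add: evens_def odds_def take_map drop_map)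

lemma word_comult_mult:
  "word_comult (NPS_mult f g) (u, v) =
     (\<Sum>k\<le>length u. \<Sum>l\<le>length v.
        word_comult f (take k u, take l v) * word_comult g (drop k u, drop l v))"
  by (simp add: word_comult_def shuf_sum_NPS_mult evens_take_drop odds_take_drop)

lemma word_comult_eq_0:
  assumes "\<And>w. length w = length u + length v \<Longrightarrow> set w = set (evens u) \<union> set (odds v) \<Longrightarrow> f w = 0"
  shows "word_comult f (u, v) = 0"
proof -
  have "shuf_sum f (evens u) (odds v) = shuf_sum (\<lambda>_. 0) (evens u) (odds v)"
    by (rule shuf_sum_cong) (simp add: assms)
  thus ?thesis by (simp add: word_comult_def)
qed

lemma word_comult_not_words:
  assumes f: "\<And>w. w \<notin> var_words r \<Longrightarrow> f w = 0" and uv: "u \<notin> var_words r \<or> v \<notin> var_words r"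
  shows "word_comult f (u, v) = 0"
proof (rule word_comult_eq_0, rule f)
  fix w assume "set w = set (evens u) \<union> set (odds v)"
  moreover have "evens u \<notin> var_words r \<or> odds v \<notin> var_words r"
    unfolding evens_def odds_def map_act_var_in_words by (rule uv)
  ultimately show "w \<notin> var_words r" by auto
qed

section \<open>The antipode\<close>

text \<open>In degree \<open>n\<close> the equation \<open>S * id = \<epsilon>\<close> expresses \<open>S\<close> through its values in smaller degrees,
  because the coproduct of \<open>f\<close> contains \<open>f \<otimes> 1\<close>. So \<open>S\<close> is defined by recursion on the length of the
  word at which \<open>S f\<close> is evaluated.\<close>

function word_antipode :: "nc_var list \<Rightarrow> (nc_var list \<Rightarrow> complex) \<Rightarrow> complex" where
  "word_antipode w f = (if w = [] then f [] else
     - (\<Sum>k\<in>{..<length w}. word_antipode (take k w) (\<lambda>x. word_comult f (x, drop k w))))"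
  by pat_completeness auto
termination by (relation "measure (\<lambda>(w, f). length w)") auto

declare word_antipode.simps [simp del]

lemma word_antipode_Nil [simp]: "word_antipode [] f = f []"
  by (simp add: word_antipode.simps)

lemma word_antipode_add:
  "word_antipode w (\<lambda>z. f z + g z) = word_antipode w f + word_antipode w g"
proof (induction w arbitrary: f g rule: length_induct)
  case (1 w)
  have "word_comult (\<lambda>z. f z + g z) p = word_comult f p + word_comult g p" for p
    using fun_cong[OF word_comult_add[of f g], of p] by (simp add: plus_fun_def)
  with 1 show ?case
    by (cases "w = []") (simp_all add: word_antipode.simps[of w] sum.distrib)
qed

lemma word_antipode_cmult: "word_antipode w (\<lambda>z. c * f z) = c * word_antipode w f"
proof (induction w arbitrary: f rule: length_induct)
  case (1 w)
  have "word_comult (\<lambda>z. c * f z) p = c * word_comult f p" for p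
    using fun_cong[OF word_comult_fscale[of c f], of p] by (simp add: fscale_def)
  with 1 show ?case
    by (cases "w = []") (simp_all add: word_antipode.simps[of w] sum_distrib_left)
qed

lemma word_antipode_0: "word_antipode w (\<lambda>z. 0) = 0"
  using word_antipode_cmult[of w 0 "\<lambda>z. 0"] by simp

lemma word_antipode_sum:
  "word_antipode w (\<lambda>z. \<Sum>i\<in>I. f i z) = (\<Sum>i\<in>I. word_antipode w (f i))"
  by (induction I rule: infinite_finite_induct) (simp_all add: word_antipode_0 word_antipode_add)

text \<open>An operator on functions of words is given here by its values \<open>A w f\<close>, the value at \<open>w\<close> of the image
  of \<open>f\<close>; it then acts on all functions, and convolution needs no expansion of the coproduct into tensors.\<close>

definition convolution :: "(nc_var list \<Rightarrow> (nc_var list \<Rightarrow> complex) \<Rightarrow> complex) \<Rightarrow>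
    (nc_var list \<Rightarrow> (nc_var list \<Rightarrow> complex) \<Rightarrow> complex) \<Rightarrow>
    nc_var list \<Rightarrow> (nc_var list \<Rightarrow> complex) \<Rightarrow> complex" where
  "convolution A B w f =
     (\<Sum>k\<le>length w. A (take k w) (\<lambda>x. B (drop k w) (\<lambda>y. word_comult f (x, y))))"

abbreviation (input) word_id :: "nc_var list \<Rightarrow> (nc_var list \<Rightarrow> complex) \<Rightarrow> complex" where
  "word_id w f \<equiv> f w"

lemma antipode_left:
  assumes f: "renaming_invariant f"
  shows "convolution word_antipode word_id w f = (if w = [] then f [] else 0)"
proof (cases "w = []")
  case True
  thus ?thesis by (simp add: convolution_def word_comult_Nil1 f)
next
  case False
  have "convolution word_antipode word_id w f =
      (\<Sum>k<length w. word_antipode (take k w) (\<lambda>x. word_comult f (x, drop k w))) +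
      word_antipode w (\<lambda>x. word_comult f (x, []))"
    by (simp add: convolution_def lessThan_Suc_atMost[symmetric])
  also have "word_antipode w (\<lambda>x. word_comult f (x, [])) = word_antipode w f"
    by (simp add: word_comult_Nil2 f)
  also have "\<dots> = - (\<Sum>k<length w. word_antipode (take k w) (\<lambda>x. word_comult f (x, drop k w)))"
    using False by (simp add: word_antipode.simps[of w])
  finally show ?thesis using False by simp
qed

text \<open>Both sides sum over the cuts of \<open>w\<close> into three pieces, and coassociativity identifies the summands.\<close>

lemma convolution_assoc:
  assumes A_add: "\<And>w g h. A w (\<lambda>z. g z + h z) = A w g + A w h" and A0: "\<And>w. A w (\<lambda>z. 0) = 0"
    and f: "renaming_invariant f"
  shows "convolution (convolution A word_id) A w f = convolution A (convolution word_id A) w f"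
proof -
  have A_sum: "A w (\<lambda>z. \<Sum>i\<in>I. g i z) = (\<Sum>i\<in>I. A w (g i))" for w I and g :: "nat \<Rightarrow> _"
    by (induction I rule: infinite_finite_induct) (simp_all add: A0 A_add)
  \<comment> \<open>The contribution of the cut into pieces of lengths \<open>j\<close>, \<open>l\<close> and the rest.\<close>
  define T where "T j l = A (take j w) (\<lambda>x. A (drop l (drop j w))
      (\<lambda>z. word_comult (\<lambda>s. word_comult f (s, z)) (x, take l (drop j w))))" for j l
  have "convolution (convolution A word_id) A w f = (\<Sum>k\<le>length w. \<Sum>j\<le>k. T j (k - j))"
  proof (unfold convolution_def, rule sum.cong[OF refl], goal_cases)
    case (1 k)
    hence k: "k \<le> length w" by simp
    have "word_comult (\<lambda>s. A (drop k w) (\<lambda>z. word_comult f (s, z))) (x, y) =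
        A (drop k w) (\<lambda>z. word_comult (\<lambda>s. word_comult f (s, z)) (x, y))" for x y
      by (rule word_comult_additive[of "A (drop k w)"]) (rule A_add)
    thus ?case
      using k by (auto simp: T_def min_def drop_take intro!: sum.cong)
  qed
  also have "\<dots> = (\<Sum>(j, l)\<in>{(j, l). j + l \<le> length w}. T j l)"
    by (rule sum.triangle_reindex_eq[symmetric])
  also have "\<dots> = (\<Sum>(j, l)\<in>(SIGMA j:{..length w}. {..length w - j}). T j l)"
    by (rule sum.cong) auto
  also have "\<dots> = (\<Sum>j\<le>length w. \<Sum>l\<le>length w - j. T j l)"
    by (rule sum.Sigma[symmetric]) auto
  also have "\<dots> = convolution A (convolution word_id A) w f"
    unfolding convolution_def T_def by (simp add: A_sum word_comult_coassoc[OF f])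
  finally show ?thesis .
qed

text \<open>A left inverse of the identity is a right inverse: evaluating \<open>S * id * S\<close> in both ways gives
  \<open>S * (id * S - \<epsilon>) = 0\<close>, and by induction on the degree only the term \<open>id * S - \<epsilon>\<close> itself is left.\<close>

lemma antipode_right:
  assumes "renaming_invariant f"
  shows "convolution word_id word_antipode w f = (if w = [] then f [] else 0)"
  using assms
proof (induction w arbitrary: f rule: length_induct)
  case (1 w)
  note f = \<open>renaming_invariant f\<close>
  note inv = renaming_invariant_word_comult[OF f]
  show ?case
  proof (cases "w = []")
    case True
    thus ?thesis by (simp add: convolution_def word_comult_Nil1 f)
  next
    case False
    then obtain n where n: "length w = Suc n" by (cases w) auto
    have "convolution (convolution word_antipode word_id) word_antipode w f =
      (\<Sum>k\<le>length w. if k = 0 then word_antipode w f else 0)"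
    proof (subst convolution_def, rule sum.cong[OF refl], goal_cases)
      case (1 k)
      have "renaming_invariant (\<lambda>x. word_antipode (drop k w) (\<lambda>y. word_comult f (x, y)))"
        using word_comult_rename1[OF f] by (simp add: renaming_invariant_def)
      from antipode_left[OF this, of "take k w"] show ?case
        using False by (auto simp: word_comult_Nil1 f)
    qed
    also have "\<dots> = word_antipode w f" by simp
    finally have l: "convolution (convolution word_antipode word_id) word_antipode w f = word_antipode w f" .
    have "convolution word_antipode (convolution word_id word_antipode) w f =
      (\<Sum>k\<le>length w. (if k = 0 then convolution word_id word_antipode w f else 0) +
          (if k = length w then word_antipode w f else 0))"
    proof (subst convolution_def, rule sum.cong[OF refl], goal_cases)
      case (1 k)
      hence k: "k \<le> length w" by simp
      consider "k = 0" | "k = length w" "k \<noteq> 0" | "0 < k" "k < length w" using k by linarith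
      thus ?case
      proof cases
        case 1
        thus ?thesis using False by (simp add: word_comult_Nil1 f)
      next
        case 2
        thus ?thesis by (simp add: convolution_def word_comult_Nil1 word_comult_Nil2 f inv)
      next
        case 3
        \<comment> \<open>Here \<open>drop k w\<close> is nonempty and shorter than \<open>w\<close>, so the induction hypothesis applies.\<close>
        have "convolution word_id word_antipode (drop k w) (\<lambda>y. word_comult f (x, y)) = 0" for x
          using "1.IH"[rule_format, of "drop k w", OF _ inv(2)] 3 by simp
        thus ?thesis using 3 by (simp add: word_antipode_0)
      qed
    qed
    also have "\<dots> = convolution word_id word_antipode w f + word_antipode w f"
      by (simp add: sum.distrib)
    also have "convolution word_antipode (convolution word_id word_antipode) w f = word_antipode w f"
      using convolution_assoc[of word_antipode f w] l by (simp add: word_antipode_add word_antipode_0 f)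
    finally show ?thesis using False by simp
  qed
qed

lemma word_antipode_length:
  assumes "\<And>w'. length w' = length w \<Longrightarrow> f w' = 0"
  shows "word_antipode w f = 0"
  using assms
proof (induction w arbitrary: f rule: length_induct)
  case (1 w)
  have "word_antipode (take k w) (\<lambda>x. word_comult f (x, drop k w)) = 0" if k: "k < length w" for k
  proof (rule "1.IH"[rule_format])
    fix u :: "nc_var list" assume u: "length u = length (take k w)"
    show "word_comult f (u, drop k w) = 0"
      by (rule word_comult_eq_0, rule "1.prems") (use u k in simp)
  qed (use k in simp)
  thus ?case using "1.prems" by (cases "w = []") (simp_all add: word_antipode.simps[of w])
qed

lemma word_antipode_words:
  assumes "\<And>w. w \<notin> var_words r \<Longrightarrow> f w = 0" and "w \<notin> var_words r"
  shows "word_antipode w f = 0"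
  using assms
proof (induction w arbitrary: f rule: length_induct)
  case (1 w)
  have "word_antipode (take k w) (\<lambda>x. word_comult f (x, drop k w)) = 0" if "k < length w" for k
  proof (cases "drop k w \<in> var_words r")
    case True
    have "take k w \<notin> var_words r"
    proof
      assume "take k w \<in> var_words r"
      with True have "set (take k w @ drop k w) \<subseteq> range Xvar \<union> Yvar ` {..<r}"
        unfolding set_append by blast
      with "1.prems"(2) show False by simp
    qed
    show ?thesis
    proof (rule "1.IH"[rule_format])
      fix u :: "nc_var list" assume "u \<notin> var_words r"
      thus "word_comult f (u, drop k w) = 0"
        using word_comult_not_words[of r f u, OF "1.prems"(1)] by blast
    qed (use that \<open>take k w \<notin> var_words r\<close> in simp_all)
  next
    case False
    hence "word_comult f (x, drop k w) = 0" for x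
      using word_comult_not_words[of r f x, OF "1.prems"(1)] by blast
    thus ?thesis by (simp add: word_antipode_0)
  qed
  moreover have "w \<noteq> []" using "1.prems"(2) by auto
  ultimately show ?case by (simp add: word_antipode.simps[of w])
qed

lemma word_antipode_rename:
  assumes "renaming_invariant f" and "inj \<rho>"
  shows "word_antipode (map (act_var \<rho>) w) f = word_antipode w f"
  using assms(1)
proof (induction w arbitrary: f rule: length_induct)
  case (1 w)
  have "word_antipode (take k (map (act_var \<rho>) w))
          (\<lambda>x. word_comult f (x, drop k (map (act_var \<rho>) w))) =
        word_antipode (take k w) (\<lambda>x. word_comult f (x, drop k w))" if "k < length w" for k
  proof -
    have "word_antipode (map (act_var \<rho>) (take k w)) (\<lambda>x. word_comult f (x, drop k w)) =
        word_antipode (take k w) (\<lambda>x. word_comult f (x, drop k w))"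
      using that by (intro "1.IH"[rule_format] renaming_invariant_word_comult(1) "1.prems") simp
    thus ?thesis
      by (simp only: take_map drop_map word_comult_rename2[OF "1.prems" assms(2)])
  qed
  thus ?case
    by (cases "w = []") (simp_all add: word_antipode.simps[of w] word_antipode.simps[of "map _ w"])
qed

lemma word_antipode_NPS:
  assumes f: "f \<in> NPS_space r"
  shows "(\<lambda>w. word_antipode w f) \<in> NPS_space r"
proof -
  obtain N where N: "\<forall>w. length w > N \<longrightarrow> f w = 0" using NPS_spaceD(3)[OF f] by blast
  have "word_antipode w f = 0" if "length w > N" for w
    using that N by (intro word_antipode_length) simp
  moreover have "word_antipode w f = 0" if "w \<notin> var_words r" for w
    using word_antipode_words[OF NPS_spaceD(1)[OF f] that] .
  moreover have "renaming_invariant (\<lambda>w. word_antipode w f)"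
    using word_antipode_rename[OF NPS_spaceD(2)[OF f]] by (simp add: renaming_invariant_def)
  ultimately show ?thesis unfolding NPS_space_iff by blast
qed

section \<open>Shuffles indexed by subsets\<close>

lemma weave_insert_0:
  "weave (insert 0 (Suc ` A)) (x # u) v = x # weave A u v"
proof (rule nth_equalityI)
  fix i assume i: "i < length (weave (insert 0 (Suc ` A)) (x # u) v)"
  have c1: "card {a \<in> insert 0 (Suc ` A). a < Suc k} = Suc (card {a \<in> A. a < k})" for k
  proof -
    have "{a \<in> insert 0 (Suc ` A). a < Suc k} = insert 0 (Suc ` {a \<in> A. a < k})" by auto
    thus ?thesis by (simp add: card_image)
  qed
  have c2: "card {a \<in> - insert 0 (Suc ` A). a < Suc k} = card {a \<in> - A. a < k}" for k
  proof -
    have "{a \<in> - insert 0 (Suc ` A). a < Suc k} = Suc ` {a \<in> - A. a < k}"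
    proof (rule Set.set_eqI)
      fix a show "a \<in> {a \<in> - insert 0 (Suc ` A). a < Suc k} \<longleftrightarrow> a \<in> Suc ` {a \<in> - A. a < k}"
        by (cases a) auto
    qed
    thus ?thesis by (simp add: card_image)
  qed
  show "weave (insert 0 (Suc ` A)) (x # u) v ! i = (x # weave A u v) ! i"
  proof (cases i)
    case 0
    thus ?thesis by (simp add: weave_def nth_append)
  next
    case (Suc k)
    with i have k: "k < length (weave A u v)" by (simp add: length_weave)
    show ?thesis
      unfolding nth_weave[OF i] unfolding Suc nth_Cons_Suc nth_weave[OF k] c1 c2 by auto
  qed
qed (simp add: length_weave)

lemma weave_Suc_image:
  "weave (Suc ` A) u (y # v) = y # weave A u v"
proof (rule nth_equalityI)
  fix i assume i: "i < length (weave (Suc ` A) u (y # v))"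
  have c1: "card {a \<in> Suc ` A. a < Suc k} = card {a \<in> A. a < k}" for k
  proof -
    have "{a \<in> Suc ` A. a < Suc k} = Suc ` {a \<in> A. a < k}" by auto
    thus ?thesis by (simp add: card_image)
  qed
  have c2: "card {a \<in> - (Suc ` A). a < Suc k} = Suc (card {a \<in> - A. a < k})" for k
  proof -
    have "{a \<in> - (Suc ` A). a < Suc k} = insert 0 (Suc ` {a \<in> - A. a < k})"
    proof (rule Set.set_eqI)
      fix a show "a \<in> {a \<in> - (Suc ` A). a < Suc k} \<longleftrightarrow> a \<in> insert 0 (Suc ` {a \<in> - A. a < k})"
        by (cases a) auto
    qed
    thus ?thesis by (simp add: card_image)
  qed
  show "weave (Suc ` A) u (y # v) ! i = (y # weave A u v) ! i"
  proof (cases i)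
    case 0
    thus ?thesis by (simp add: weave_def nth_append)
  next
    case (Suc k)
    with i have k: "k < length (weave A u v)" by (simp add: length_weave)
    show ?thesis
      unfolding nth_weave[OF i] unfolding Suc nth_Cons_Suc nth_weave[OF k] c1 c2 by auto
  qed
qed (simp add: length_weave)

lemma weave_empty: "weave {} [] v = v"
  by (rule nth_equalityI) (simp_all add: length_weave nth_weave)

lemma weave_full: "weave {..<length u} u [] = u"
proof (rule nth_equalityI)
  fix i assume "i < length (weave {..<length u} u [])"
  hence i: "i < length u" by (simp add: length_weave)
  hence "{a \<in> {..<length u}. a < i} = {..<i}" by auto
  thus "weave {..<length u} u [] ! i = u ! i"
    using i by (simp add: nth_weave length_weave)
qed (simp add: length_weave)

abbreviation subsets_of_card :: "nat \<Rightarrow> nat \<Rightarrow> nat set set" where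
  "subsets_of_card n k \<equiv> {A. A \<subseteq> {..<n} \<and> card A = k}"

lemma subsets_of_card_Suc:
  "subsets_of_card (Suc n) (Suc k) =
     (\<lambda>A. insert 0 (Suc ` A)) ` subsets_of_card n k \<union> (`) Suc ` subsets_of_card n (Suc k)"
proof (intro equalityI subsetI)
  fix A assume "A \<in> subsets_of_card (Suc n) (Suc k)"
  hence A: "A \<subseteq> {..<Suc n}" "card A = Suc k" by auto
  define B where "B = {a. Suc a \<in> A}"
  have fin: "finite B" using A(1) by (intro finite_subset[of B "{..<n}"]) (auto simp: B_def)
  have B: "B \<subseteq> {..<n}" using A(1) by (auto simp: B_def)
  show "A \<in> (\<lambda>A. insert 0 (Suc ` A)) ` subsets_of_card n k \<union> (`) Suc ` subsets_of_card n (Suc k)"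
  proof (cases "0 \<in> A")
    case True
    have "A = insert 0 (Suc ` B)"
    proof (rule Set.set_eqI)
      fix a show "a \<in> A \<longleftrightarrow> a \<in> insert 0 (Suc ` B)" using True by (cases a) (auto simp: B_def)
    qed
    moreover from this have "card B = k" using A(2) fin by (simp add: card_image)
    ultimately show ?thesis using B by blast
  next
    case False
    have "A = Suc ` B"
    proof (rule Set.set_eqI)
      fix a show "a \<in> A \<longleftrightarrow> a \<in> Suc ` B" using False by (cases a) (auto simp: B_def)
    qed
    moreover from this have "card B = Suc k" using A(2) by (simp add: card_image)
    ultimately show ?thesis using B by blast
  qed
next
  fix A assume "A \<in> (\<lambda>A. insert 0 (Suc ` A)) ` subsets_of_card n k \<union> (`) Suc ` subsets_of_card n (Suc k)"
  thus "A \<in> subsets_of_card (Suc n) (Suc k)"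
    by (auto simp: card_image card_insert_if finite_subset)
qed

text \<open>The first letter of a shuffle comes from the first word exactly if \<open>0\<close> is one of its positions.\<close>

lemma shuf_sum_eq_weave:
  "shuf_sum f u v = (\<Sum>A\<in>subsets_of_card (length u + length v) (length u). f (weave A u v))"
proof (induction f u v rule: shuf_sum.induct)
  case (1 f v)
  have "subsets_of_card (length v) 0 = {{}}"
    by (auto simp: finite_subset card_eq_0_iff)
  thus ?case by (simp add: weave_empty)
next
  case (2 f x u)
  have "A = {..<n}" if "A \<subseteq> {..<n}" "card A = n" for A :: "nat set" and n
    using that by (metis card_lessThan card_subset_eq finite_lessThan)
  hence "subsets_of_card (length (x # u)) (length (x # u)) = {{..<length (x # u)}}" by auto
  thus ?case using weave_full[of "x # u"] by simp
next
  case (3 f x u y v)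
  let ?n = "length u + length (y # v)"
  have fin: "finite (subsets_of_card a b)" for a b
    by (rule finite_subset[of _ "Pow {..<a}"]) auto
  have i1: "inj_on (\<lambda>A. insert 0 (Suc ` A)) S" for S
  proof (rule inj_onI)
    fix A B :: "nat set" assume eq: "insert 0 (Suc ` A) = insert 0 (Suc ` B)"
    have "{a. Suc a \<in> insert 0 (Suc ` C)} = C" for C by auto
    with eq show "A = B" by metis
  qed
  have i2: "inj_on ((`) Suc) S" for S
    by (simp add: inj_on_def inj_image_eq_iff)
  have "(\<Sum>A\<in>subsets_of_card (length (x # u) + length (y # v)) (length (x # u)). f (weave A (x # u) (y # v))) =
     (\<Sum>A\<in>(\<lambda>A. insert 0 (Suc ` A)) ` subsets_of_card ?n (length u). f (weave A (x # u) (y # v))) +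
     (\<Sum>A\<in>(`) Suc ` subsets_of_card ?n (Suc (length u)). f (weave A (x # u) (y # v)))"
  proof -
    have split: "subsets_of_card (length (x # u) + length (y # v)) (length (x # u)) =
       (\<lambda>A. insert 0 (Suc ` A)) ` subsets_of_card ?n (length u) \<union>
       (`) Suc ` subsets_of_card ?n (Suc (length u))"
      using subsets_of_card_Suc[of ?n "length u"] by simp
    show ?thesis
      unfolding split by (rule sum.union_disjoint) (auto intro: fin)
  qed
  also have "(\<Sum>A\<in>(\<lambda>A. insert 0 (Suc ` A)) ` subsets_of_card ?n (length u). f (weave A (x # u) (y # v))) =
     (\<Sum>A\<in>subsets_of_card ?n (length u). f (x # weave A u (y # v)))"
    by (subst sum.reindex[OF i1]) (simp add: weave_insert_0)
  also have "(\<Sum>A\<in>(`) Suc ` subsets_of_card ?n (Suc (length u)). f (weave A (x # u) (y # v))) =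
     (\<Sum>A\<in>subsets_of_card ?n (Suc (length u)). f (y # weave A (x # u) v))"
    by (subst sum.reindex[OF i2]) (simp add: weave_Suc_image)
  finally show ?case using 3 by simp
qed

section \<open>Rigged partitions as types of words\<close>

text \<open>The positions in \<open>A\<close> carrying one and the same \<open>X\<close>-letter form a block; a \<open>Y\<close>-letter is the
  rigging of its position.\<close>

definition letter_type :: "nat set \<Rightarrow> (nat \<Rightarrow> nc_var) \<Rightarrow> rigged" where
  "letter_type A z =
     ({B. \<exists>j. B = {i\<in>A. z i = Xvar j} \<and> B \<noteq> {}},
      (\<lambda>i. if i \<in> A then (case z i of Xvar _ \<Rightarrow> None | Yvar c \<Rightarrow> Some c) else None))"

abbreviation word_type :: "nc_var list \<Rightarrow> rigged" where
  "word_type w \<equiv> letter_type {..<length w} ((!) w)"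

lemma range_Xvar_Yvar: "range Xvar \<inter> range Yvar = {}" "range Xvar \<union> range Yvar = UNIV"
  by auto (metis nc_var.exhaust rangeI)

lemma supp_letter_type: "supp (letter_type A z) = {i\<in>A. z i \<in> range Xvar}"
  unfolding supp_def letter_type_def by auto

lemma dom_letter_type: "dom (snd (letter_type A z)) = {i\<in>A. z i \<in> range Yvar}"
proof (rule Set.set_eqI)
  fix i show "i \<in> dom (snd (letter_type A z)) \<longleftrightarrow> i \<in> {i\<in>A. z i \<in> range Yvar}"
    by (cases "z i") (auto simp: letter_type_def dom_def)
qed

lemma ground_letter_type [simp]: "ground (letter_type A z) = A"
  unfolding ground_def supp_letter_type dom_letter_type using range_Xvar_Yvar by blast

lemma snd_letter_type:
  "snd (letter_type A z) i = Some c \<longleftrightarrow> i \<in> A \<and> z i = Yvar c"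
  by (auto simp: letter_type_def split: nc_var.splits)

lemma fst_letter_type:
  "B \<in> fst (letter_type A z) \<longleftrightarrow> (\<exists>j. B = {i\<in>A. z i = Xvar j} \<and> B \<noteq> {})"
  by (simp add: letter_type_def)

lemma letter_type_cong:
  assumes "A = A'" "\<And>i. i \<in> A' \<Longrightarrow> z i = z' i"
  shows "letter_type A z = letter_type A' z'"
proof -
  have "{i\<in>A. z i = Xvar j} = {i\<in>A'. z' i = Xvar j}" for j using assms by auto
  thus ?thesis using assms by (auto simp: letter_type_def fun_eq_iff)
qed

lemma rigged_letter_type:
  assumes "finite A"
  shows "rigged_partition r A (letter_type A z) \<longleftrightarrow> (\<forall>i\<in>A. z i \<in> range Xvar \<union> Yvar ` {..<r})"
proof -
  have "partition_on (supp (letter_type A z)) (fst (letter_type A z))"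
  proof (rule partition_onI)
    fix B C assume "B \<in> fst (letter_type A z)" "C \<in> fst (letter_type A z)" and ne: "B \<noteq> C"
    then obtain j k where jk: "B = {i\<in>A. z i = Xvar j}" "C = {i\<in>A. z i = Xvar k}"
      unfolding fst_letter_type by blast
    with ne have "j \<noteq> k" by blast
    thus "disjnt B C" unfolding jk disjnt_def by auto
  qed (auto simp: fst_letter_type supp_def)
  moreover have "dom (snd (letter_type A z)) = A - supp (letter_type A z)"
    unfolding supp_letter_type dom_letter_type using range_Xvar_Yvar by blast
  moreover have "supp (letter_type A z) \<subseteq> A" by (auto simp: supp_letter_type)
  moreover have "ran (snd (letter_type A z)) \<subseteq> {..<r} \<longleftrightarrow>
      (\<forall>i\<in>A. z i \<in> range Xvar \<union> Yvar ` {..<r})"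
  proof -
    have "ran (snd (letter_type A z)) = {c. \<exists>i\<in>A. z i = Yvar c}"
      by (auto simp: ran_def snd_letter_type)
    moreover have "x \<in> range Xvar \<union> Yvar ` {..<r} \<longleftrightarrow> (\<forall>c. x = Yvar c \<longrightarrow> c < r)" for x
      by (cases x) auto
    ultimately show ?thesis by auto
  qed
  ultimately show ?thesis using assms by (simp add: rigged_partition_def)
qed

lemma letter_type_rename:
  assumes \<rho>: "inj \<rho>"
  shows "letter_type A (\<lambda>i. act_var \<rho> (z i)) = letter_type A z"
proof (rule prod_eqI)
  have 1: "act_var \<rho> (z i) = Xvar (\<rho> j) \<longleftrightarrow> z i = Xvar j" for i j
    using injD[OF \<rho>] by (cases "z i") auto
  have 2: "act_var \<rho> (z i) = Xvar j \<Longrightarrow> \<exists>k. j = \<rho> k" for i j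
    by (cases "z i") auto
  show "fst (letter_type A (\<lambda>i. act_var \<rho> (z i))) = fst (letter_type A z)"
  proof (rule Set.set_eqI)
    fix B
    show "B \<in> fst (letter_type A (\<lambda>i. act_var \<rho> (z i))) \<longleftrightarrow> B \<in> fst (letter_type A z)"
      unfolding fst_letter_type
    proof
      assume "\<exists>j. B = {i \<in> A. act_var \<rho> (z i) = Xvar j} \<and> B \<noteq> {}"
      then obtain j where j: "B = {i \<in> A. act_var \<rho> (z i) = Xvar j}" "B \<noteq> {}" by blast
      then obtain k where "j = \<rho> k" using 2 by blast
      with j(1) have "B = {i \<in> A. z i = Xvar k}" by (simp add: 1)
      with j(2) show "\<exists>j. B = {i \<in> A. z i = Xvar j} \<and> B \<noteq> {}" by blast
    next
      assume "\<exists>j. B = {i \<in> A. z i = Xvar j} \<and> B \<noteq> {}"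
      thus "\<exists>j. B = {i \<in> A. act_var \<rho> (z i) = Xvar j} \<and> B \<noteq> {}" unfolding 1[symmetric] by blast
    qed
  qed
  show "snd (letter_type A (\<lambda>i. act_var \<rho> (z i))) = snd (letter_type A z)"
  proof -
    have "(case act_var \<rho> x of Xvar _ \<Rightarrow> None | Yvar c \<Rightarrow> Some c) =
        (case x of Xvar _ \<Rightarrow> None | Yvar c \<Rightarrow> Some c)" for x
      by (cases x) auto
    thus ?thesis by (simp add: letter_type_def cong: if_cong)
  qed
qed

lemma word_type_rename:
  assumes "inj \<rho>"
  shows "word_type (map (act_var \<rho>) w) = word_type w"
proof -
  have "word_type (map (act_var \<rho>) w) = letter_type {..<length w} (\<lambda>i. act_var \<rho> (w ! i))"
    by (rule letter_type_cong) auto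
  thus ?thesis by (simp add: letter_type_rename[OF assms])
qed

text \<open>Words of one type differ by a permutation of the variables \<open>X\<close>: match the letters of equal
  blocks.\<close>

lemma word_type_eqD:
  assumes len: "length w = length w'" and eq: "word_type w = word_type w'"
  obtains \<sigma> where "finite_perm \<sigma>" "w' = map (act_var \<sigma>) w"
proof -
  let ?n = "length w"
  have ex: "\<exists>b. {k\<in>{..<?n}. w ! k = Xvar a} = {k\<in>{..<?n}. w' ! k = Xvar b}"
    if "Xvar a \<in> set w" for a
  proof -
    have "{k\<in>{..<?n}. w ! k = Xvar a} \<noteq> {}" using that by (auto simp: in_set_conv_nth)
    hence "{k\<in>{..<?n}. w ! k = Xvar a} \<in> fst (word_type w)" by (auto simp: fst_letter_type)
    hence "{k\<in>{..<?n}. w ! k = Xvar a} \<in> fst (letter_type {..<?n} ((!) w'))"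
      using eq len by simp
    thus ?thesis unfolding fst_letter_type by blast
  qed
  \<comment> \<open>The letter of \<open>w'\<close> at the positions at which \<open>w\<close> has the letter \<open>Xvar a\<close>.\<close>
  define \<rho> where "\<rho> a = (SOME b. {k\<in>{..<?n}. w ! k = Xvar a} = {k\<in>{..<?n}. w' ! k = Xvar b})" for a
  have \<rho>: "{k\<in>{..<?n}. w ! k = Xvar a} = {k\<in>{..<?n}. w' ! k = Xvar (\<rho> a)}"
    if "Xvar a \<in> set w" for a
    unfolding \<rho>_def by (rule someI_ex) (rule ex[OF that])
  have "inj_on \<rho> {a. Xvar a \<in> set w}"
  proof (rule inj_onI)
    fix a b assume a: "a \<in> {a. Xvar a \<in> set w}" and b: "b \<in> {a. Xvar a \<in> set w}" and "\<rho> a = \<rho> b"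
    with \<rho> have "{k\<in>{..<?n}. w ! k = Xvar a} = {k\<in>{..<?n}. w ! k = Xvar b}" by simp
    moreover obtain k where "k < ?n" "w ! k = Xvar a" using a by (auto simp: in_set_conv_nth)
    ultimately have "k \<in> {k\<in>{..<?n}. w ! k = Xvar b}" by blast
    thus "a = b" using \<open>w ! k = Xvar a\<close> by simp
  qed
  then obtain \<sigma> where \<sigma>: "finite_perm \<sigma>" "\<And>a. a \<in> {a. Xvar a \<in> set w} \<Longrightarrow> \<sigma> a = \<rho> a"
    using finite_perm_extends[OF finite_Xvar_indices] by metis
  have "w' = map (act_var \<sigma>) w"
  proof (rule nth_equalityI)
    fix i assume "i < length w'"
    hence i: "i < ?n" by (simp add: len)
    show "w' ! i = map (act_var \<sigma>) w ! i"
    proof (cases "w ! i")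
      case (Xvar a)
      hence a: "Xvar a \<in> set w" using i by (metis nth_mem)
      have "i \<in> {k\<in>{..<?n}. w ! k = Xvar a}" using i Xvar by simp
      hence "w' ! i = Xvar (\<rho> a)" unfolding \<rho>[OF a] by simp
      thus ?thesis using \<sigma>(2)[of a] a i Xvar by simp
    next
      case (Yvar c)
      hence "snd (word_type w) i = Some c" using i by (simp add: snd_letter_type)
      hence "w' ! i = Yvar c" unfolding eq snd_letter_type by simp
      thus ?thesis using i Yvar by simp
    qed
  qed (simp add: len)
  with \<sigma>(1) show thesis using that by blast
qed

text \<open>The letters of \<^const>\<open>rigged_word\<close>, for rigged partitions of arbitrary sets of positions.\<close>

definition rigged_letter :: "rigged \<Rightarrow> nat \<Rightarrow> nc_var" where
  "rigged_letter \<P> i =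
     (if i \<in> supp \<P> then Xvar (block_label (fst \<P>) (THE B. B \<in> fst \<P> \<and> i \<in> B))
      else Yvar (the (snd \<P> i)))"

lemma rigged_word_eq: "rigged_word n \<P> = map (rigged_letter \<P>) [0..<n]"
  by (simp add: rigged_word_def rigged_letter_def)

lemma length_rigged_word [simp]: "length (rigged_word n \<P>) = n"
  by (simp add: rigged_word_def)

lemma rigged_letter_block:
  assumes "rigged_partition r A \<P>" and B: "i \<in> B" "B \<in> fst \<P>"
  shows "rigged_letter \<P> i = Xvar (block_label (fst \<P>) B)"
proof -
  have "partition_on (supp \<P>) (fst \<P>)" using assms by (simp add: rigged_partition_def)
  hence uniq: "C = B" if "C \<in> fst \<P> \<and> i \<in> C" for C
    using B that by (meson disjnt_iff pairwiseD partition_onD2)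
  have "(THE B. B \<in> fst \<P> \<and> i \<in> B) = B"
    by (rule the_equality) (use B in blast, rule uniq)
  moreover have "i \<in> supp \<P>" using B by (auto simp: supp_def)
  ultimately show ?thesis
    by (simp add: rigged_letter_def)
qed

lemma rigged_letter_not_supp: "i \<notin> supp \<P> \<Longrightarrow> rigged_letter \<P> i = Yvar (the (snd \<P> i))"
  by (simp add: rigged_letter_def)

lemma inj_on_block_label:
  assumes "finite P"
  shows "inj_on (block_label P) P"
proof -
  have "\<exists>e. bij_betw e P {..<card P}"
    using assms by (intro finite_same_card_bij) auto
  hence "bij_betw (block_label P) P {..<card P}"
    unfolding block_label_def by (rule someI_ex)
  thus ?thesis by (rule bij_betw_imp_inj_on)
qed

lemma map_le_SomeI: "(\<And>i c. m i = Some c \<Longrightarrow> m' i = Some c) \<Longrightarrow> m \<subseteq>\<^sub>m m'"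
  by (auto simp: map_le_def)

lemma letter_type_rigged_letter:
  assumes P: "rigged_partition r A \<P>"
  shows "letter_type A (rigged_letter \<P>) = \<P>"
proof (rule prod_eqI)
  let ?z = "rigged_letter \<P>"
  note nth = rigged_letter_block[OF P] rigged_letter_not_supp
  have part: "partition_on (supp \<P>) (fst \<P>)" and sub: "supp \<P> \<subseteq> A"
    and dom: "dom (snd \<P>) = A - supp \<P>"
    using P by (auto simp: rigged_partition_def)
  have fin: "finite (fst \<P>)"
    using P part sub finite_elements finite_subset unfolding rigged_partition_def by metis
  have block: "{i\<in>A. ?z i = Xvar (block_label (fst \<P>) B)} = B" if B: "B \<in> fst \<P>" for B
  proof (intro equalityI subsetI)
    fix i assume "i \<in> {i\<in>A. ?z i = Xvar (block_label (fst \<P>) B)}"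
    hence i: "i \<in> A" "?z i = Xvar (block_label (fst \<P>) B)" by auto
    with nth(2) have "i \<in> supp \<P>" by fastforce
    then obtain C where C: "C \<in> fst \<P>" "i \<in> C" by (auto simp: supp_def)
    with nth(1) i have "block_label (fst \<P>) C = block_label (fst \<P>) B" by fastforce
    thus "i \<in> B" using inj_onD[OF inj_on_block_label[OF fin]] B C by metis
  next
    fix i assume i: "i \<in> B"
    hence "i \<in> A" using B sub by (auto simp: supp_def)
    thus "i \<in> {i\<in>A. ?z i = Xvar (block_label (fst \<P>) B)}" using nth(1) i B by auto
  qed
  show "fst (letter_type A ?z) = fst \<P>"
  proof (intro equalityI subsetI)
    fix B assume "B \<in> fst (letter_type A ?z)"
    then obtain j i where j: "B = {i\<in>A. ?z i = Xvar j}" "i \<in> B"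
      by (auto simp: fst_letter_type)
    hence i: "i \<in> A" "?z i = Xvar j" by auto
    with nth(2) have "i \<in> supp \<P>" by fastforce
    then obtain C where C: "C \<in> fst \<P>" "i \<in> C" by (auto simp: supp_def)
    with nth(1) i have "j = block_label (fst \<P>) C" by fastforce
    thus "B \<in> fst \<P>" using block[OF C(1)] C j by simp
  next
    fix B assume B: "B \<in> fst \<P>"
    hence "B \<noteq> {}" using part by (auto dest: partition_onD3)
    thus "B \<in> fst (letter_type A ?z)" using block[OF B] by (auto simp: fst_letter_type)
  qed
  show "snd (letter_type A ?z) = snd \<P>"
  proof (rule map_le_antisym)
    show "snd (letter_type A ?z) \<subseteq>\<^sub>m snd \<P>"
    proof (rule map_le_SomeI)
      fix i c assume "snd (letter_type A ?z) i = Some c"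
      hence i: "i \<in> A" "?z i = Yvar c" by (auto simp: snd_letter_type)
      have "i \<notin> supp \<P>"
      proof
        assume "i \<in> supp \<P>"
        then obtain C where C: "C \<in> fst \<P>" "i \<in> C" by (auto simp: supp_def)
        with nth(1) i show False by fastforce
      qed
      moreover from this dom i have "i \<in> dom (snd \<P>)" by auto
      ultimately show "snd \<P> i = Some c" using nth(2) i by auto
    qed
    show "snd \<P> \<subseteq>\<^sub>m snd (letter_type A ?z)"
    proof (rule map_le_SomeI)
      fix i c assume c: "snd \<P> i = Some c"
      hence "i \<in> A" "i \<notin> supp \<P>" using dom by (auto simp: dom_def)
      with nth(2) c show "snd (letter_type A ?z) i = Some c" by (simp add: snd_letter_type)
    qed
  qed
qed

lemma word_type_rigged_word:
  assumes "rigged_partition r {..<n} \<P>"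
  shows "word_type (rigged_word n \<P>) = \<P>"
proof -
  have "word_type (rigged_word n \<P>) = letter_type {..<n} (rigged_letter \<P>)"
    by (rule letter_type_cong) (simp_all add: rigged_word_eq)
  thus ?thesis using letter_type_rigged_letter[OF assms] by simp
qed

lemma rigged_word_in_words:
  assumes "rigged_partition r {..<n} \<P>"
  shows "rigged_word n \<P> \<in> var_words r"
proof -
  have "rigged_partition r {..<length (rigged_word n \<P>)} (word_type (rigged_word n \<P>))"
    unfolding word_type_rigged_word[OF assms] using assms by simp
  hence "\<forall>i<n. rigged_word n \<P> ! i \<in> range Xvar \<union> Yvar ` {..<r}"
    by (subst (asm) rigged_letter_type) auto
  thus ?thesis unfolding mem_Collect_eq subset_iff by (metis in_set_conv_nth length_rigged_word)
qed

lemma inj_finite_perm: "finite_perm \<sigma> \<Longrightarrow> inj \<sigma>"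
  by (simp add: finite_perm_def bij_is_inj)

lemma m_rigged_eq:
  assumes P: "rigged_partition r {..<n} \<P>"
  shows "m_rigged n \<P> w = (if length w = n \<and> word_type w = \<P> then 1 else 0)"
proof -
  have "(\<exists>\<sigma>. finite_perm \<sigma> \<and> w = map (act_var \<sigma>) (rigged_word n \<P>)) \<longleftrightarrow>
      length w = n \<and> word_type w = \<P>"
  proof
    assume "\<exists>\<sigma>. finite_perm \<sigma> \<and> w = map (act_var \<sigma>) (rigged_word n \<P>)"
    then obtain \<sigma> where \<sigma>: "finite_perm \<sigma>" and w: "w = map (act_var \<sigma>) (rigged_word n \<P>)"
      by blast
    have "word_type w = word_type (rigged_word n \<P>)"
      unfolding w by (rule word_type_rename[OF inj_finite_perm[OF \<sigma>]])
    also have "\<dots> = \<P>" by (rule word_type_rigged_word[OF P])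
    finally show "length w = n \<and> word_type w = \<P>" by (simp add: w)
  next
    assume "length w = n \<and> word_type w = \<P>"
    thus "\<exists>\<sigma>. finite_perm \<sigma> \<and> w = map (act_var \<sigma>) (rigged_word n \<P>)"
      using word_type_eqD[of "rigged_word n \<P>" w] word_type_rigged_word[OF P]
      by (metis length_rigged_word)
  qed
  thus ?thesis by (simp add: m_rigged_def)
qed

lemma m_rigged_in_NPS:
  assumes P: "rigged_partition r {..<n} \<P>"
  shows "m_rigged n \<P> \<in> NPS_space r"
proof -
  have "m_rigged n \<P> w = 0" if "w \<notin> var_words r" for w
  proof (rule ccontr)
    assume "m_rigged n \<P> w \<noteq> 0"
    then obtain \<sigma> where "w = map (act_var \<sigma>) (rigged_word n \<P>)" by (auto simp: m_rigged_def split: if_splits)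
    with that show False using map_act_var_in_words rigged_word_in_words[OF P] by blast
  qed
  moreover have "\<exists>N. \<forall>w. length w > N \<longrightarrow> m_rigged n \<P> w = 0"
    by (intro exI[of _ n]) (simp add: m_rigged_eq[OF P])
  moreover have "renaming_invariant (m_rigged n \<P>)"
    unfolding renaming_invariant_def m_rigged_eq[OF P] by (metis length_map word_type_rename)
  ultimately show ?thesis unfolding NPS_space_iff by blast
qed

lemma finite_rigged_partitions: "finite {\<P>. rigged_partition r A \<P>}"
proof (cases "finite A")
  case True
  have "{\<P>. rigged_partition r A \<P>} \<subseteq>
      Pow (Pow A) \<times> (\<Union>B\<in>Pow A. {m. dom m = B \<and> ran m \<subseteq> {..<r}})"
    by (auto simp: rigged_partition_def supp_def) blast
  moreover have "finite (Pow (Pow A) \<times> (\<Union>B\<in>Pow A. {m. dom m = B \<and> ran m \<subseteq> {..<r}}))"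
    using True by (intro finite_cartesian_product finite_UN_I finite_set_of_finite_maps)
      (auto intro: finite_subset)
  ultimately show ?thesis by (rule finite_subset)
qed (simp add: rigged_partition_def)

abbreviation rigged_index :: "nat \<Rightarrow> (nat \<times> rigged) set" where
  "rigged_index r \<equiv> {(n, \<P>). rigged_partition r {..<n} \<P>}"

text \<open>There are finitely many types of words of bounded length, and \<open>f\<close> is determined by its value at one
  word of each type.\<close>

lemma NPS_expansion:
  assumes f: "f \<in> NPS_space r"
  obtains J where "finite J" "J \<subseteq> rigged_index r"
    "f = (\<Sum>(n, \<P>)\<in>J. fscale (f (rigged_word n \<P>)) (m_rigged n \<P>))"
proof -
  obtain N where N: "\<forall>w. length w > N \<longrightarrow> f w = 0" using NPS_spaceD(3)[OF f] by blast
  define J where "J = (SIGMA n:{..N}. {\<P>. rigged_partition r {..<n} \<P>})"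
  have J: "finite J" unfolding J_def by (intro finite_SigmaI finite_rigged_partitions) simp
  have "f w = (\<Sum>(n, \<P>)\<in>J. fscale (f (rigged_word n \<P>)) (m_rigged n \<P>)) w" for w
  proof -
    let ?p = "(length w, word_type w)"
    have "(\<Sum>(n, \<P>)\<in>J. fscale (f (rigged_word n \<P>)) (m_rigged n \<P>)) w =
        (\<Sum>p\<in>J. if p = ?p then f (rigged_word (fst p) (snd p)) else 0)"
      unfolding sum_fun_apply
      by (rule sum.cong) (auto simp: J_def fscale_apply m_rigged_eq split: if_splits)
    also have "\<dots> = (if ?p \<in> J then f (rigged_word (length w) (word_type w)) else 0)"
      using J by simp
    also have "\<dots> = f w"
    proof (cases "?p \<in> J")
      case True
      hence P: "rigged_partition r {..<length w} (word_type w)" by (simp add: J_def)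
      obtain \<sigma> where "finite_perm \<sigma>" "w = map (act_var \<sigma>) (rigged_word (length w) (word_type w))"
        using word_type_eqD[of "rigged_word (length w) (word_type w)" w] word_type_rigged_word[OF P]
        by (metis length_rigged_word)
      hence "f w = f (rigged_word (length w) (word_type w))"
        using renaming_invariantD[OF NPS_spaceD(2)[OF f] inj_finite_perm] by metis
      thus ?thesis using True by simp
    next
      case False
      hence "length w > N \<or> \<not> (\<forall>i\<in>{..<length w}. w ! i \<in> range Xvar \<union> Yvar ` {..<r})"
        using rigged_letter_type[of "{..<length w}" r "(!) w"] by (auto simp: J_def)
      hence "length w > N \<or> w \<notin> var_words r" by (metis lessThan_iff mem_Collect_eq nth_mem subsetD)
      hence "f w = 0" using N NPS_spaceD(1)[OF f] by blast
      thus ?thesis using False by simp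
    qed
    finally show ?thesis ..
  qed
  moreover have "J \<subseteq> rigged_index r" by (auto simp: J_def)
  ultimately show thesis using that[of J] J by blast
qed

section \<open>The coproduct of monomial functions\<close>

abbreviation rank_in :: "nat set \<Rightarrow> nat \<Rightarrow> nat" where
  "rank_in A i \<equiv> card {a\<in>A. a < i}"

lemma rank_in_mono:
  fixes A :: "nat set"
  assumes "finite A" "i \<in> A" "i < j"
  shows "rank_in A i < rank_in A j"
  using assms by (intro psubset_card_mono) auto

lemma rank_in_less_card:
  fixes A :: "nat set"
  assumes "finite A" "i \<in> A"
  shows "rank_in A i < card A"
  using assms by (intro psubset_card_mono) auto

lemma rank_in_inject:
  fixes A :: "nat set"
  assumes "finite A" "i \<in> A" "j \<in> A"
  shows "rank_in A i = rank_in A j \<longleftrightarrow> i = j"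
    and "rank_in A i < rank_in A j \<longleftrightarrow> i < j"
  using rank_in_mono[OF assms(1,2), of j] rank_in_mono[OF assms(1,3), of i]
  by (cases i j rule: linorder_cases; simp)+

lemma bij_betw_rank_in:
  fixes A :: "nat set"
  assumes "finite A"
  shows "bij_betw (\<lambda>i. rank_in A i) A {..<card A}"
proof (rule bij_betw_byWitness[where f' = "pick A"])
  show "(\<lambda>i. rank_in A i) ` A \<subseteq> {..<card A}"
    using rank_in_less_card[OF assms] by auto
qed (auto simp: card_pick_le pick_card_in_set pick_in_set_le)

lemma bij_betw_pick:
  assumes "finite A"
  shows "bij_betw (pick A) {..<card A} A"
proof (rule bij_betw_byWitness[where f' = "rank_in A"])
  show "rank_in A ` A \<subseteq> {..<card A}"
    using rank_in_less_card[OF assms] by auto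
qed (auto simp: card_pick_le pick_card_in_set pick_in_set_le)

lemma ground_rigged: "rigged_partition r A \<P> \<Longrightarrow> ground \<P> = A"
  by (auto simp: rigged_partition_def ground_def)

lemma standardize_letter_type:
  assumes A: "finite A"
  shows "standardize (letter_type A z) = letter_type {..<card A} (\<lambda>i. z (pick A i))"
proof -
  have bij: "bij_betw (pick A) {..<card A} A" by (rule bij_betw_pick[OF A])
  have pickA: "pick A i \<in> A" if "i < card A" for i
    using bij that by (auto simp: bij_betw_def)
  let ?g = "\<lambda>B. {i. i < card A \<and> pick A i \<in> B}"
  have g: "?g {i\<in>A. z i = Xvar j} = {i\<in>{..<card A}. z (pick A i) = Xvar j}" for j
    using pickA by auto
  have ne: "?g B \<noteq> {}" if B: "B \<noteq> {}" "B \<subseteq> A" for B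
  proof -
    obtain b where "b \<in> B" using B by blast
    moreover from this have "b \<in> pick A ` {..<card A}"
      using B bij by (auto simp: bij_betw_def)
    ultimately show ?thesis by auto
  qed
  have "?g ` fst (letter_type A z) = fst (letter_type {..<card A} (\<lambda>i. z (pick A i)))"
  proof (intro equalityI subsetI)
    fix C assume "C \<in> ?g ` fst (letter_type A z)"
    then obtain B where "C = ?g B" "B \<in> fst (letter_type A z)" by blast
    then obtain j where B: "C = ?g B" "B = {i\<in>A. z i = Xvar j}" "B \<noteq> {}"
      unfolding fst_letter_type by blast
    hence "C = {i\<in>{..<card A}. z (pick A i) = Xvar j}" using g by simp
    moreover have "C \<noteq> {}" unfolding B(1) by (rule ne) (use B in auto)
    ultimately show "C \<in> fst (letter_type {..<card A} (\<lambda>i. z (pick A i)))"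
      unfolding fst_letter_type by blast
  next
    fix C assume "C \<in> fst (letter_type {..<card A} (\<lambda>i. z (pick A i)))"
    then obtain j where j: "C = {i\<in>{..<card A}. z (pick A i) = Xvar j}" "C \<noteq> {}"
      unfolding fst_letter_type by blast
    hence "C = ?g {i\<in>A. z i = Xvar j}" using g by simp
    moreover from this j(2) have "{i\<in>A. z i = Xvar j} \<noteq> {}" by blast
    hence "{i\<in>A. z i = Xvar j} \<in> fst (letter_type A z)" unfolding fst_letter_type by blast
    ultimately show "C \<in> ?g ` fst (letter_type A z)" by (rule image_eqI)
  qed
  moreover have "(\<lambda>i. if i < card A then snd (letter_type A z) (pick A i) else None) =
      snd (letter_type {..<card A} (\<lambda>i. z (pick A i)))"
    by (auto simp: letter_type_def fun_eq_iff pickA)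
  ultimately show ?thesis
    by (simp add: standardize_def Let_def prod_eq_iff)
qed

lemma rigged_standardize:
  assumes P: "rigged_partition r A \<P>"
  shows "rigged_partition r {..<card A} (standardize \<P>)"
proof -
  have A: "finite A" using P by (simp add: rigged_partition_def)
  have "\<forall>i\<in>A. rigged_letter \<P> i \<in> range Xvar \<union> Yvar ` {..<r}"
    using P rigged_letter_type[OF A, of r "rigged_letter \<P>"] letter_type_rigged_letter[OF P] by simp
  moreover have "pick A i \<in> A" if "i < card A" for i
    using that by (simp add: pick_in_set_le)
  ultimately have "rigged_partition r {..<card A}
      (letter_type {..<card A} (\<lambda>i. rigged_letter \<P> (pick A i)))"
    by (subst rigged_letter_type) auto
  thus ?thesis
    using standardize_letter_type[OF A, of "rigged_letter \<P>"] letter_type_rigged_letter[OF P] by simp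
qed

lemma standardize_inject:
  assumes P: "rigged_partition r A \<P>" and Q: "rigged_partition r A \<Q>"
    and eq: "standardize \<P> = standardize \<Q>"
  shows "\<P> = \<Q>"
proof -
  have A: "finite A" using P by (simp add: rigged_partition_def)
  have bij: "bij_betw (pick A) {..<card A} A" by (rule bij_betw_pick[OF A])
  have g: "pick A ` {i. i < card A \<and> pick A i \<in> B} = B" if "B \<subseteq> A" for B
  proof -
    have "pick A ` {i. i < card A \<and> pick A i \<in> B} = pick A ` {..<card A} \<inter> B" by auto
    thus ?thesis using bij that by (auto simp: bij_betw_def)
  qed
  have 1: "fst \<R> = (`) (pick A) ` fst (standardize \<R>)"
    "\<And>i. i \<in> A \<Longrightarrow> snd \<R> i = snd (standardize \<R>) (card {a\<in>A. a < i})"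
    "\<And>i. i \<notin> A \<Longrightarrow> snd \<R> i = None"
    if R: "rigged_partition r A \<R>" for \<R>
  proof -
    have sub: "B \<subseteq> A" if "B \<in> fst \<R>" for B
      using R that by (auto simp: rigged_partition_def supp_def)
    have "(`) (pick A) ` fst (standardize \<R>) =
        (\<lambda>B. pick A ` {i. i < card A \<and> pick A i \<in> B}) ` fst \<R>"
      by (simp add: standardize_def Let_def ground_rigged[OF R] image_image)
    also have "\<dots> = (\<lambda>B. B) ` fst \<R>" by (rule image_cong[OF refl]) (rule g[OF sub])
    finally show "fst \<R> = (`) (pick A) ` fst (standardize \<R>)" by simp
  next
    fix i assume i: "i \<in> A"
    hence "card {a\<in>A. a < i} < card A" using A by (auto intro!: psubset_card_mono)
    thus "snd \<R> i = snd (standardize \<R>) (card {a\<in>A. a < i})"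
      using i by (simp add: standardize_def Let_def ground_rigged[OF R] pick_card_in_set)
  next
    fix i assume "i \<notin> A"
    thus "snd \<R> i = None" using R by (auto simp: rigged_partition_def dom_def)
  qed
  show ?thesis
  proof (rule prod_eqI)
    show "fst \<P> = fst \<Q>" using 1(1)[OF P] 1(1)[OF Q] eq by simp
    show "snd \<P> = snd \<Q>"
    proof
      fix i show "snd \<P> i = snd \<Q> i"
        using 1(2,3)[OF P] 1(2,3)[OF Q] eq by (cases "i \<in> A") simp_all
    qed
  qed
qed

lemma fst_letter_type_Un:
  assumes sep: "\<And>i j. i \<in> A1 \<Longrightarrow> j \<in> A2 \<Longrightarrow> z i = z j \<Longrightarrow> z i \<in> range Yvar"
  shows "fst (letter_type (A1 \<union> A2) z) = fst (letter_type A1 z) \<union> fst (letter_type A2 z)"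
proof -
  have split: "{i\<in>A1 \<union> A2. z i = Xvar j} = {i\<in>A1. z i = Xvar j} \<union> {i\<in>A2. z i = Xvar j}" for j
    by auto
  have one: "{i\<in>A1. z i = Xvar j} = {} \<or> {i\<in>A2. z i = Xvar j} = {}" for j
    using sep by fastforce
  show ?thesis
  proof (intro equalityI subsetI)
    fix B assume "B \<in> fst (letter_type (A1 \<union> A2) z)"
    then obtain j where "B = {i\<in>A1 \<union> A2. z i = Xvar j}" "B \<noteq> {}"
      unfolding fst_letter_type by blast
    thus "B \<in> fst (letter_type A1 z) \<union> fst (letter_type A2 z)"
      using one[of j] unfolding split Un_iff fst_letter_type by auto
  next
    fix B assume "B \<in> fst (letter_type A1 z) \<union> fst (letter_type A2 z)"
    then obtain j where "B = {i\<in>A1. z i = Xvar j} \<or> B = {i\<in>A2. z i = Xvar j}" "B \<noteq> {}"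
      unfolding Un_iff fst_letter_type by blast
    hence "B = {i\<in>A1 \<union> A2. z i = Xvar j}" using one[of j] unfolding split by auto
    thus "B \<in> fst (letter_type (A1 \<union> A2) z)" using \<open>B \<noteq> {}\<close> unfolding fst_letter_type by blast
  qed
qed

lemma rigged_sum_letter_type:
  assumes r: "rigged_partition r (A1 \<union> A2) (letter_type (A1 \<union> A2) z)" and dis: "A1 \<inter> A2 = {}"
    and sep: "\<And>i j. i \<in> A1 \<Longrightarrow> j \<in> A2 \<Longrightarrow> z i = z j \<Longrightarrow> z i \<in> range Yvar"
  shows "rigged_sum r (letter_type (A1 \<union> A2) z) (letter_type A1 z) (letter_type A2 z)"
proof -
  have fin: "finite (A1 \<union> A2)" using r by (simp add: rigged_partition_def)
  hence fin': "finite A1" "finite A2" by auto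
  have val: "\<forall>i\<in>A1 \<union> A2. z i \<in> range Xvar \<union> Yvar ` {..<r}"
    using r unfolding rigged_letter_type[OF fin] .
  have "rigged_partition r A1 (letter_type A1 z)" "rigged_partition r A2 (letter_type A2 z)"
    unfolding fin'[THEN rigged_letter_type] using val by auto
  moreover have "fst (letter_type A1 z) \<inter> fst (letter_type A2 z) = {}"
  proof -
    have "B \<noteq> {} \<and> B \<subseteq> A" if "B \<in> fst (letter_type A z)" for A B
      using that unfolding fst_letter_type by blast
    thus ?thesis using dis by blast
  qed
  moreover have "snd (letter_type (A1 \<union> A2) z) |` (A - supp (letter_type A z)) = snd (letter_type A z)"
    if "A \<subseteq> A1 \<union> A2" for A
  proof
    fix i show "(snd (letter_type (A1 \<union> A2) z) |` (A - supp (letter_type A z))) i = snd (letter_type A z) i"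
      using that unfolding supp_letter_type
      by (cases "z i") (auto simp: letter_type_def restrict_map_def)
  qed
  ultimately show ?thesis
    unfolding rigged_sum_def
    using r dis fst_letter_type_Un[of A1 A2 z, OF sep]
    by (intro exI[of _ "A1 \<union> A2"] exI[of _ A1] exI[of _ A2] conjI) simp_all
qed

lemma rigged_sumD:
  assumes "rigged_sum r \<P> \<P>1 \<P>2"
  shows "rigged_partition r (ground \<P>1) \<P>1" "rigged_partition r (ground \<P>2) \<P>2"
    "ground \<P> = ground \<P>1 \<union> ground \<P>2" "ground \<P>1 \<inter> ground \<P>2 = {}"
    "fst \<P> = fst \<P>1 \<union> fst \<P>2"
    "i \<in> ground \<P>1 \<Longrightarrow> snd \<P> i = snd \<P>1 i" "i \<in> ground \<P>2 \<Longrightarrow> snd \<P> i = snd \<P>2 i"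
    "i \<notin> ground \<P> \<Longrightarrow> snd \<P> i = None"
    "snd \<P>1 = snd \<P> |` (ground \<P>1 - supp \<P>1)" "snd \<P>2 = snd \<P> |` (ground \<P>2 - supp \<P>2)"
proof -
  obtain A A1 A2 where *: "rigged_partition r A \<P>" "rigged_partition r A1 \<P>1" "rigged_partition r A2 \<P>2"
    "A = A1 \<union> A2" "A1 \<inter> A2 = {}" "fst \<P> = fst \<P>1 \<union> fst \<P>2"
    "snd \<P> |` (A1 - supp \<P>1) = snd \<P>1" "snd \<P> |` (A2 - supp \<P>2) = snd \<P>2"
    using assms unfolding rigged_sum_def by blast
  note g = *(1-3)[THEN ground_rigged]
  show "rigged_partition r (ground \<P>1) \<P>1" "rigged_partition r (ground \<P>2) \<P>2"
    "ground \<P> = ground \<P>1 \<union> ground \<P>2" "ground \<P>1 \<inter> ground \<P>2 = {}"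
    "fst \<P> = fst \<P>1 \<union> fst \<P>2"
    "snd \<P>1 = snd \<P> |` (ground \<P>1 - supp \<P>1)" "snd \<P>2 = snd \<P> |` (ground \<P>2 - supp \<P>2)"
    using * g by simp_all
  have dom: "dom (snd \<P>) = A - supp \<P>" using *(1) by (simp add: rigged_partition_def)
  thus "i \<notin> ground \<P> \<Longrightarrow> snd \<P> i = None" using g by auto
  have supp: "supp \<P>1 \<subseteq> supp \<P>" "supp \<P>2 \<subseteq> supp \<P>" using *(6) by (auto simp: supp_def)
  hence none: "i \<in> supp \<P>1 \<Longrightarrow> snd \<P> i = None" "i \<in> supp \<P>2 \<Longrightarrow> snd \<P> i = None"
    using dom by (auto simp: dom_def)
  show "snd \<P> i = snd \<P>1 i" if "i \<in> ground \<P>1"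
    using none(1) that g fun_cong[OF *(7), of i] by (cases "i \<in> supp \<P>1") (auto simp: restrict_map_def)
  show "snd \<P> i = snd \<P>2 i" if "i \<in> ground \<P>2"
    using none(2) that g fun_cong[OF *(8), of i] by (cases "i \<in> supp \<P>2") (auto simp: restrict_map_def)
qed

lemma finite_rigged_sums:
  assumes P: "rigged_partition r {..<n} \<P>"
  shows "finite {(\<P>1, \<P>2). rigged_sum r \<P> \<P>1 \<P>2}"
proof -
  have "{(\<P>1, \<P>2). rigged_sum r \<P> \<P>1 \<P>2} \<subseteq>
      (\<Union>A\<in>Pow {..<n}. {\<P>. rigged_partition r A \<P>}) \<times> (\<Union>A\<in>Pow {..<n}. {\<P>. rigged_partition r A \<P>})"
  proof clarify
    fix a b c d assume "rigged_sum r \<P> (a, b) (c, d)"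
    note D = rigged_sumD(1-3)[OF this]
    have "ground (a, b) \<subseteq> {..<n}" "ground (c, d) \<subseteq> {..<n}"
      using D(3) ground_rigged[OF P] by auto
    with D(1,2) show "(a, b) \<in> (\<Union>A\<in>Pow {..<n}. {\<P>. rigged_partition r A \<P>}) \<and>
        (c, d) \<in> (\<Union>A\<in>Pow {..<n}. {\<P>. rigged_partition r A \<P>})" by blast
  qed
  moreover have "finite \<dots>"
    by (intro finite_cartesian_product finite_UN_I finite_rigged_partitions) auto
  ultimately show ?thesis by (rule finite_subset)
qed

lemma card_lessThan_Diff:
  "A \<subseteq> {..<k + m} \<Longrightarrow> card A = k \<Longrightarrow> card ({..<k + m} - A) = m" for A :: "nat set"
  by (subst card_Diff_subset) (auto intro: finite_subset)

lemma word_type_evens: "word_type (evens u) = word_type u"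
  and word_type_odds: "word_type (odds u) = word_type u"
  unfolding evens_def odds_def by (rule word_type_rename, rule inj_evens inj_odds)+

lemma nth_weave1:
  assumes "A \<subseteq> {..<length u + length v}" "i \<in> A"
  shows "weave A u v ! i = u ! rank_in A i"
  using assms by (subst nth_weave) (auto simp: length_weave)

lemma nth_weave2:
  assumes "i < length u + length v" "i \<notin> A"
  shows "weave A u v ! i = v ! rank_in ({..<length u + length v} - A) i"
proof -
  have "{a\<in>-A. a < i} = {a\<in>{..<length u + length v} - A. a < i}" using assms by auto
  thus ?thesis using assms by (subst nth_weave) (auto simp: length_weave)
qed

context
  fixes u v :: "nc_var list" and A :: "nat set"
  assumes A: "A \<in> subsets_of_card (length u + length v) (length u)"
begin

abbreviation "shuffled \<equiv> weave A (evens u) (odds v)"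
abbreviation "other_positions \<equiv> {..<length u + length v} - A"

lemma positions: "A \<subseteq> {..<length u + length v}" "card A = length u" "finite A"
  and card_other_positions: "card other_positions = length v"
  using A card_lessThan_Diff[of A "length u" "length v"] by (auto intro: finite_subset)

lemma length_shuffled: "length shuffled = length u + length v"
  by (simp add: length_weave)

lemma shuffled_nth1: "i \<in> A \<Longrightarrow> shuffled ! i = evens u ! rank_in A i"
  and shuffled_nth2: "i \<in> other_positions \<Longrightarrow> shuffled ! i = odds v ! rank_in other_positions i"
  using nth_weave1[of A "evens u" "odds v" i] nth_weave2[of i "evens u" "odds v" A] positions by auto

lemma rank1: "i \<in> A \<Longrightarrow> rank_in A i < length u"
  and rank2: "i \<in> other_positions \<Longrightarrow> rank_in other_positions i < length v"
  using rank_in_less_card[OF positions(3), of i] rank_in_less_card[of other_positions i]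
    positions(2) card_other_positions by simp_all

text \<open>The \<open>X\<close>-letters of one word are even and those of the other odd.\<close>

lemma shuffled_separated:
  assumes i: "i \<in> A" and j: "j \<in> other_positions" and eq: "shuffled ! i = shuffled ! j"
  shows "shuffled ! i \<in> range Yvar"
proof -
  have "shuffled ! i = act_var (\<lambda>i. 2 * i) (u ! rank_in A i)"
    "shuffled ! i = act_var (\<lambda>i. 2 * i + 1) (v ! rank_in other_positions j)"
    using rank1[OF i] rank2[OF j] shuffled_nth1[OF i] shuffled_nth2[OF j] eq
    by (simp_all add: evens_def odds_def)
  moreover have "Suc (2 * b) \<noteq> 2 * a" for a b by presburger
  ultimately show ?thesis
    by (cases "u ! rank_in A i"; cases "v ! rank_in other_positions j") auto
qed

lemma shuffled_in_var_words:
  assumes "u \<in> var_words r" "v \<in> var_words r"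
  shows "shuffled \<in> var_words r"
proof -
  have w: "evens u \<in> var_words r" "odds v \<in> var_words r"
    using assms unfolding evens_def odds_def map_act_var_in_words by blast+
  have "shuffled ! i \<in> range Xvar \<union> Yvar ` {..<r}" if i: "i < length shuffled" for i
  proof (cases "i \<in> A")
    case True
    show ?thesis
      unfolding shuffled_nth1[OF True] by (rule var_words_nth[OF w(1)]) (use rank1[OF True] in simp)
  next
    case False
    hence i: "i \<in> other_positions" using i by (simp add: length_shuffled)
    show ?thesis
      unfolding shuffled_nth2[OF i] by (rule var_words_nth[OF w(2)]) (use rank2[OF i] in simp)
  qed
  thus ?thesis unfolding mem_Collect_eq subset_iff by (metis in_set_conv_nth)
qed

lemma standardize_shuffled1: "standardize (letter_type A ((!) shuffled)) = word_type u"
proof -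
  have "letter_type {..<card A} (\<lambda>i. shuffled ! pick A i) = word_type (evens u)"
    using positions shuffled_nth1
    by (intro letter_type_cong) (simp_all add: pick_in_set_le card_pick_le)
  thus ?thesis by (simp only: standardize_letter_type[OF positions(3)] word_type_evens)
qed

lemma standardize_shuffled2: "standardize (letter_type other_positions ((!) shuffled)) = word_type v"
proof -
  have fin: "finite other_positions" by simp
  have "letter_type {..<card other_positions} (\<lambda>i. shuffled ! pick other_positions i) = word_type (odds v)"
  proof (rule letter_type_cong)
    fix i assume "i \<in> {..<length (odds v)}"
    hence i: "i < card other_positions" using card_other_positions by simp
    show "shuffled ! pick other_positions i = odds v ! i"
      using shuffled_nth2[OF pick_in_set_le[OF i]] card_pick_le[OF i] by simp
  qed (use card_other_positions in simp)
  thus ?thesis by (simp only: standardize_letter_type[OF fin] word_type_odds)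
qed

lemma positions_union: "A \<union> other_positions = {..<length u + length v}" and positions_disjoint: "A \<inter> other_positions = {}"
  using A by auto

lemma rigged_sum_shuffled:
  assumes "rigged_partition r {..<length u + length v} (word_type shuffled)"
  shows "rigged_sum r (word_type shuffled) (letter_type A ((!) shuffled)) (letter_type other_positions ((!) shuffled))"
  using rigged_sum_letter_type[of r A other_positions "(!) shuffled", OF _ positions_disjoint shuffled_separated] assms
  unfolding positions_union by (simp add: length_weave)

lemma rigged_sum_eq_shuffled:
  assumes P: "rigged_partition r {..<length u + length v} \<P>"
    and sum: "rigged_sum r \<P> \<P>1 \<P>2" and g: "ground \<P>1 = A"
    and st: "standardize \<P>1 = word_type u" "standardize \<P>2 = word_type v"
  shows "\<P>1 = letter_type A ((!) shuffled)" "\<P>2 = letter_type other_positions ((!) shuffled)" "\<P> = word_type shuffled"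
proof -
  note D = rigged_sumD[OF sum]
  have g2: "ground \<P>2 = other_positions" using D(3,4) g ground_rigged[OF P] by auto
  have words: "u \<in> var_words r" "v \<in> var_words r"
  proof -
    have in_words: "w \<in> var_words r" if "rigged_partition r B (word_type w)" for w B
    proof -
      have "rigged_partition r {..<length w} (word_type w)" using that ground_rigged[OF that] by simp
      hence "\<forall>i<length w. w ! i \<in> range Xvar \<union> Yvar ` {..<r}"
        by (subst (asm) rigged_letter_type) simp_all
      thus ?thesis unfolding mem_Collect_eq subset_iff by (metis in_set_conv_nth)
    qed
    show "u \<in> var_words r" "v \<in> var_words r"
      using rigged_standardize[OF D(1)] rigged_standardize[OF D(2)] st in_words by simp_all
  qed
  note valid = var_words_nth[OF shuffled_in_var_words[OF words]]
  have r1: "rigged_partition r A (letter_type A ((!) shuffled))"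
    unfolding rigged_letter_type[OF positions(3)] using valid positions(1) by (auto simp: length_shuffled)
  have r2: "rigged_partition r other_positions (letter_type other_positions ((!) shuffled))"
    by (subst rigged_letter_type) (use valid in \<open>auto simp: length_shuffled\<close>)
  show 1: "\<P>1 = letter_type A ((!) shuffled)"
    by (rule standardize_inject[OF _ r1]) (use D(1) g in simp, simp only: st(1) standardize_shuffled1)
  show 2: "\<P>2 = letter_type other_positions ((!) shuffled)"
    by (rule standardize_inject[OF _ r2]) (use D(2) g2 in simp, simp only: st(2) standardize_shuffled2)
  have wt: "word_type shuffled = letter_type (A \<union> other_positions) ((!) shuffled)"
    unfolding positions_union by (simp add: length_weave)
  show "\<P> = word_type shuffled"
  proof (rule prod_eqI)
    show "fst \<P> = fst (word_type shuffled)"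
      unfolding wt D(5) 1 2 by (rule fst_letter_type_Un[symmetric]) (rule shuffled_separated)
    show "snd \<P> = snd (word_type shuffled)"
    proof
      fix i
      have lt: "snd (letter_type C z) i = (if i \<in> C then snd (letter_type {i} z) i else None)"
        for C z by (simp add: letter_type_def)
      consider "i \<in> A" | "i \<in> other_positions" | "i \<notin> A \<union> other_positions" by blast
      thus "snd \<P> i = snd (word_type shuffled) i"
      proof cases
        case 1
        thus ?thesis
          using D(6)[of i] unfolding g wt lt[of "A \<union> other_positions"] \<open>\<P>1 = _\<close> lt[of A] by simp
      next
        case 2
        thus ?thesis
          using D(7)[of i] unfolding g2 wt lt[of "A \<union> other_positions"] \<open>\<P>2 = _\<close> lt[of other_positions] by simp
      next
        case 3
        thus ?thesis using D(8)[of i] unfolding D(3) g g2 wt lt[of "A \<union> other_positions"] by simp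
      qed
    qed
  qed
qed

end

text \<open>Splittings \<open>\<P> = \<P>1 + \<P>2\<close> into pieces of the types of \<open>u\<close> and \<open>v\<close> correspond to the sets \<open>A\<close> for which
  shuffling \<open>u\<close> into the positions \<open>A\<close> and \<open>v\<close> into the others gives a word of type \<open>\<P>\<close>: take for \<open>A\<close>
  the ground set of \<open>\<P>1\<close>.\<close>

lemma word_comult_m_rigged:
  assumes P: "rigged_partition r {..<n} \<P>"
  shows "word_comult (m_rigged n \<P>) =
    (\<Sum>(\<P>1, \<P>2) \<in> {(\<P>1, \<P>2). rigged_sum r \<P> \<P>1 \<P>2}.
          tens (m_rigged (card (ground \<P>1)) (standardize \<P>1))
               (m_rigged (card (ground \<P>2)) (standardize \<P>2)))" (is "_ = (\<Sum>(\<P>1, \<P>2) \<in> ?S. ?t \<P>1 \<P>2)")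
proof (rule ext, clarify)
  fix u v :: "nc_var list"
  let ?N = "length u + length v"
  let ?w = "\<lambda>A. weave A (evens u) (odds v)"
  define S where "S = {p \<in> ?S. card (ground (fst p)) = length u \<and> standardize (fst p) = word_type u \<and>
      card (ground (snd p)) = length v \<and> standardize (snd p) = word_type v}"
  define T where "T = {A \<in> subsets_of_card ?N (length u). ?N = n \<and> word_type (?w A) = \<P>}"
  have summand: "?t \<P>1 \<P>2 (u, v) = (if (\<P>1, \<P>2) \<in> S then 1 else 0)" if "(\<P>1, \<P>2) \<in> ?S" for \<P>1 \<P>2
  proof -
    note D = that[unfolded mem_Collect_eq prod.case, THEN rigged_sumD(1)]
      that[unfolded mem_Collect_eq prod.case, THEN rigged_sumD(2)]
    show ?thesis
      using that by (auto simp: tens_def S_def m_rigged_eq[OF D(1)[THEN rigged_standardize]]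
          m_rigged_eq[OF D(2)[THEN rigged_standardize]])
  qed
  have "(\<Sum>(\<P>1, \<P>2) \<in> ?S. ?t \<P>1 \<P>2) (u, v) = (\<Sum>p\<in>?S. if p \<in> S then 1 else 0)"
    unfolding sum_fun_apply by (rule sum.cong[OF refl]) (use summand in auto)
  also have "\<dots> = of_nat (card S)"
  proof -
    have "{p \<in> ?S. p \<in> S} = S" unfolding S_def by blast
    thus ?thesis
      using sum.inter_filter[OF finite_rigged_sums[OF P], of "\<lambda>_. 1 :: complex" "\<lambda>p. p \<in> S"] by simp
  qed
  also have "card S = card T"
  proof (rule bij_betw_same_card[where f = "\<lambda>p. ground (fst p)"], rule bij_betw_byWitness[where
        f' = "\<lambda>A. (letter_type A ((!) (?w A)), letter_type ({..<?N} - A) ((!) (?w A)))"])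
    have *: "A \<in> subsets_of_card ?N (length u) \<and> ?N = n \<and> \<P>1 = letter_type A ((!) (?w A)) \<and>
        \<P>2 = letter_type ({..<?N} - A) ((!) (?w A)) \<and> \<P> = word_type (?w A)"
      if p: "(\<P>1, \<P>2) \<in> S" and A: "A = ground \<P>1" for \<P>1 \<P>2 A
    proof -
      have sum: "rigged_sum r \<P> \<P>1 \<P>2" and cards: "card (ground \<P>1) = length u" "card (ground \<P>2) = length v"
        and st: "standardize \<P>1 = word_type u" "standardize \<P>2 = word_type v"
        using p by (auto simp: S_def)
      note D = rigged_sumD[OF sum]
      have un: "ground \<P>1 \<union> ground \<P>2 = {..<n}" using D(3) ground_rigged[OF P] by simp
      have "card (ground \<P>1 \<union> ground \<P>2) = ?N"
        using D(1,2,4) cards by (subst card_Un_disjoint) (auto simp: rigged_partition_def)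
      hence n: "?N = n" using un by simp
      have A': "A \<in> subsets_of_card ?N (length u)" using un n A cards by auto
      have P': "rigged_partition r {..<?N} \<P>" using P n by simp
      show ?thesis
        using rigged_sum_eq_shuffled[OF A' P' sum A[symmetric] st] A' n by blast
    qed
    show "\<forall>p\<in>S. (letter_type (ground (fst p)) ((!) (?w (ground (fst p)))),
        letter_type ({..<?N} - ground (fst p)) ((!) (?w (ground (fst p))))) = p"
    proof
      fix p assume "p \<in> S"
      hence "(fst p, snd p) \<in> S" by simp
      note eqs = *[OF this refl, THEN conjunct2, THEN conjunct2]
      show "(letter_type (ground (fst p)) ((!) (?w (ground (fst p)))),
        letter_type ({..<?N} - ground (fst p)) ((!) (?w (ground (fst p))))) = p"
        by (rule prod_eqI; unfold fst_conv snd_conv)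
           (rule eqs[THEN conjunct1, symmetric], rule eqs[THEN conjunct2, THEN conjunct1, symmetric])
    qed
    show "(\<lambda>p. ground (fst p)) ` S \<subseteq> T"
    proof (rule image_subsetI)
      fix p assume "p \<in> S"
      hence "(fst p, snd p) \<in> S" by simp
      from *[OF this refl] show "ground (fst p) \<in> T" unfolding T_def by blast
    qed
    show "(\<lambda>A. (letter_type A ((!) (?w A)), letter_type ({..<?N} - A) ((!) (?w A)))) ` T \<subseteq> S"
    proof (rule image_subsetI)
      fix A assume "A \<in> T"
      hence A: "A \<in> subsets_of_card ?N (length u)" and n: "?N = n" and wt: "word_type (?w A) = \<P>"
        by (auto simp: T_def)
      have "rigged_sum r \<P> (letter_type A ((!) (?w A))) (letter_type ({..<?N} - A) ((!) (?w A)))"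
        using rigged_sum_shuffled[OF A, of r] P n wt by simp
      moreover have "card ({..<?N} - A) = length v" using A by (intro card_lessThan_Diff) auto
      ultimately show "(letter_type A ((!) (?w A)), letter_type ({..<?N} - A) ((!) (?w A))) \<in> S"
        using A standardize_shuffled1[OF A] standardize_shuffled2[OF A] by (simp add: S_def)
    qed
  qed simp
  also have "of_nat (card T) = (\<Sum>A\<in>subsets_of_card ?N (length u). m_rigged n \<P> (?w A))"
  proof -
    have fin: "finite (subsets_of_card ?N (length u))"
      by (rule finite_subset[of _ "Pow {..<?N}"]) auto
    have "(\<Sum>A\<in>subsets_of_card ?N (length u). m_rigged n \<P> (?w A)) =
        (\<Sum>A\<in>subsets_of_card ?N (length u). if ?N = n \<and> word_type (?w A) = \<P> then 1 else 0)"
      by (rule sum.cong[OF refl]) (simp add: m_rigged_eq[OF P] length_weave)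
    also have "\<dots> = of_nat (card T)"
      using sum.inter_filter[OF fin, of "\<lambda>_. 1 :: complex" "\<lambda>A. ?N = n \<and> word_type (?w A) = \<P>"]
      by (simp add: T_def)
    finally show ?thesis ..
  qed
  also have "\<dots> = word_comult (m_rigged n \<P>) (u, v)"
    by (simp add: word_comult_def shuf_sum_eq_weave)
  finally show "word_comult (m_rigged n \<P>) (u, v) = (\<Sum>(\<P>1, \<P>2) \<in> ?S. ?t \<P>1 \<P>2) (u, v)" ..
qed

abbreviation basis_comult :: "nat \<Rightarrow> nat \<times> rigged \<Rightarrow> nc_var list \<times> nc_var list \<Rightarrow> complex" where
  "basis_comult r \<equiv> (\<lambda>(n, \<P>). \<Sum>(\<P>1, \<P>2) \<in> {(\<P>1, \<P>2). rigged_sum r \<P> \<P>1 \<P>2}.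
          tens (m_rigged (card (ground \<P>1)) (standardize \<P>1))
               (m_rigged (card (ground \<P>2)) (standardize \<P>2)))"

lemma word_comult_sum: "word_comult (\<Sum>i\<in>I. f i) = (\<Sum>i\<in>I. word_comult (f i))"
proof -
  have "linear_on UNIV UNIV word_comult"
    by (rule linear_onI) (simp_all add: word_comult_add word_comult_fscale)
  from linear_on_sum[OF this fvs.subspace_UNIV] show ?thesis by simp
qed

lemma word_comult_combination:
  assumes "J \<subseteq> rigged_index r"
  shows "word_comult (\<Sum>i\<in>J. fscale (a i) (case i of (n, \<P>) \<Rightarrow> m_rigged n \<P>)) =
    (\<Sum>i\<in>J. fscale (a i) (basis_comult r i))"
  unfolding word_comult_sum
  by (rule sum.cong[OF refl]) (use assms in \<open>auto simp: word_comult_fscale word_comult_m_rigged[of r]\<close>)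

lemma NPS_expansion':
  assumes f: "f \<in> NPS_space r"
  obtains J a where "finite J" "J \<subseteq> rigged_index r"
    "f = (\<Sum>i\<in>J. fscale (a i) (case i of (n, \<P>) \<Rightarrow> m_rigged n \<P>))"
proof -
  obtain J where J: "finite J" "J \<subseteq> rigged_index r"
    "f = (\<Sum>(n, \<P>)\<in>J. fscale (f (rigged_word n \<P>)) (m_rigged n \<P>))"
    using NPS_expansion[OF f] by blast
  have "(\<Sum>(n, \<P>)\<in>J. fscale (f (rigged_word n \<P>)) (m_rigged n \<P>)) =
    (\<Sum>i\<in>J. fscale (f (rigged_word (fst i) (snd i))) (case i of (n, \<P>) \<Rightarrow> m_rigged n \<P>))"
    by (rule sum.cong) auto
  with J show thesis using that[of J "\<lambda>i. f (rigged_word (fst i) (snd i))"] by simp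
qed

text \<open>Since \<^const>\<open>word_comult\<close> is linear and has the right values on the monomial functions, any two
  expansions of \<open>f\<close> give the same value.\<close>

lemma NPS_comult_eq:
  assumes f: "f \<in> NPS_space r"
  shows "NPS_comult r f = word_comult f"
  unfolding NPS_comult_def linear_extension_def
proof (rule the_equality)
  obtain J a where J: "finite J" "J \<subseteq> rigged_index r"
    "f = (\<Sum>i\<in>J. fscale (a i) (case i of (n, \<P>) \<Rightarrow> m_rigged n \<P>))"
    using NPS_expansion'[OF f] .
  moreover have "word_comult f = (\<Sum>i\<in>J. fscale (a i) (basis_comult r i))"
    unfolding J(3) by (rule word_comult_combination[OF J(2)])
  ultimately show "\<exists>J a. finite J \<and> J \<subseteq> rigged_index r \<and>
      f = (\<Sum>i\<in>J. fscale (a i) (case i of (n, \<P>) \<Rightarrow> m_rigged n \<P>)) \<and>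
      word_comult f = (\<Sum>i\<in>J. fscale (a i) (basis_comult r i))" by blast
next
  fix w assume "\<exists>J a. finite J \<and> J \<subseteq> rigged_index r \<and>
      f = (\<Sum>i\<in>J. fscale (a i) (case i of (n, \<P>) \<Rightarrow> m_rigged n \<P>)) \<and>
      w = (\<Sum>i\<in>J. fscale (a i) (basis_comult r i))"
  then obtain J a where J: "J \<subseteq> rigged_index r"
      "f = (\<Sum>i\<in>J. fscale (a i) (case i of (n, \<P>) \<Rightarrow> m_rigged n \<P>))"
      "w = (\<Sum>i\<in>J. fscale (a i) (basis_comult r i))" by blast
  show "w = word_comult f" unfolding J(2,3) by (rule word_comult_combination[OF J(1), symmetric])
qed

lemma word_comult_in_tensor_space:
  assumes f: "f \<in> NPS_space r"
  shows "word_comult f \<in> tensor_space (NPS_space r) (NPS_space r)"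
proof -
  obtain J a where J: "finite J" "J \<subseteq> rigged_index r"
    "f = (\<Sum>i\<in>J. fscale (a i) (case i of (n, \<P>) \<Rightarrow> m_rigged n \<P>))"
    using NPS_expansion'[OF f] .
  have "basis_comult r i \<in> tensor_space (NPS_space r) (NPS_space r)" for i
  proof -
    obtain n \<P> where i: "i = (n, \<P>)" by (rule prod.exhaust)
    show ?thesis
      unfolding i prod.case
    proof (rule fvs.subspace_sum[OF subspace_tensor_space], clarify)
      fix a b c d assume "rigged_sum r \<P> (a, b) (c, d)"
      note D = rigged_sumD(1,2)[OF this, THEN rigged_standardize]
      show "tens (m_rigged (card (ground (a, b))) (standardize (a, b)))
          (m_rigged (card (ground (c, d))) (standardize (c, d))) \<in> tensor_space (NPS_space r) (NPS_space r)"
        by (intro tens_in_tensor_space m_rigged_in_NPS D)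
    qed
  qed
  thus ?thesis
    unfolding J(3) word_comult_combination[OF J(2)]
    by (intro fvs.subspace_sum[OF subspace_tensor_space] fvs.subspace_scale[OF subspace_tensor_space])
qed

section \<open>The Hopf algebra of partially symmetric functions\<close>

lemma NPS_simps [simp]:
  "hspace (NPS r) = NPS_space r" "hmult (NPS r) = NPS_mult" "hunit (NPS r) = NPS_unit"
  "hcomult (NPS r) = NPS_comult r" "hcounit (NPS r) = NPS_counit"
  by (simp_all add: NPS_def)

lemma NPS_mult_add1: "NPS_mult (f + g) h = NPS_mult f h + NPS_mult g h"
  and NPS_mult_add2: "NPS_mult h (f + g) = NPS_mult h f + NPS_mult h g"
  and NPS_mult_scale1: "NPS_mult (fscale c f) h = fscale c (NPS_mult f h)"
  and NPS_mult_scale2: "NPS_mult h (fscale c f) = fscale c (NPS_mult h f)"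
  by (auto simp: NPS_mult_def fscale_apply fun_eq_iff sum.distrib sum_distrib_left algebra_simps)

lemma NPS_mult_assoc: "NPS_mult (NPS_mult f g) h w = NPS_mult f (NPS_mult g h) w"
proof (induction w arbitrary: f)
  case (Cons x w)
  have "(\<lambda>v. NPS_mult f g (x # v)) = fscale (f []) (\<lambda>v. g (x # v)) + NPS_mult (\<lambda>v. f (x # v)) g"
    by (auto simp: fun_eq_iff NPS_mult_Cons fscale_apply)
  hence "NPS_mult (NPS_mult f g) h (x # w) =
      f [] * g [] * h (x # w) + f [] * NPS_mult (\<lambda>v. g (x # v)) h w +
      NPS_mult (NPS_mult (\<lambda>v. f (x # v)) g) h w"
    by (simp add: NPS_mult_Cons[of _ h] NPS_mult_add1 NPS_mult_scale1 fscale_apply)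
  also have "\<dots> = NPS_mult f (NPS_mult g h) (x # w)"
    by (simp add: Cons NPS_mult_Cons algebra_simps)
  finally show ?case .
qed simp

lemma NPS_mult_unit_left: "NPS_mult NPS_unit f = f"
proof
  fix w
  have "NPS_mult NPS_unit f w = (\<Sum>k\<le>length w. if k = 0 then f w else 0)"
    unfolding NPS_mult_def by (rule sum.cong) (auto simp: NPS_unit_def)
  thus "NPS_mult NPS_unit f w = f w" by simp
qed

lemma NPS_mult_unit_right: "NPS_mult f NPS_unit = f"
proof
  fix w
  have "NPS_mult f NPS_unit w = (\<Sum>k\<le>length w. if k = length w then f w else 0)"
    unfolding NPS_mult_def by (rule sum.cong) (auto simp: NPS_unit_def)
  thus "NPS_mult f NPS_unit w = f w" by simp
qed

lemma NPS_mult_closed: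
  assumes f: "f \<in> NPS_space r" and g: "g \<in> NPS_space r"
  shows "NPS_mult f g \<in> NPS_space r"
proof -
  have "NPS_mult f g w = 0" if w: "w \<notin> var_words r" for w
    unfolding NPS_mult_def
  proof (rule sum.neutral, rule ballI)
    fix k
    have "take k w \<notin> var_words r \<or> drop k w \<notin> var_words r"
    proof (rule ccontr)
      assume "\<not> ?thesis"
      hence "set (take k w @ drop k w) \<subseteq> range Xvar \<union> Yvar ` {..<r}"
        unfolding set_append by blast
      with w show False by simp
    qed
    thus "f (take k w) * g (drop k w) = 0"
      using NPS_spaceD(1)[OF f, of "take k w"] NPS_spaceD(1)[OF g, of "drop k w"] by fastforce
  qed
  moreover obtain N M where N: "\<forall>w. length w > N \<longrightarrow> f w = 0" and M: "\<forall>w. length w > M \<longrightarrow> g w = 0"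
    using NPS_spaceD(3) f g by metis
  have "NPS_mult f g w = 0" if w: "length w > N + M" for w
    unfolding NPS_mult_def
  proof (rule sum.neutral, rule ballI)
    fix k assume "k \<in> {..length w}"
    hence "length (take k w) > N \<or> length (drop k w) > M" using w by auto
    thus "f (take k w) * g (drop k w) = 0" using N M by auto
  qed
  moreover have "renaming_invariant (NPS_mult f g)"
    unfolding renaming_invariant_def NPS_mult_def
    by (simp add: take_map drop_map renaming_invariantD[OF NPS_spaceD(2)[OF f]]
        renaming_invariantD[OF NPS_spaceD(2)[OF g]])
  ultimately show ?thesis unfolding NPS_space_iff by blast
qed

lemma NPS_unit_in: "NPS_unit \<in> NPS_space r"
proof -
  have "\<exists>N. \<forall>w. length w > N \<longrightarrow> NPS_unit w = 0"
    by (intro exI[of _ 0]) (simp add: NPS_unit_def)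
  thus ?thesis by (auto simp: NPS_space_iff NPS_unit_def renaming_invariant_def)
qed

lemma NPS_mult_bilinear: "bilinear_on (NPS_space r) (NPS_space r) NPS_mult"
  by (rule bilinear_onI) (simp_all add: NPS_mult_add1 NPS_mult_add2 NPS_mult_scale1 NPS_mult_scale2)

lemma unital_algebra_NPS: "unital_algebra (NPS r)"
  by unfold_locales
     (simp_all add: subspace_NPS_space NPS_mult_closed NPS_mult_bilinear NPS_mult_assoc fun_eq_iff[of "NPS_mult _ _"]
        NPS_unit_in NPS_mult_unit_left NPS_mult_unit_right)

lemma NPS_comult_add: "f \<in> NPS_space r \<Longrightarrow> g \<in> NPS_space r \<Longrightarrow>
    NPS_comult r (f + g) = NPS_comult r f + NPS_comult r g"
  and NPS_comult_scale: "f \<in> NPS_space r \<Longrightarrow> NPS_comult r (fscale c f) = fscale c (NPS_comult r f)"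
  by (simp_all add: NPS_comult_eq fvs.subspace_add[OF subspace_NPS_space]
      fvs.subspace_scale[OF subspace_NPS_space] word_comult_add word_comult_fscale)

text \<open>A linear map applied to one tensor factor of the coproduct is evaluated by applying it to the
  coproduct as a function of the corresponding argument.\<close>

lemma NPS_tensor_expansion:
  assumes f: "f \<in> NPS_space r"
  obtains n :: nat and a b where
    "\<And>i. i < n \<Longrightarrow> a i \<in> NPS_space r \<and> b i \<in> NPS_space r"
    "NPS_comult r f = (\<Sum>i<n. tens (a i) (b i))"
    "\<And>x y. word_comult f (x, y) = (\<Sum>i<n. a i x * b i y)"
    "\<And>\<beta>. bilinear_on (NPS_space r) (NPS_space r) \<beta> \<Longrightarrow>
       tensor_lift (NPS_space r) (NPS_space r) \<beta> (NPS_comult r f) = (\<Sum>i<n. \<beta> (a i) (b i))"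
proof -
  obtain n :: nat and a b where ab: "\<And>i. i < n \<Longrightarrow> a i \<in> NPS_space r" "\<And>i. i < n \<Longrightarrow> b i \<in> NPS_space r"
    "word_comult f = (\<Sum>i<n. tens (a i) (b i))"
    by (rule tensor_spaceE[OF word_comult_in_tensor_space[OF f] subspace_NPS_space]) blast
  show thesis
  proof (rule that[of n a b])
    show "NPS_comult r f = (\<Sum>i<n. tens (a i) (b i))" using ab by (simp add: NPS_comult_eq f)
    thus "tensor_lift (NPS_space r) (NPS_space r) \<beta> (NPS_comult r f) = (\<Sum>i<n. \<beta> (a i) (b i))"
      if "bilinear_on (NPS_space r) (NPS_space r) \<beta>" for \<beta> :: "_ \<Rightarrow> _ \<Rightarrow> 'x \<Rightarrow> complex"
      using ab that by (simp only:) (intro tensor_lift_eq subspace_NPS_space, auto)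
    show "word_comult f (x, y) = (\<Sum>i<n. a i x * b i y)" for x y
      unfolding ab(3) by (simp add: sum_fun_apply tens_def)
  qed (use ab in auto)
qed

lemma word_comult_linear_combination:
  "word_comult (\<lambda>x. \<Sum>i\<in>I. g i x * c i) p = (\<Sum>i\<in>I. word_comult (g i) p * c i)"
proof -
  have "(\<lambda>x. \<Sum>i\<in>I. g i x * c i) = (\<Sum>i\<in>I. fscale (c i) (g i))"
    by (auto simp: fun_eq_iff sum_fun_apply fscale_apply mult.commute)
  thus ?thesis by (simp add: word_comult_sum word_comult_fscale sum_fun_apply fscale_apply mult.commute)
qed

lemma word_antipode_linear_combination:
  "word_antipode w (\<lambda>x. \<Sum>i\<in>I. g i x * c i) = (\<Sum>i\<in>I. word_antipode w (g i) * c i)"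
  by (simp add: word_antipode_sum mult.commute[of _ "c _"] word_antipode_cmult)

lemma counital_coalgebra_NPS: "counital_coalgebra (NPS r)"
proof (unfold_locales, unfold NPS_simps)
  show "fvs.subspace (NPS_space r)" by (rule subspace_NPS_space)
  show "linear_on (NPS_space r) (tensor_space (NPS_space r) (NPS_space r)) (NPS_comult r)"
    by (rule linear_onI)
       (simp_all add: NPS_comult_add NPS_comult_scale word_comult_in_tensor_space NPS_comult_eq)
  show "linear_form_on (NPS_space r) NPS_counit"
    by (simp add: linear_form_on_def NPS_counit_def fscale_apply)
  fix f assume f: "f \<in> NPS_space r"
  note inv = NPS_spaceD(2)[OF f]
  have bi: "bilinear_on (NPS_space r) (NPS_space r) (\<lambda>a b. reassoc (tens (NPS_comult r a) b))"
    "bilinear_on (NPS_space r) (NPS_space r) (\<lambda>a b. tens a (NPS_comult r b))"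
    by (auto intro!: bilinear_onI simp: tens_simps tens_simps' reassoc_simps NPS_comult_add NPS_comult_scale)
  show "tensor_lift (NPS_space r) (NPS_space r) (\<lambda>a b. reassoc (tens (NPS_comult r a) b)) (NPS_comult r f) =
    tensor_lift (NPS_space r) (NPS_space r) (\<lambda>a b. tens a (NPS_comult r b)) (NPS_comult r f)"
  proof -
    obtain n :: nat and a b where ab: "\<And>i. i < n \<Longrightarrow> a i \<in> NPS_space r \<and> b i \<in> NPS_space r"
      and D: "\<And>x y. word_comult f (x, y) = (\<Sum>i<n. a i x * b i y)"
      and L: "\<And>\<beta> :: _ \<Rightarrow> _ \<Rightarrow> nc_var list \<times> nc_var list \<times> nc_var list \<Rightarrow> complex.
        bilinear_on (NPS_space r) (NPS_space r) \<beta> \<Longrightarrow>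
        tensor_lift (NPS_space r) (NPS_space r) \<beta> (NPS_comult r f) = (\<Sum>i<n. \<beta> (a i) (b i))"
      by (rule NPS_tensor_expansion[OF f]) blast
    have "(\<Sum>i<n. reassoc (tens (NPS_comult r (a i)) (b i))) (x, y, z) =
        (\<Sum>i<n. tens (a i) (NPS_comult r (b i))) (x, y, z)" for x y z
    proof -
      have "(\<Sum>i<n. reassoc (tens (NPS_comult r (a i)) (b i))) (x, y, z) =
          (\<Sum>i<n. word_comult (a i) (x, y) * b i z)"
        using ab by (simp add: sum_fun_apply reassoc_def tens_def NPS_comult_eq)
      also have "\<dots> = word_comult (\<lambda>s. word_comult f (s, z)) (x, y)"
        by (simp add: D word_comult_linear_combination)
      also have "\<dots> = word_comult (\<lambda>t. word_comult f (x, t)) (y, z)"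
        by (rule word_comult_coassoc[OF inv])
      also have "\<dots> = (\<Sum>i<n. word_comult (b i) (y, z) * a i x)"
        by (simp add: D mult.commute[of "a _ x"] word_comult_linear_combination)
      also have "\<dots> = (\<Sum>i<n. tens (a i) (NPS_comult r (b i))) (x, y, z)"
        using ab by (simp add: sum_fun_apply tens_def NPS_comult_eq mult.commute)
      finally show ?thesis .
    qed
    thus ?thesis unfolding L[OF bi(1)] L[OF bi(2)] by (auto simp: fun_eq_iff)
  qed
  have bi': "bilinear_on (NPS_space r) (NPS_space r) (\<lambda>a b. fscale (NPS_counit a) b)"
    "bilinear_on (NPS_space r) (NPS_space r) (\<lambda>a b. fscale (NPS_counit b) a)"
    by (auto intro!: bilinear_onI simp: NPS_counit_def fscale_def fun_eq_iff algebra_simps)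
  obtain n :: nat and a b where ab: "\<And>i. i < n \<Longrightarrow> a i \<in> NPS_space r \<and> b i \<in> NPS_space r"
    and D: "\<And>x y. word_comult f (x, y) = (\<Sum>i<n. a i x * b i y)"
    and L: "\<And>\<beta> :: _ \<Rightarrow> _ \<Rightarrow> nc_var list \<Rightarrow> complex.
      bilinear_on (NPS_space r) (NPS_space r) \<beta> \<Longrightarrow>
      tensor_lift (NPS_space r) (NPS_space r) \<beta> (NPS_comult r f) = (\<Sum>i<n. \<beta> (a i) (b i))"
    by (rule NPS_tensor_expansion[OF f]) blast
  show "tensor_lift (NPS_space r) (NPS_space r) (\<lambda>a b. fscale (NPS_counit a) b) (NPS_comult r f) = f"
    unfolding L[OF bi'(1)] using word_comult_Nil1[OF inv]
    by (simp add: D fun_eq_iff sum_fun_apply fscale_apply NPS_counit_def)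
  show "tensor_lift (NPS_space r) (NPS_space r) (\<lambda>a b. fscale (NPS_counit b) a) (NPS_comult r f) = f"
    unfolding L[OF bi'(2)] using word_comult_Nil2[OF inv]
    by (simp add: D fun_eq_iff sum_fun_apply fscale_apply NPS_counit_def mult.commute)
qed

lemma word_comult_unit: "word_comult NPS_unit = tens NPS_unit NPS_unit"
proof (rule ext, clarify)
  fix u v :: "nc_var list"
  show "word_comult NPS_unit (u, v) = tens NPS_unit NPS_unit (u, v)"
  proof (cases "u = [] \<and> v = []")
    case True
    thus ?thesis by (simp add: word_comult_def tens_def NPS_unit_def)
  next
    case False
    have "word_comult NPS_unit (u, v) = 0"
      by (rule word_comult_eq_0) (use False in \<open>auto simp: NPS_unit_def\<close>)
    with False show ?thesis by (auto simp: tens_def NPS_unit_def)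
  qed
qed

lemma bialgebra_NPS: "bialgebra (NPS r)"
proof -
  interpret unital_algebra "NPS r" by (rule unital_algebra_NPS)
  interpret counital_coalgebra "NPS r" by (rule counital_coalgebra_NPS)
  show ?thesis
  proof (unfold_locales, unfold NPS_simps)
    fix f g assume f: "f \<in> NPS_space r" and g: "g \<in> NPS_space r"
    obtain n :: nat and a b where ab: "\<And>i. i < n \<Longrightarrow> a i \<in> NPS_space r \<and> b i \<in> NPS_space r"
      and E1: "NPS_comult r f = (\<Sum>i<n. tens (a i) (b i))"
      and D1: "\<And>x y. word_comult f (x, y) = (\<Sum>i<n. a i x * b i y)"
      by (rule NPS_tensor_expansion[OF f]) blast
    obtain m :: nat and c d where cd: "\<And>i. i < m \<Longrightarrow> c i \<in> NPS_space r \<and> d i \<in> NPS_space r"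
      and E2: "NPS_comult r g = (\<Sum>i<m. tens (c i) (d i))"
      and D2: "\<And>x y. word_comult g (x, y) = (\<Sum>i<m. c i x * d i y)"
      by (rule NPS_tensor_expansion[OF g]) blast
    have TM: "tensor_mult (NPS r) (NPS_comult r f) (NPS_comult r g) =
        (\<Sum>i<n. \<Sum>j<m. tens (NPS_mult (a i) (c j)) (NPS_mult (b i) (d j)))"
      unfolding E1 E2 using tensor_mult_expansion[of n a b m c d] ab cd by simp
    have "word_comult (NPS_mult f g) (u, v) =
        (\<Sum>i<n. \<Sum>j<m. tens (NPS_mult (a i) (c j)) (NPS_mult (b i) (d j))) (u, v)" for u v
    proof -
      define X where "X k l i j = a i (take k u) * c j (drop k u) * (b i (take l v) * d j (drop l v))"
        for k l i j
      have "word_comult (NPS_mult f g) (u, v) =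
          (\<Sum>k\<le>length u. \<Sum>l\<le>length v. \<Sum>i<n. \<Sum>j<m. X k l i j)"
        by (simp add: word_comult_mult D1 D2 sum_product X_def mult_ac)
      also have "\<dots> = (\<Sum>k\<le>length u. \<Sum>i<n. \<Sum>l\<le>length v. \<Sum>j<m. X k l i j)"
        by (rule sum.cong[OF refl]) (rule sum.swap)
      also have "\<dots> = (\<Sum>i<n. \<Sum>k\<le>length u. \<Sum>l\<le>length v. \<Sum>j<m. X k l i j)"
        by (rule sum.swap)
      also have "\<dots> = (\<Sum>i<n. \<Sum>k\<le>length u. \<Sum>j<m. \<Sum>l\<le>length v. X k l i j)"
        by (rule sum.cong[OF refl], rule sum.cong[OF refl]) (rule sum.swap)
      also have "\<dots> = (\<Sum>i<n. \<Sum>j<m. \<Sum>k\<le>length u. \<Sum>l\<le>length v. X k l i j)"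
        by (rule sum.cong[OF refl]) (rule sum.swap)
      also have "\<dots> = (\<Sum>i<n. \<Sum>j<m. tens (NPS_mult (a i) (c j)) (NPS_mult (b i) (d j))) (u, v)"
        by (simp add: sum_fun_apply tens_def NPS_mult_def sum_product X_def)
      finally show ?thesis .
    qed
    thus "NPS_comult r (NPS_mult f g) = tensor_mult (NPS r) (NPS_comult r f) (NPS_comult r g)"
      unfolding TM NPS_comult_eq[OF NPS_mult_closed[OF f g]] by (auto simp: fun_eq_iff)
    show "NPS_counit (NPS_mult f g) = NPS_counit f * NPS_counit g" by (simp add: NPS_counit_def)
  next
    show "NPS_comult r NPS_unit = tens NPS_unit NPS_unit"
      by (simp add: NPS_comult_eq NPS_unit_in word_comult_unit)
    show "NPS_counit NPS_unit = 1" by (simp add: NPS_counit_def NPS_unit_def)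
  qed
qed

theorem hopf_algebra_NPS: "hopf_algebra (NPS r)"
proof -
  let ?S = "\<lambda>f w. word_antipode w f"
  have lin: "?S (f + g) = ?S f + ?S g" "?S (fscale c f) = fscale c (?S f)" for f g c
    by (auto simp: fun_eq_iff plus_fun_def fscale_def word_antipode_add word_antipode_cmult)
  have "is_antipode (NPS r) ?S"
    unfolding is_antipode_def NPS_simps
  proof (intro conjI ballI)
    show "linear_on (NPS_space r) (NPS_space r) ?S"
      by (rule linear_onI) (simp_all only: lin word_antipode_NPS)
    fix f assume f: "f \<in> NPS_space r"
    note inv = NPS_spaceD(2)[OF f]
    have bi: "bilinear_on (NPS_space r) (NPS_space r) (\<lambda>a b. NPS_mult (?S a) b)"
      "bilinear_on (NPS_space r) (NPS_space r) (\<lambda>a b. NPS_mult a (?S b))"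
      by (rule bilinear_onI;
          simp only: lin NPS_mult_add1 NPS_mult_add2 NPS_mult_scale1 NPS_mult_scale2)+
    obtain n :: nat and a b where D: "\<And>x y. word_comult f (x, y) = (\<Sum>i<n. a i x * b i y)"
      and L: "\<And>\<beta> :: _ \<Rightarrow> _ \<Rightarrow> nc_var list \<Rightarrow> complex.
        bilinear_on (NPS_space r) (NPS_space r) \<beta> \<Longrightarrow>
        tensor_lift (NPS_space r) (NPS_space r) \<beta> (NPS_comult r f) = (\<Sum>i<n. \<beta> (a i) (b i))"
      by (rule NPS_tensor_expansion[OF f]) blast
    have \<epsilon>: "fscale (NPS_counit f) NPS_unit = (\<lambda>w. if w = [] then f [] else 0)"
      by (auto simp: fscale_def NPS_counit_def NPS_unit_def)
    have "(\<Sum>i<n. NPS_mult (?S (a i)) (b i)) w = convolution word_antipode word_id w f" for w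
    proof -
      have "(\<Sum>i<n. NPS_mult (?S (a i)) (b i)) w =
          (\<Sum>k\<le>length w. \<Sum>i<n. word_antipode (take k w) (a i) * b i (drop k w))"
        unfolding sum_fun_apply NPS_mult_def by (rule sum.swap)
      thus ?thesis by (simp add: convolution_def D word_antipode_linear_combination)
    qed
    thus "tensor_lift (NPS_space r) (NPS_space r) (\<lambda>a b. NPS_mult (?S a) b) (NPS_comult r f) =
        fscale (NPS_counit f) NPS_unit"
      unfolding L[OF bi(1)] \<epsilon> by (simp add: fun_eq_iff antipode_left[OF inv])
    have "(\<Sum>i<n. NPS_mult (a i) (?S (b i))) w = convolution word_id word_antipode w f" for w
    proof -
      have "(\<Sum>i<n. NPS_mult (a i) (?S (b i))) w =
          (\<Sum>k\<le>length w. \<Sum>i<n. a i (take k w) * word_antipode (drop k w) (b i))"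
        unfolding sum_fun_apply NPS_mult_def by (rule sum.swap)
      thus ?thesis
        by (simp add: convolution_def D mult.commute[of "a _ _"] word_antipode_linear_combination)
    qed
    thus "tensor_lift (NPS_space r) (NPS_space r) (\<lambda>a b. NPS_mult a (?S b)) (NPS_comult r f) =
        fscale (NPS_counit f) NPS_unit"
      unfolding L[OF bi(2)] \<epsilon> by (simp add: fun_eq_iff antipode_right[OF inv])
  qed
  thus ?thesis
    using bialgebra_NPS by (simp add: hopf_algebra_def hopf_algebra_axioms_def) blast
qed

section \<open>Upper triangular matrices\<close>

text \<open>As classical rules these would decompose every triangularity hypothesis into its entries.\<close>

declare upper_triangularD [rule del] upper_triangularI [rule del]

lemma mult_mat_sum:
  assumes "A \<in> carrier_mat n n" "B \<in> carrier_mat n n" "i < n" "j < n"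
  shows "(A * B) $$ (i, j) = (\<Sum>l<n. A $$ (i, l) * B $$ (l, j))"
  using assms by (simp add: scalar_prod_def atLeast0LessThan)

lemma square_assoc:
  "A \<in> carrier_mat n n \<Longrightarrow> B \<in> carrier_mat n n \<Longrightarrow> C \<in> carrier_mat n n \<Longrightarrow> (A * B) * C = A * (B * C)"
  for A :: "'q::field mat"
  by simp

lemma square_mult_closed:
  "A \<in> carrier_mat n n \<Longrightarrow> B \<in> carrier_mat n n \<Longrightarrow> A * B \<in> carrier_mat n n"
  for A :: "'q::field mat"
  by simp

lemma upper_triangular_zero:
  "upper_triangular A \<Longrightarrow> A \<in> carrier_mat n n \<Longrightarrow> j < i \<Longrightarrow> i < n \<Longrightarrow> A $$ (i, j) = 0"
  by (simp add: upper_triangularD)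

lemma upper_triangular_carrierI:
  assumes "A \<in> carrier_mat n n" "\<And>i j. i < n \<Longrightarrow> j < i \<Longrightarrow> A $$ (i, j) = 0"
  shows "upper_triangular A"
  by (rule upper_triangularI) (use assms in auto)

lemma upper_triangular_mult:
  fixes A B :: "'q::field mat"
  assumes A: "A \<in> carrier_mat n n" "upper_triangular A" and B: "B \<in> carrier_mat n n" "upper_triangular B"
  shows "upper_triangular (A * B)" and "i < n \<Longrightarrow> (A * B) $$ (i, i) = A $$ (i, i) * B $$ (i, i)"
proof -
  show "upper_triangular (A * B)"
  proof (rule upper_triangular_carrierI)
    show "A * B \<in> carrier_mat n n" using A B by simp
    fix i j assume ij: "i < n" "j < i"
    have "A $$ (i, l) * B $$ (l, j) = 0" if "l < n" for l
      using upper_triangular_zero[OF A(2,1), of l i] upper_triangular_zero[OF B(2,1), of j l] ij that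
      by (cases "l < i") auto
    thus "(A * B) $$ (i, j) = 0"
      using A B ij by (subst mult_mat_sum[of _ n]) (auto intro!: sum.neutral)
  qed
  assume i: "i < n"
  have "A $$ (i, l) * B $$ (l, i) = (if l = i then A $$ (i, i) * B $$ (i, i) else 0)" if "l < n" for l
    using upper_triangular_zero[OF A(2,1), of l i] upper_triangular_zero[OF B(2,1), of i l] i that
    by (cases l i rule: linorder_cases) auto
  hence "(\<Sum>l<n. A $$ (i, l) * B $$ (l, i)) = (\<Sum>l<n. if l = i then A $$ (i, i) * B $$ (i, i) else 0)"
    by (intro sum.cong) simp_all
  thus "(A * B) $$ (i, i) = A $$ (i, i) * B $$ (i, i)" using i by (simp only: mult_mat_sum[OF A(1) B(1) i i]) simp
qed

lemma det_upper_triangular_nonzero: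
  fixes A :: "'q::field mat"
  assumes "A \<in> carrier_mat n n" "upper_triangular A"
  shows "det A \<noteq> 0 \<longleftrightarrow> (\<forall>i<n. A $$ (i, i) \<noteq> 0)"
  unfolding det_upper_triangular[OF assms(2,1)] prod_list_zero_iff
  using assms(1) by (auto simp: diag_mat_def)

lemma upper_triangular_inverse:
  fixes A :: "'q::field mat"
  assumes A: "A \<in> carrier_mat n n" "upper_triangular A" and d: "\<And>i. i < n \<Longrightarrow> A $$ (i, i) \<noteq> 0"
  shows "\<exists>B. mat_inverse A = Some B \<and> B \<in> carrier_mat n n \<and> A * B = 1\<^sub>m n \<and> B * A = 1\<^sub>m n \<and>
    upper_triangular B \<and> (\<forall>i<n. B $$ (i, i) = 1 / A $$ (i, i))"
proof -
  have "det A \<noteq> 0" using det_upper_triangular_nonzero[OF A] d by blast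
  hence "A \<in> Units (ring_mat TYPE('q) n (0::nat))" by (rule det_non_zero_imp_unit[OF A(1)])
  then obtain B where B: "mat_inverse A = Some B"
    using mat_inverse(1)[OF A(1), where b = "0::nat"] by (cases "mat_inverse A") auto
  note B' = mat_inverse(2)[OF A(1) B]
  hence Bc: "B \<in> carrier_mat n n" and AB: "A * B = 1\<^sub>m n" and BA: "B * A = 1\<^sub>m n" by auto
  have zero: "i < n \<Longrightarrow> j < i \<Longrightarrow> B $$ (i, j) = 0" for i j
  proof (induction "n - i" arbitrary: i rule: less_induct)
    case less
    have "A $$ (i, l) * B $$ (l, j) = (if l = i then A $$ (i, i) * B $$ (i, j) else 0)" if "l < n" for l
      using upper_triangular_zero[OF A(2,1), of l i] less that
      by (cases l i rule: linorder_cases) auto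
    hence "(\<Sum>l<n. A $$ (i, l) * B $$ (l, j)) = (\<Sum>l<n. if l = i then A $$ (i, i) * B $$ (i, j) else 0)"
      by (intro sum.cong) simp_all
    hence "(A * B) $$ (i, j) = A $$ (i, i) * B $$ (i, j)"
      using less.prems by (subst mult_mat_sum[OF A(1) Bc]) simp_all
    thus ?case using AB d[of i] less by simp
  qed
  have up: "upper_triangular B" by (rule upper_triangular_carrierI[OF Bc zero])
  have "B $$ (i, i) = 1 / A $$ (i, i)" if "i < n" for i
    using upper_triangular_mult(2)[OF A Bc up that] AB d[OF that] that by (simp add: field_simps)
  with B Bc AB BA up show ?thesis by blast
qed

lemma tri_group_iff:
  "g \<in> tri_group n \<longleftrightarrow> g \<in> carrier_mat n n \<and> upper_triangular g \<and> (\<forall>i<n. g $$ (i, i) \<noteq> 0)"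
proof (cases "g \<in> carrier_mat n n \<and> upper_triangular g")
  case True
  hence g: "g \<in> carrier_mat n n" "upper_triangular g" by auto
  have "invertible_mat g \<longleftrightarrow> (\<forall>i<n. g $$ (i, i) \<noteq> 0)"
  proof
    assume "invertible_mat g"
    then obtain B where B: "g * B = 1\<^sub>m (dim_row g)" "B * g = 1\<^sub>m (dim_row B)"
      by (auto simp: invertible_mat_def inverts_mat_def)
    have "dim_col (g * B) = n" unfolding B(1) using g by simp
    moreover have "dim_col (B * g) = dim_row B" unfolding B(2) by simp
    ultimately have Bc: "B \<in> carrier_mat n n" using g(1) by (intro carrier_matI) simp_all
    have "det g * det B = 1"
      unfolding det_mult[OF g(1) Bc, symmetric] B(1) by simp
    thus "\<forall>i<n. g $$ (i, i) \<noteq> 0"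
      using det_upper_triangular_nonzero[OF g] by (metis mult_zero_left zero_neq_one)
  next
    assume "\<forall>i<n. g $$ (i, i) \<noteq> 0"
    then obtain B where "B \<in> carrier_mat n n" "g * B = 1\<^sub>m n" "B * g = 1\<^sub>m n"
      using upper_triangular_inverse[OF g] by blast
    thus "invertible_mat g" using g by (auto simp: invertible_mat_def inverts_mat_def)
  qed
  thus ?thesis using g by (simp add: tri_group_def)
qed (auto simp: tri_group_def)

section \<open>Superclasses\<close>

text \<open>Clearing denominators, \<open>h - 1 = t a (g - 1) b\<inverse> t\<inverse>\<close> becomes \<open>(h - 1) B = A (g - 1)\<close> with \<open>A = t a\<close> and
  \<open>B = t b\<close>, two invertible upper triangular matrices with the same diagonal.\<close>

definition tri_equiv :: "nat \<Rightarrow> 'q::field mat \<Rightarrow> 'q mat \<Rightarrow> bool" where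
  "tri_equiv n M M' \<longleftrightarrow> (\<exists>A B. A \<in> carrier_mat n n \<and> B \<in> carrier_mat n n \<and>
     upper_triangular A \<and> upper_triangular B \<and>
     (\<forall>i<n. A $$ (i, i) = B $$ (i, i) \<and> A $$ (i, i) \<noteq> 0) \<and> M' * B = A * M)"

lemma tri_equivI:
  assumes "A \<in> carrier_mat n n" "B \<in> carrier_mat n n" "upper_triangular A" "upper_triangular B"
    "\<And>i. i < n \<Longrightarrow> A $$ (i, i) = B $$ (i, i)" "\<And>i. i < n \<Longrightarrow> A $$ (i, i) \<noteq> 0" "M' * B = A * M"
  shows "tri_equiv n M M'"
  using assms unfolding tri_equiv_def by blast

lemma upper_triangular_one: "upper_triangular (1\<^sub>m n :: 'q::field mat)"
  by (rule upper_triangular_carrierI[of _ n]) auto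

lemma tri_equiv_refl: "M \<in> carrier_mat n n \<Longrightarrow> tri_equiv n M M"
  by (rule tri_equivI[of "1\<^sub>m n" _ "1\<^sub>m n"]) (auto simp: upper_triangular_one)

lemma tri_equiv_trans:
  fixes M :: "'q::field mat"
  assumes M: "M \<in> carrier_mat n n" "M' \<in> carrier_mat n n" "M'' \<in> carrier_mat n n"
    and 1: "tri_equiv n M M'" and 2: "tri_equiv n M' M''"
  shows "tri_equiv n M M''"
proof -
  obtain A B where AB': "A \<in> carrier_mat n n" "B \<in> carrier_mat n n" "upper_triangular A" "upper_triangular B"
    "\<forall>i<n. A $$ (i, i) = B $$ (i, i)" "\<forall>i<n. A $$ (i, i) \<noteq> 0" "M' * B = A * M"
    using 1 unfolding tri_equiv_def by blast
  note AB = AB'[rule_format]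
  obtain C D where CD': "C \<in> carrier_mat n n" "D \<in> carrier_mat n n" "upper_triangular C" "upper_triangular D"
    "\<forall>i<n. C $$ (i, i) = D $$ (i, i)" "\<forall>i<n. C $$ (i, i) \<noteq> 0" "M'' * D = C * M'"
    using 2 unfolding tri_equiv_def by blast
  note CD = CD'[rule_format]
  have "M'' * (D * B) = (M'' * D) * B" by (rule square_assoc[OF M(3) CD(2) AB(2), symmetric])
  also have "\<dots> = C * (M' * B)" unfolding CD(7) by (rule square_assoc[OF CD(1) M(2) AB(2)])
  also have "\<dots> = (C * A) * M" unfolding AB(7) by (rule square_assoc[OF CD(1) AB(1) M(1), symmetric])
  finally have eq: "M'' * (D * B) = (C * A) * M" .
  show ?thesis
  proof (rule tri_equivI[OF _ _ _ _ _ _ eq])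
    show "upper_triangular (C * A)" by (rule upper_triangular_mult(1)[OF CD(1,3) AB(1,3)])
    show "upper_triangular (D * B)" by (rule upper_triangular_mult(1)[OF CD(2,4) AB(2,4)])
    fix i assume i: "i < n"
    show "(C * A) $$ (i, i) = (D * B) $$ (i, i)" "(C * A) $$ (i, i) \<noteq> 0"
      unfolding upper_triangular_mult(2)[OF CD(1,3) AB(1,3) i] upper_triangular_mult(2)[OF CD(2,4) AB(2,4) i]
      using AB(5,6)[OF i] CD(5,6)[OF i] by auto
  qed (use AB CD in simp_all)
qed

lemma tri_equiv_sym:
  fixes M :: "'q::field mat"
  assumes M: "M \<in> carrier_mat n n" "M' \<in> carrier_mat n n" and e: "tri_equiv n M M'"
  shows "tri_equiv n M' M"
proof -
  obtain A B where AB': "A \<in> carrier_mat n n" "B \<in> carrier_mat n n" "upper_triangular A" "upper_triangular B"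
    "\<forall>i<n. A $$ (i, i) = B $$ (i, i)" "\<forall>i<n. A $$ (i, i) \<noteq> 0" "M' * B = A * M"
    using e unfolding tri_equiv_def by blast
  note AB = AB'[rule_format]
  have dB: "B $$ (i, i) \<noteq> 0" if "i < n" for i using AB(5,6)[OF that] by simp
  obtain C where C': "C \<in> carrier_mat n n" "A * C = 1\<^sub>m n" "C * A = 1\<^sub>m n"
    "upper_triangular C" "\<forall>i<n. C $$ (i, i) = 1 / A $$ (i, i)"
    using upper_triangular_inverse[OF AB(1,3,6)] by blast
  note C = C'[rule_format]
  obtain D where D': "D \<in> carrier_mat n n" "B * D = 1\<^sub>m n" "D * B = 1\<^sub>m n"
    "upper_triangular D" "\<forall>i<n. D $$ (i, i) = 1 / B $$ (i, i)"
    using upper_triangular_inverse[OF AB(2,4) dB] by blast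
  note D = D'[rule_format]
  have "M * D = (C * A) * M * D" unfolding C(3) using M by simp
  also have "\<dots> = C * (A * M) * D" using M AB(1) C(1) by (simp add: square_assoc[of C n])
  also have "\<dots> = C * (M' * (B * D))" unfolding AB(7)[symmetric] using M AB(2) C(1) D(1)
    by (simp add: square_assoc[of _ n] square_mult_closed[of _ n] del: assoc_mult_mat)
  also have "\<dots> = C * M'" unfolding D(2) using M by simp
  finally have eq: "M * D = C * M'" .
  show ?thesis
    by (rule tri_equivI[OF C(1) D(1) C(4) D(4) _ _ eq]) (use C(5) D(5) AB(5,6) in auto)
qed

lemma tri_equiv_diag:
  fixes M :: "'q::field mat"
  assumes M: "M \<in> carrier_mat n n" "upper_triangular M" and M': "M' \<in> carrier_mat n n" "upper_triangular M'"
    and e: "tri_equiv n M M'" and i: "i < n"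
  shows "M' $$ (i, i) = M $$ (i, i)"
proof -
  obtain A B where AB': "A \<in> carrier_mat n n" "B \<in> carrier_mat n n" "upper_triangular A" "upper_triangular B"
    "\<forall>i<n. A $$ (i, i) = B $$ (i, i)" "\<forall>i<n. A $$ (i, i) \<noteq> 0" "M' * B = A * M"
    using e unfolding tri_equiv_def by blast
  note AB = AB'[rule_format]
  have "M' $$ (i, i) * B $$ (i, i) = A $$ (i, i) * M $$ (i, i)"
    using upper_triangular_mult(2)[OF M' AB(2,4) i] upper_triangular_mult(2)[OF AB(1,3) M i] AB(7) by simp
  thus ?thesis using AB(5,6)[OF i] by simp
qed

lemma tri_equiv_upper_triangular:
  fixes M :: "'q::field mat"
  assumes M: "M \<in> carrier_mat n n" "upper_triangular M" and M': "M' \<in> carrier_mat n n"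
    and e: "tri_equiv n M M'"
  shows "upper_triangular M'"
proof -
  obtain A B where AB': "A \<in> carrier_mat n n" "B \<in> carrier_mat n n" "upper_triangular A" "upper_triangular B"
    "\<forall>i<n. A $$ (i, i) = B $$ (i, i)" "\<forall>i<n. A $$ (i, i) \<noteq> 0" "M' * B = A * M"
    using e unfolding tri_equiv_def by blast
  note AB = AB'[rule_format]
  have dB: "B $$ (i, i) \<noteq> 0" if "i < n" for i using AB(5,6)[OF that] by simp
  obtain D where D': "D \<in> carrier_mat n n" "B * D = 1\<^sub>m n" "upper_triangular D"
    using upper_triangular_inverse[OF AB(2,4) dB] by blast
  note D = D'[rule_format]
  have "M' = M' * (B * D)" unfolding D(2) using M' by simp
  also have "\<dots> = (M' * B) * D" using M' AB(2) D(1) by (simp add: square_assoc[of M' n])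
  also have "\<dots> = (A * M) * D" by (simp add: AB(7))
  finally have "M' = (A * M) * D" .
  moreover have "upper_triangular ((A * M) * D)"
    by (intro upper_triangular_mult(1)[of _ n] square_mult_closed AB(1,3) M D(1,3))
  ultimately show ?thesis by simp
qed

lemma superclass_iff:
  fixes g :: "'q::field mat"
  assumes g: "g \<in> carrier_mat n n"
  shows "h \<in> superclass n g \<longleftrightarrow> h \<in> carrier_mat n n \<and> tri_equiv n (g - 1\<^sub>m n) (h - 1\<^sub>m n)"
proof
  assume "h \<in> superclass n g"
  then obtain t a b where h: "h = 1\<^sub>m n + t * a * (g - 1\<^sub>m n) * the (mat_inverse b) * the (mat_inverse t)"
    and t: "t \<in> diag_group n" and a: "a \<in> unitri_group n" and b: "b \<in> unitri_group n"
    unfolding superclass_def by blast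
  have t': "t \<in> carrier_mat n n" "upper_triangular t" "\<And>i. i < n \<Longrightarrow> t $$ (i, i) \<noteq> 0"
    using t by (auto simp: diag_group_def tri_group_iff)
  have a': "a \<in> carrier_mat n n" "upper_triangular a" "\<And>i. i < n \<Longrightarrow> a $$ (i, i) = 1"
    and b': "b \<in> carrier_mat n n" "upper_triangular b" "\<And>i. i < n \<Longrightarrow> b $$ (i, i) = 1"
    using a b by (auto simp: unitri_group_def)
  have b1: "b $$ (i, i) \<noteq> 0" if "i < n" for i using b'(3)[OF that] by simp
  obtain ti where ti: "mat_inverse t = Some ti" "ti \<in> carrier_mat n n" "ti * t = 1\<^sub>m n"
    using upper_triangular_inverse[OF t'] by blast
  obtain bi where bi: "mat_inverse b = Some bi" "bi \<in> carrier_mat n n" "bi * b = 1\<^sub>m n"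
    using upper_triangular_inverse[OF b'(1,2) b1] by blast
  let ?M = "g - 1\<^sub>m n"
  have M: "?M \<in> carrier_mat n n" by (simp add: minus_carrier_mat)
  have prod: "t * a * ?M * bi * ti \<in> carrier_mat n n"
    by (intro square_mult_closed t'(1) a'(1) M bi(2) ti(2))
  have hc: "h \<in> carrier_mat n n" unfolding h ti(1) bi(1) option.sel using prod by (intro add_carrier_mat)
  have "h - 1\<^sub>m n = t * a * ?M * bi * ti"
    unfolding h ti(1) bi(1) option.sel using prod
    by (intro eq_matI) (auto simp del: assoc_mult_mat index_mult_mat)
  hence "(h - 1\<^sub>m n) * (t * b) = t * a * ?M * bi * ti * (t * b)" by simp
  also have "\<dots> = t * a * ?M * bi * (ti * t) * b"
    using t'(1) a'(1) b'(1) M bi(2) ti(2)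
    by (simp add: square_assoc[of _ n] square_mult_closed[of _ n] del: assoc_mult_mat)
  also have "\<dots> = t * a * ?M * bi * b"
    unfolding ti(3)
    by (simp only: right_mult_one_mat[OF square_mult_closed[OF square_mult_closed[OF square_mult_closed[OF t'(1) a'(1)] M] bi(2)]])
  also have "\<dots> = t * a * ?M * (bi * b)"
    by (rule square_assoc[OF square_mult_closed[OF square_mult_closed[OF t'(1) a'(1)] M] bi(2) b'(1)])
  also have "\<dots> = (t * a) * ?M"
    unfolding bi(3) by (rule right_mult_one_mat[OF square_mult_closed[OF square_mult_closed[OF t'(1) a'(1)] M]])
  finally have eq: "(h - 1\<^sub>m n) * (t * b) = (t * a) * ?M" .
  have "tri_equiv n ?M (h - 1\<^sub>m n)"
  proof (rule tri_equivI[OF _ _ _ _ _ _ eq])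
    show "upper_triangular (t * a)" "upper_triangular (t * b)"
      by (rule upper_triangular_mult(1)[OF t'(1,2) a'(1,2)], rule upper_triangular_mult(1)[OF t'(1,2) b'(1,2)])
    fix i assume i: "i < n"
    show "(t * a) $$ (i, i) = (t * b) $$ (i, i)" "(t * a) $$ (i, i) \<noteq> 0"
      unfolding upper_triangular_mult(2)[OF t'(1,2) a'(1,2) i] upper_triangular_mult(2)[OF t'(1,2) b'(1,2) i]
      using t'(3)[OF i] a'(3)[OF i] b'(3)[OF i] by auto
  qed (use t' a' b' in simp_all)
  with hc show "h \<in> carrier_mat n n \<and> tri_equiv n ?M (h - 1\<^sub>m n)" by blast
next
  let ?M = "g - 1\<^sub>m n"
  have M: "?M \<in> carrier_mat n n" by (simp add: minus_carrier_mat)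
  assume asm: "h \<in> carrier_mat n n \<and> tri_equiv n ?M (h - 1\<^sub>m n)"
  hence h: "h \<in> carrier_mat n n" by blast
  have hM: "h - 1\<^sub>m n \<in> carrier_mat n n" by (simp add: minus_carrier_mat)
  obtain A B where AB': "A \<in> carrier_mat n n" "B \<in> carrier_mat n n" "upper_triangular A" "upper_triangular B"
    "\<forall>i<n. A $$ (i, i) = B $$ (i, i)" "\<forall>i<n. A $$ (i, i) \<noteq> 0"
    "(h - 1\<^sub>m n) * B = A * ?M"
    using asm unfolding tri_equiv_def by blast
  note AB = AB'[rule_format]
  define t where "t = mat n n (\<lambda>(i, j). if i = j then A $$ (i, i) else 0)"
  define a where "a = mat n n (\<lambda>(i, j). A $$ (i, j) / A $$ (i, i))"
  define b where "b = mat n n (\<lambda>(i, j). B $$ (i, j) / B $$ (i, i))"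
  have dB: "B $$ (i, i) \<noteq> 0" if "i < n" for i using AB(5,6)[OF that] by simp
  have c: "t \<in> carrier_mat n n" "a \<in> carrier_mat n n" "b \<in> carrier_mat n n"
    by (simp_all add: t_def a_def b_def)
  have t: "t \<in> diag_group n"
    unfolding diag_group_def tri_group_iff mem_Collect_eq
    using AB(6) by (auto simp: t_def diagonal_mat_def intro!: upper_triangularI)
  have ab: "a \<in> unitri_group n" "b \<in> unitri_group n"
    using AB(1-4,6) dB by (auto simp: unitri_group_def a_def b_def upper_triangular_zero intro!: upper_triangularI)
  have t': "upper_triangular t" "\<And>i. i < n \<Longrightarrow> t $$ (i, i) \<noteq> 0"
    using AB(6) by (auto simp: t_def intro!: upper_triangularI)
  have b': "upper_triangular b" "\<And>i. i < n \<Longrightarrow> b $$ (i, i) \<noteq> 0"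
    using ab(2) by (auto simp: unitri_group_def)
  have tmult: "t * mat n n (\<lambda>(i, j). C $$ (i, j) / C $$ (i, i)) = C"
    if C: "C \<in> carrier_mat n n" "\<And>i. i < n \<Longrightarrow> A $$ (i, i) = C $$ (i, i)" for C
  proof (rule eq_matI)
    fix i j assume "i < dim_row C" "j < dim_col C"
    hence ij: "i < n" "j < n" using C by auto
    have "(t * mat n n (\<lambda>(i, j). C $$ (i, j) / C $$ (i, i))) $$ (i, j) =
        (\<Sum>l<n. if l = i then C $$ (i, j) else 0)"
      unfolding mult_mat_sum[OF c(1) mat_carrier ij]
      by (rule sum.cong[OF refl]) (use ij C(2)[OF ij(1)] AB(6)[OF ij(1)] in \<open>auto simp: t_def\<close>)
    thus "(t * mat n n (\<lambda>(i, j). C $$ (i, j) / C $$ (i, i))) $$ (i, j) = C $$ (i, j)"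
      using ij by simp
  qed (use c C in auto)
  have ta: "t * a = A" unfolding a_def by (rule tmult[OF AB(1) refl])
  have tb: "t * b = B" unfolding b_def by (rule tmult[OF AB(2,5)])
  obtain ti where ti: "mat_inverse t = Some ti" "ti \<in> carrier_mat n n" "t * ti = 1\<^sub>m n"
    using upper_triangular_inverse[OF c(1) t'] by blast
  obtain bi where bi: "mat_inverse b = Some bi" "bi \<in> carrier_mat n n" "b * bi = 1\<^sub>m n"
    using upper_triangular_inverse[OF c(3) b'] by blast
  have "t * a * ?M * bi * ti = (h - 1\<^sub>m n) * (t * b) * bi * ti"
    unfolding ta tb AB(7) ..
  also have "\<dots> = (h - 1\<^sub>m n) * (t * (b * bi) * ti)"
    using c hM bi(2) ti(2) by (simp add: square_assoc[of _ n] square_mult_closed[of _ n] del: assoc_mult_mat)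
  also have "t * (b * bi) * ti = 1\<^sub>m n"
    unfolding bi(3) using c(1) ti(3) by simp
  also have "(h - 1\<^sub>m n) * 1\<^sub>m n = h - 1\<^sub>m n"
    using hM by simp
  finally have eq: "t * a * ?M * bi * ti = h - 1\<^sub>m n" .
  have "h = 1\<^sub>m n + t * a * ?M * the (mat_inverse b) * the (mat_inverse t)"
    unfolding bi(1) ti(1) option.sel eq using h by (intro eq_matI) auto
  thus "h \<in> superclass n g"
    unfolding superclass_def using t ab by blast
qed

section \<open>The matrix of a word\<close>

text \<open>The matrix of a word is the representative \<open>h\<^sub>\<P> + x\<^sub>D\<close> of the superclass attached to the type \<open>\<P>\<close> of the
  word (lemma \<open>word_mat_eq_rigged\<close>); the difference \<open>word_rook\<close> of it and the identity has at most one
  nonzero entry in each row and column.\<close>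

definition word_arc :: "nc_var list \<Rightarrow> nat \<Rightarrow> nat \<Rightarrow> bool" where
  "word_arc w i j \<longleftrightarrow> i < j \<and> j < length w \<and> w ! i = w ! j \<and> w ! i \<in> range Xvar \<and>
     (\<forall>k. i < k \<and> k < j \<longrightarrow> w ! k \<noteq> w ! i)"

definition word_entry :: "(nat \<Rightarrow> 'q::field) \<Rightarrow> nc_var list \<Rightarrow> nat \<Rightarrow> nat \<Rightarrow> 'q" where
  "word_entry u w i j =
     (if i = j then (case w ! i of Xvar _ \<Rightarrow> 0 | Yvar c \<Rightarrow> u c - 1)
      else if word_arc w i j then 1 else 0)"

definition word_rook :: "(nat \<Rightarrow> 'q::field) \<Rightarrow> nc_var list \<Rightarrow> 'q mat" where
  "word_rook u w = mat (length w) (length w) (\<lambda>(i, j). word_entry u w i j)"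

definition word_mat :: "(nat \<Rightarrow> 'q::field) \<Rightarrow> nc_var list \<Rightarrow> 'q mat" where
  "word_mat u w = 1\<^sub>m (length w) + word_rook u w"

lemma word_rook_carrier: "word_rook u w \<in> carrier_mat (length w) (length w)"
  and word_mat_carrier: "word_mat u w \<in> carrier_mat (length w) (length w)"
  by (simp_all add: word_rook_def word_mat_def)

lemma word_rook_index: "i < length w \<Longrightarrow> j < length w \<Longrightarrow> word_rook u w $$ (i, j) = word_entry u w i j"
  by (simp add: word_rook_def)

lemma word_mat_minus_one: "word_mat u w - 1\<^sub>m (length w) = word_rook u w"
  using word_rook_carrier[of u w] by (intro eq_matI) (auto simp: word_mat_def)

lemma word_arc_less: "word_arc w i j \<Longrightarrow> i < j"
  by (simp add: word_arc_def)

lemma upper_triangular_word_rook: "upper_triangular (word_rook u w)"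
  by (rule upper_triangularI) (auto simp: word_rook_def word_entry_def dest: word_arc_less)

lemma word_mat_tri_group:
  assumes u: "bij_betw u {..<r} (UNIV - {0, 1 :: 'q::field})" and w: "w \<in> var_words r"
  shows "word_mat u w \<in> tri_group (length w)"
proof -
  have "upper_triangular (word_mat u w)"
    by (rule upper_triangularI)
       (auto simp: word_mat_def word_rook_def word_entry_def dest: word_arc_less)
  moreover have "word_mat u w $$ (i, i) \<noteq> 0" if i: "i < length w" for i
  proof -
    have "w ! i \<in> range Xvar \<union> Yvar ` {..<r}" using var_words_nth[OF w i] .
    moreover have "u c \<noteq> 0" if "c < r" for c using u that by (auto simp: bij_betw_def)
    ultimately show ?thesis
      using i by (auto simp: word_mat_def word_rook_def word_entry_def)
  qed
  ultimately show ?thesis unfolding tri_group_iff using word_mat_carrier by blast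
qed

lemma word_entry_row:
  assumes "word_entry u w i j \<noteq> 0" "word_entry u w i j' \<noteq> 0"
  shows "j = j'"
proof (cases "w ! i")
  case (Xvar a)
  hence arcs: "word_arc w i j" "word_arc w i j'"
    using assms by (auto simp: word_entry_def split: if_splits)
  thus ?thesis unfolding word_arc_def by (metis linorder_neqE_nat)
next
  case (Yvar c)
  have "\<not> word_arc w i l" for l using Yvar by (auto simp: word_arc_def)
  thus ?thesis using assms by (auto simp: word_entry_def split: if_splits)
qed

lemma word_entry_col:
  assumes "word_entry u w i j \<noteq> 0" "word_entry u w i' j \<noteq> 0"
  shows "i = i'"
proof (cases "w ! j")
  case (Xvar a)
  hence arcs: "word_arc w i j" "word_arc w i' j"
    using assms by (auto simp: word_entry_def split: if_splits)
  thus ?thesis unfolding word_arc_def by (metis linorder_neqE_nat)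
next
  case (Yvar c)
  have "\<not> word_arc w l j" for l using Yvar by (auto simp: word_arc_def)
  thus ?thesis using assms by (auto simp: word_entry_def split: if_splits)
qed

text \<open>The condition is restricted to the rows from \<open>k\<close> on because elimination proceeds from the last row
  upwards.\<close>

definition rook_from :: "nat \<Rightarrow> nat \<Rightarrow> 'q::field mat \<Rightarrow> bool" where
  "rook_from n k M \<longleftrightarrow>
     (\<forall>i j j'. k \<le> i \<and> i < n \<and> j < n \<and> j' < n \<and> M $$ (i, j) \<noteq> 0 \<and> M $$ (i, j') \<noteq> 0 \<longrightarrow> j = j') \<and>
     (\<forall>i i' j. k \<le> i \<and> i < n \<and> k \<le> i' \<and> i' < n \<and> j < n \<and> M $$ (i, j) \<noteq> 0 \<and> M $$ (i', j) \<noteq> 0 \<longrightarrow> i = i')"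

lemma rook_fromD:
  assumes "rook_from n k M"
  shows "\<lbrakk>k \<le> i; i < n; j < n; j' < n; M $$ (i, j) \<noteq> 0; M $$ (i, j') \<noteq> 0\<rbrakk> \<Longrightarrow> j = j'"
    and "\<lbrakk>k \<le> i; i < n; k \<le> i'; i' < n; j < n; M $$ (i, j) \<noteq> 0; M $$ (i', j) \<noteq> 0\<rbrakk> \<Longrightarrow> i = i'"
  using assms unfolding rook_from_def by blast+

lemma rook_word_rook: "rook_from (length w) 0 (word_rook u w)"
  unfolding rook_from_def
  by (auto simp: word_rook_index intro: word_entry_row word_entry_col)

section \<open>Different types give different superclasses\<close>

text \<open>Comparing the entries of \<open>M' B = A M\<close> at a nonzero position of \<open>M\<close>, respectively of \<open>M'\<close>, moves it
  to a nonzero position of the other matrix that is weakly to the left, respectively weakly below. So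
  the rows can be compared from the last one upwards.\<close>

lemma tri_equiv_rook_support:
  fixes M :: "'q::field mat"
  assumes M: "M \<in> carrier_mat n n" "rook_from n 0 M" and M': "M' \<in> carrier_mat n n" "rook_from n 0 M'"
    and e: "tri_equiv n M M'"
  shows "i < n \<Longrightarrow> j < n \<Longrightarrow> M $$ (i, j) \<noteq> 0 \<longleftrightarrow> M' $$ (i, j) \<noteq> 0"
proof -
  obtain A B where AB': "A \<in> carrier_mat n n" "B \<in> carrier_mat n n" "upper_triangular A" "upper_triangular B"
    "\<forall>i<n. A $$ (i, i) = B $$ (i, i)" "\<forall>i<n. A $$ (i, i) \<noteq> 0" "M' * B = A * M"
    using e unfolding tri_equiv_def by blast
  note AB = AB'[rule_format]
  have left: "\<exists>l. l < n \<and> l \<le> j \<and> M' $$ (i, l) \<noteq> 0" if ij: "i < n" "j < n" "M $$ (i, j) \<noteq> 0" for i j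
  proof -
    have "(\<Sum>l<n. A $$ (i, l) * M $$ (l, j)) = (\<Sum>l<n. if l = i then A $$ (i, i) * M $$ (i, j) else 0)"
    proof (rule sum.cong[OF refl])
      fix l assume "l \<in> {..<n}"
      hence "M $$ (l, j) = 0" if "l \<noteq> i"
        using rook_fromD(2)[OF M(2) _ ij(1) _ _ ij(2,3), of l] that by auto
      thus "A $$ (i, l) * M $$ (l, j) = (if l = i then A $$ (i, i) * M $$ (i, j) else 0)" by simp
    qed
    hence "(M' * B) $$ (i, j) \<noteq> 0"
      unfolding AB(7) mult_mat_sum[OF AB(1) M(1) ij(1,2)] using AB(6)[OF ij(1)] ij by simp
    then obtain l where l: "l < n" "M' $$ (i, l) * B $$ (l, j) \<noteq> 0"
      unfolding mult_mat_sum[OF M'(1) AB(2) ij(1,2)]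
      by (rule sum.not_neutral_contains_not_neutral) simp
    have "\<not> j < l" using upper_triangular_zero[OF AB(4,2) _ l(1), of j] l(2) by auto
    with l show ?thesis by (intro exI[of _ l]) simp
  qed
  have down: "\<exists>l. l < n \<and> i \<le> l \<and> M $$ (l, j) \<noteq> 0" if ij: "i < n" "j < n" "M' $$ (i, j) \<noteq> 0" for i j
  proof -
    have "(\<Sum>l<n. M' $$ (i, l) * B $$ (l, j)) = (\<Sum>l<n. if l = j then M' $$ (i, j) * B $$ (j, j) else 0)"
    proof (rule sum.cong[OF refl])
      fix l assume "l \<in> {..<n}"
      hence "M' $$ (i, l) = 0" if "l \<noteq> j"
        using rook_fromD(1)[OF M'(2) _ ij(1) _ ij(2) _ ij(3), of l] that by auto
      thus "M' $$ (i, l) * B $$ (l, j) = (if l = j then M' $$ (i, j) * B $$ (j, j) else 0)" by simp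
    qed
    hence "(A * M) $$ (i, j) \<noteq> 0"
      unfolding AB(7)[symmetric] mult_mat_sum[OF M'(1) AB(2) ij(1,2)] using AB(5,6)[OF ij(2)] ij by simp
    then obtain l where l: "l < n" "A $$ (i, l) * M $$ (l, j) \<noteq> 0"
      unfolding mult_mat_sum[OF AB(1) M(1) ij(1,2)]
      by (rule sum.not_neutral_contains_not_neutral) simp
    have "\<not> l < i" using upper_triangular_zero[OF AB(3,1) _ ij(1), of l] l(2) by auto
    with l show ?thesis by (intro exI[of _ l]) simp
  qed
  have "\<forall>j<n. M $$ (i, j) \<noteq> 0 \<longleftrightarrow> M' $$ (i, j) \<noteq> 0" if "i < n" for i
    using that
  proof (induction "n - i" arbitrary: i rule: less_induct)
    case less
    have IH: "M $$ (l, j) \<noteq> 0 \<longleftrightarrow> M' $$ (l, j) \<noteq> 0" if "i < l" "l < n" "j < n" for l j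
      using less.hyps[of l] that less.prems by simp
    have same: "M $$ (i, j) \<noteq> 0" if j: "j < n" "M' $$ (i, j) \<noteq> 0" for j
    proof -
      obtain l where l: "l < n" "i \<le> l" "M $$ (l, j) \<noteq> 0" using down[OF less.prems j] by blast
      have "l = i"
      proof (rule ccontr)
        assume "l \<noteq> i"
        with l IH j have "M' $$ (l, j) \<noteq> 0" by simp
        from rook_fromD(2)[OF M'(2) _ l(1) _ less.prems j(1) this j(2)] \<open>l \<noteq> i\<close> show False by simp
      qed
      with l show ?thesis by simp
    qed
    show ?case
    proof (intro allI impI iffI)
      fix j assume j: "j < n" and nz: "M $$ (i, j) \<noteq> 0"
      obtain l where l: "l < n" "M' $$ (i, l) \<noteq> 0" using left[OF less.prems j nz] by blast
      have "l = j" by (rule rook_fromD(1)[OF M(2) _ less.prems l(1) j same[OF l] nz]) simp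
      with l show "M' $$ (i, j) \<noteq> 0" by simp
    qed (use same in blast)
  qed
  thus "i < n \<Longrightarrow> j < n \<Longrightarrow> M $$ (i, j) \<noteq> 0 \<longleftrightarrow> M' $$ (i, j) \<noteq> 0" by blast
qed

lemma word_arc_chain:
  assumes "i < j" "j < length w" "w ! i = w ! j" "w ! i \<in> range Xvar"
  obtains k where "i \<le> k" "word_arc w k j" "w ! k = w ! i"
proof -
  define K where "K = {k. i \<le> k \<and> k < j \<and> w ! k = w ! i}"
  \<comment> \<open>The last occurrence of the letter before position \<open>j\<close>.\<close>
  define m where "m = Max K"
  have fin: "finite K" by (rule finite_subset[of _ "{..<j}"]) (auto simp: K_def)
  have "i \<in> K" using assms by (simp add: K_def)
  hence "m \<in> K" unfolding m_def using fin by (intro Max_in) auto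
  hence m: "i \<le> m" "m < j" "w ! m = w ! i" by (simp_all add: K_def)
  have "w ! k \<noteq> w ! m" if k: "m < k" "k < j" for k
  proof
    assume "w ! k = w ! m"
    with k m have "k \<in> K" by (simp add: K_def)
    with fin have "k \<le> m" unfolding m_def by (rule Max_ge)
    with k show False by simp
  qed
  moreover have "w ! m = w ! j" "w ! m \<in> range Xvar" unfolding m(3) by (fact assms(3), fact assms(4))
  ultimately have "word_arc w m j" unfolding word_arc_def using m(2) assms(2) by blast
  thus thesis using m(1,3) by (intro that)
qed

text \<open>Any two occurrences of an \<open>X\<close>-letter are connected by a chain of arcs.\<close>

lemma word_arcs_determine_letters:
  assumes len: "length w = length w'" and arcs: "\<And>i j. word_arc w i j \<Longrightarrow> word_arc w' i j"
  shows "i < j \<Longrightarrow> j < length w \<Longrightarrow> w ! i = w ! j \<Longrightarrow> w ! i \<in> range Xvar \<Longrightarrow> w' ! i = w' ! j"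
proof (induction j arbitrary: i rule: less_induct)
  case (less j)
  obtain k where k: "i \<le> k" "word_arc w k j" "w ! k = w ! i"
    using word_arc_chain[OF less.prems] .
  have "w' ! k = w' ! j" using arcs[OF k(2)] by (simp add: word_arc_def)
  moreover have "w' ! i = w' ! k"
  proof (cases "i = k")
    case False
    thus ?thesis using less.IH[of k i] k less.prems word_arc_less[OF k(2)] by simp
  qed simp
  ultimately show ?case by simp
qed

lemma word_type_eqI:
  assumes len: "length w = length w'"
    and arcs: "\<And>i j. word_arc w i j \<longleftrightarrow> word_arc w' i j"
    and Y: "\<And>i c. i < length w \<Longrightarrow> w ! i = Yvar c \<longleftrightarrow> w' ! i = Yvar c"
  shows "word_type w = word_type w'"
proof -
  have sub: "fst (word_type a) \<subseteq> fst (word_type b)"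
    if l: "length a = length b" and arcs: "\<And>i j. word_arc a i j \<longleftrightarrow> word_arc b i j"
      and Y: "\<And>i c. i < length a \<Longrightarrow> a ! i = Yvar c \<longleftrightarrow> b ! i = Yvar c" for a b
  proof
    fix B assume "B \<in> fst (word_type a)"
    then obtain x where B: "B = {k\<in>{..<length a}. a ! k = Xvar x}" "B \<noteq> {}"
      unfolding fst_letter_type by blast
    then obtain i where i: "i < length a" "a ! i = Xvar x" by blast
    then obtain y where y: "b ! i = Xvar y" using Y[of i] by (cases "b ! i") auto
    have "a ! k = Xvar x \<longleftrightarrow> b ! k = Xvar y" if k: "k < length a" for k
    proof (cases k i rule: linorder_cases)
      case less
      thus ?thesis
        using word_arcs_determine_letters[OF l, of k i] word_arcs_determine_letters[OF l[symmetric], of k i]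
          arcs i y k l by auto
    next
      case greater
      thus ?thesis
        using word_arcs_determine_letters[OF l, of i k] word_arcs_determine_letters[OF l[symmetric], of i k]
          arcs i y k l by auto
    qed (use i y in simp)
    hence "B = {k\<in>{..<length b}. b ! k = Xvar y}" using B(1) l by auto
    with B(2) show "B \<in> fst (word_type b)" unfolding fst_letter_type by blast
  qed
  show ?thesis
  proof (rule prod_eqI)
    show "fst (word_type w) = fst (word_type w')"
      using sub[OF len arcs Y] sub[of w' w] len arcs Y by (intro equalityI) auto
    show "snd (word_type w) = snd (word_type w')"
    proof (rule map_le_antisym; rule map_le_SomeI)
      fix i c assume "snd (word_type w) i = Some c"
      thus "snd (word_type w') i = Some c" using Y[of i c] len by (auto simp: snd_letter_type)
    next
      fix i c assume "snd (word_type w') i = Some c"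
      thus "snd (word_type w) i = Some c" using Y[of i c] len by (auto simp: snd_letter_type)
    qed
  qed
qed

text \<open>The supports of the two matrices agree, which determines the arcs. Their diagonals are equal, which
  determines the \<open>Y\<close>-letters since \<open>u\<close> is injective and omits the value \<open>1\<close>.\<close>

lemma tri_equiv_word_rook_imp_type:
  fixes u :: "nat \<Rightarrow> 'q::field"
  assumes u: "bij_betw u {..<r} (UNIV - {0, 1})"
    and w: "w \<in> var_words r" and w': "w' \<in> var_words r" and len: "length w = length w'"
    and e: "tri_equiv (length w) (word_rook u w) (word_rook u w')"
  shows "word_type w = word_type w'"
proof (rule word_type_eqI[OF len])
  let ?n = "length w"
  have c: "word_rook u w \<in> carrier_mat ?n ?n" "word_rook u w' \<in> carrier_mat ?n ?n"
    using word_rook_carrier[of u w] word_rook_carrier[of u w'] len by simp_all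
  have supp: "word_entry u w i j \<noteq> 0 \<longleftrightarrow> word_entry u w' i j \<noteq> 0" if "i < ?n" "j < ?n" for i j
    using tri_equiv_rook_support[OF c(1) rook_word_rook c(2) _ e that] rook_word_rook[of w' u] that len
    by (simp add: word_rook_index)
  have diag: "word_entry u w i i = word_entry u w' i i" if "i < ?n" for i
    using tri_equiv_diag[OF c(1) upper_triangular_word_rook c(2) upper_triangular_word_rook e that] that len
    by (simp add: word_rook_index)
  show "word_arc w i j \<longleftrightarrow> word_arc w' i j" for i j
  proof (cases "i < j \<and> j < ?n")
    case True
    thus ?thesis using supp[of i j] by (auto simp: word_entry_def split: if_splits)
  next
    case False
    thus ?thesis using len by (auto simp: word_arc_def)
  qed
  have Y: "a' ! i = Yvar d" if i: "i < length a'" and d: "b' ! i = Yvar d"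
    and a': "a' \<in> var_words r" and b': "b' \<in> var_words r" and len: "length a' = length b'"
    and diag: "word_entry u a' i i = word_entry u b' i i" for a' b' :: "nc_var list" and i d
  proof -
    have "b' ! i \<in> range Xvar \<union> Yvar ` {..<r}" using var_words_nth[OF b', of i] i len by simp
    hence "d < r" using d by auto
    have ne: "u c \<noteq> 1" if "c < r" for c using u that by (auto simp: bij_betw_def)
    show ?thesis
    proof (cases "a' ! i")
      case (Xvar a)
      thus ?thesis using diag d ne[OF \<open>d < r\<close>] by (simp add: word_entry_def)
    next
      case (Yvar c)
      have "a' ! i \<in> range Xvar \<union> Yvar ` {..<r}" using var_words_nth[OF a' i] .
      hence "c < r" using Yvar by auto
      moreover have "u c = u d" using diag d Yvar by (simp add: word_entry_def)
      ultimately have "c = d" using inj_onD[OF bij_betw_imp_inj_on[OF u], of c d] \<open>d < r\<close> by simp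
      thus ?thesis using Yvar by simp
    qed
  qed
  show "w ! i = Yvar d \<longleftrightarrow> w' ! i = Yvar d" if "i < ?n" for i d
  proof
    assume "w ! i = Yvar d"
    show "w' ! i = Yvar d"
      by (rule Y[OF _ \<open>w ! i = Yvar d\<close> w' w len[symmetric] diag[OF that, symmetric]])
         (use that len in simp)
  next
    assume "w' ! i = Yvar d"
    show "w ! i = Yvar d"
      by (rule Y[OF that \<open>w' ! i = Yvar d\<close> w w' len diag[OF that]])
  qed
qed

section \<open>Every superclass contains the matrix of a word\<close>

lemma tri_equiv_addrow:
  fixes M :: "'q::field mat"
  assumes M: "M \<in> carrier_mat n n" and kl: "k < l" "l < n"
  shows "tri_equiv n M (addrow c k l M)"
proof (rule tri_equivI[where A = "addrow_mat n c k l" and B = "1\<^sub>m n"])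
  show "upper_triangular (addrow_mat n c k l)"
    using kl by (intro upper_triangularI) auto
  show "addrow c k l M * 1\<^sub>m n = addrow_mat n c k l * M"
    using addrow_mat[OF M kl(2), of c k] M by simp
qed (use kl in \<open>auto simp: upper_triangular_one\<close>)

lemma tri_equiv_addcol:
  fixes M :: "'q::field mat"
  assumes M: "M \<in> carrier_mat n n" and kl: "k < l" "l < n"
  shows "tri_equiv n M (addcol c l k M)"
proof (rule tri_equiv_sym)
  have k: "k < n" using kl by simp
  show c: "addcol c l k M \<in> carrier_mat n n" using M by (intro carrier_matI) auto
  show "tri_equiv n (addcol c l k M) M"
  proof (rule tri_equivI[where A = "1\<^sub>m n" and B = "addrow_mat n c k l"])
    show "upper_triangular (addrow_mat n c k l)"
      using kl by (intro upper_triangularI) auto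
    show "M * addrow_mat n c k l = 1\<^sub>m n * addcol c l k M"
      unfolding left_mult_one_mat[OF c] by (rule addcol_mat[OF M k, symmetric])
  qed (use kl in \<open>auto simp: upper_triangular_one\<close>)
qed (rule M)

lemma tri_equiv_scale:
  fixes M :: "'q::field mat"
  assumes M: "M \<in> carrier_mat n n" and t: "\<And>i. i < n \<Longrightarrow> t i \<noteq> 0"
  shows "tri_equiv n M (mat n n (\<lambda>(i, j). t i * M $$ (i, j) / t j))"
proof -
  define T where "T = mat n n (\<lambda>(i, j). if i = j then t i else 0)"
  have T: "T \<in> carrier_mat n n" by (simp add: T_def)
  have up: "upper_triangular T" by (rule upper_triangularI) (auto simp: T_def)
  show ?thesis
  proof (rule tri_equivI[OF T T up up])
    show "mat n n (\<lambda>(i, j). t i * M $$ (i, j) / t j) * T = T * M"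
    proof (rule eq_matI)
      fix i j assume "i < dim_row (T * M)" "j < dim_col (T * M)"
      hence ij: "i < n" "j < n" using M T by auto
      have "(mat n n (\<lambda>(i, j). t i * M $$ (i, j) / t j) * T) $$ (i, j) =
          (\<Sum>l<n. if l = j then t i * M $$ (i, j) else 0)"
        unfolding mult_mat_sum[OF mat_carrier T ij]
        by (rule sum.cong[OF refl]) (use ij t in \<open>auto simp: T_def\<close>)
      moreover have "(T * M) $$ (i, j) = (\<Sum>l<n. if l = i then t i * M $$ (i, j) else 0)"
        unfolding mult_mat_sum[OF T M ij]
        by (rule sum.cong[OF refl]) (use ij in \<open>auto simp: T_def\<close>)
      ultimately show "(mat n n (\<lambda>(i, j). t i * M $$ (i, j) / t j) * T) $$ (i, j) = (T * M) $$ (i, j)"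
        using ij by simp
    qed (use M T in auto)
  qed (use t in \<open>simp_all add: T_def\<close>)
qed

text \<open>Once the rows below are in rook form, row \<open>k\<close> is brought into rook form by operations that each
  remove one nonzero entry of row \<open>k\<close> and do not touch the rows below: first rows below clear the columns
  that they occupy, then the leftmost remaining entry clears those to its right.\<close>

lemma row_reduction:
  fixes M :: "'q::field mat"
  assumes "M \<in> carrier_mat n n" "upper_triangular M" "k < n" "rook_from n (Suc k) M"
  shows "\<exists>M'. M' \<in> carrier_mat n n \<and> tri_equiv n M M' \<and> rook_from n k M' \<and>
    (\<forall>i j. k < i \<and> i < n \<and> j < n \<longrightarrow> M' $$ (i, j) = M $$ (i, j))"
  using assms
proof (induction "card {s. s < n \<and> M $$ (k, s) \<noteq> 0}" arbitrary: M rule: less_induct)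
  case less
  note M = less.prems(1) and up = less.prems(2) and k = less.prems(3) and R = less.prems(4)
  have step: ?case
    if N: "N \<in> carrier_mat n n" "tri_equiv n M N"
      and below: "\<And>i j. k < i \<Longrightarrow> i < n \<Longrightarrow> j < n \<Longrightarrow> N $$ (i, j) = M $$ (i, j)"
      and fewer: "{s. s < n \<and> N $$ (k, s) \<noteq> 0} \<subset> {s. s < n \<and> M $$ (k, s) \<noteq> 0}" for N
  proof -
    have upN: "upper_triangular N" by (rule tri_equiv_upper_triangular[OF M up N])
    have "rook_from n (Suc k) N"
      unfolding rook_from_def
    proof (intro conjI allI impI; elim conjE)
      fix i j j' assume "Suc k \<le> i" "i < n" "j < n" "j' < n" "N $$ (i, j) \<noteq> 0" "N $$ (i, j') \<noteq> 0"
      thus "j = j'" using rook_fromD(1)[OF R, of i j j'] below[of i j] below[of i j'] by simp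
    next
      fix i i' j assume "Suc k \<le> i" "i < n" "Suc k \<le> i'" "i' < n" "j < n"
        "N $$ (i, j) \<noteq> 0" "N $$ (i', j) \<noteq> 0"
      thus "i = i'" using rook_fromD(2)[OF R, of i i' j] below[of i j] below[of i' j] by simp
    qed
    moreover have "card {s. s < n \<and> N $$ (k, s) \<noteq> 0} < card {s. s < n \<and> M $$ (k, s) \<noteq> 0}"
      using fewer by (intro psubset_card_mono) auto
    ultimately obtain M' where M': "M' \<in> carrier_mat n n" "tri_equiv n N M'" "rook_from n k M'"
      "\<forall>i j. k < i \<and> i < n \<and> j < n \<longrightarrow> M' $$ (i, j) = N $$ (i, j)"
      using less.hyps[OF _ N(1) upN k] by blast
    have "tri_equiv n M M'" by (rule tri_equiv_trans[OF M N(1) M'(1) N(2) M'(2)])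
    with M' below show ?thesis by (intro exI[of _ M']) simp
  qed
  consider
      (col) l s where "k < l" "l < n" "s < n" "M $$ (k, s) \<noteq> 0" "M $$ (l, s) \<noteq> 0"
    | (row) s s' where "s < s'" "s' < n" "M $$ (k, s) \<noteq> 0" "M $$ (k, s') \<noteq> 0"
        "\<And>l. k < l \<Longrightarrow> l < n \<Longrightarrow> M $$ (l, s) = 0"
    | (rook) "rook_from n k M"
  proof -
    have "rook_from n k M"
      if ncol: "\<And>l s. k < l \<Longrightarrow> l < n \<Longrightarrow> s < n \<Longrightarrow> M $$ (k, s) \<noteq> 0 \<Longrightarrow> M $$ (l, s) = 0"
        and nrow: "\<And>s s'. s < s' \<Longrightarrow> s' < n \<Longrightarrow> M $$ (k, s) \<noteq> 0 \<Longrightarrow> M $$ (k, s') = 0"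
      unfolding rook_from_def
    proof (intro conjI allI impI; elim conjE)
      fix i j j' assume ij: "k \<le> i" "i < n" "j < n" "j' < n" "M $$ (i, j) \<noteq> 0" "M $$ (i, j') \<noteq> 0"
      show "j = j'"
      proof (cases "i = k")
        case True
        thus ?thesis using nrow[of j j'] nrow[of j' j] ij by (cases j j' rule: linorder_cases) auto
      next
        case False
        with ij show ?thesis by (intro rook_fromD(1)[OF R, of i]) auto
      qed
    next
      fix i i' j assume ij: "k \<le> i" "i < n" "k \<le> i'" "i' < n" "j < n" "M $$ (i, j) \<noteq> 0" "M $$ (i', j) \<noteq> 0"
      show "i = i'"
      proof (cases "i = k \<or> i' = k")
        case True
        thus ?thesis using ncol[of i j] ncol[of i' j] ij by (metis le_neq_implies_less)
      next
        case False
        with ij show ?thesis by (intro rook_fromD(2)[OF R, of i i' j]) auto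
      qed
    qed
    note all_rook = this
    show thesis
    proof (cases "\<exists>l s. k < l \<and> l < n \<and> s < n \<and> M $$ (k, s) \<noteq> 0 \<and> M $$ (l, s) \<noteq> 0")
      case True
      thus ?thesis using col by blast
    next
      case ncol: False
      show ?thesis
      proof (cases "\<exists>s s'. s < s' \<and> s' < n \<and> M $$ (k, s) \<noteq> 0 \<and> M $$ (k, s') \<noteq> 0")
        case True
        then obtain s s' where s: "s < s'" "s' < n" "M $$ (k, s) \<noteq> 0" "M $$ (k, s') \<noteq> 0" by blast
        hence "M $$ (l, s) = 0" if "k < l" "l < n" for l using ncol that by (meson less_trans)
        with s show ?thesis by (rule row)
      next
        case False
        show ?thesis by (rule rook, rule all_rook) (use ncol False in blast)+
      qed
    qed
  qed
  thus ?case
  proof cases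
    case (col l s)
    define c where "c = - M $$ (k, s) / M $$ (l, s)"
    hence c: "c * M $$ (l, s) + M $$ (k, s) = 0" using col by simp
    have other: "M $$ (l, j) = 0" if "j < n" "j \<noteq> s" for j
      using rook_fromD(1)[OF R, of l j s] col that by auto
    have ent: "addrow c k l M $$ (i, j) = (if i = k \<and> j = s then 0 else M $$ (i, j))"
      if "i < n" "j < n" for i j
      using that M col(1-3) other[of j] c by (cases "i = k"; cases "j = s") auto
    show ?thesis
    proof (rule step[of "addrow c k l M"])
      show "addrow c k l M \<in> carrier_mat n n" using M by simp
      show "tri_equiv n M (addrow c k l M)" by (rule tri_equiv_addrow[OF M col(1,2)])
      show "addrow c k l M $$ (i, j) = M $$ (i, j)" if "k < i" "i < n" "j < n" for i j
        using that by (simp add: ent del: index_mat_addrow)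
      show "{j. j < n \<and> addrow c k l M $$ (k, j) \<noteq> 0} \<subset> {j. j < n \<and> M $$ (k, j) \<noteq> 0}"
      proof
        show "{j. j < n \<and> addrow c k l M $$ (k, j) \<noteq> 0} \<subseteq> {j. j < n \<and> M $$ (k, j) \<noteq> 0}"
          using k by (auto simp: ent simp del: index_mat_addrow split: if_splits)
        have "s \<notin> {j. j < n \<and> addrow c k l M $$ (k, j) \<noteq> 0}" "s \<in> {j. j < n \<and> M $$ (k, j) \<noteq> 0}"
          using k col by (auto simp: ent simp del: index_mat_addrow)
        thus "{j. j < n \<and> addrow c k l M $$ (k, j) \<noteq> 0} \<noteq> {j. j < n \<and> M $$ (k, j) \<noteq> 0}" by blast
      qed
    qed
  next
    case (row s s')
    define c where "c = - M $$ (k, s') / M $$ (k, s)"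
    hence c: "c * M $$ (k, s) + M $$ (k, s') = 0" using row by simp
    have ent: "addcol c s' s M $$ (i, j) = (if i = k \<and> j = s' then 0 else M $$ (i, j))"
      if "k \<le> i" "i < n" "j < n" for i j
      using that M row(1,2) row(5)[of i] c by (cases "i = k"; cases "j = s'") auto
    show ?thesis
    proof (rule step[of "addcol c s' s M"])
      show "addcol c s' s M \<in> carrier_mat n n" using M by (intro carrier_matI) auto
      show "tri_equiv n M (addcol c s' s M)" by (rule tri_equiv_addcol[OF M row(1,2)])
      show "addcol c s' s M $$ (i, j) = M $$ (i, j)" if "k < i" "i < n" "j < n" for i j
        using that by (simp add: ent del: index_mat_addcol)
      show "{j. j < n \<and> addcol c s' s M $$ (k, j) \<noteq> 0} \<subset> {j. j < n \<and> M $$ (k, j) \<noteq> 0}"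
      proof
        show "{j. j < n \<and> addcol c s' s M $$ (k, j) \<noteq> 0} \<subseteq> {j. j < n \<and> M $$ (k, j) \<noteq> 0}"
          using k by (auto simp: ent simp del: index_mat_addcol split: if_splits)
        have "s' \<notin> {j. j < n \<and> addcol c s' s M $$ (k, j) \<noteq> 0}" "s' \<in> {j. j < n \<and> M $$ (k, j) \<noteq> 0}"
          using k row by (auto simp: ent simp del: index_mat_addcol)
        thus "{j. j < n \<and> addcol c s' s M $$ (k, j) \<noteq> 0} \<noteq> {j. j < n \<and> M $$ (k, j) \<noteq> 0}" by blast
      qed
    qed
  next
    case rook
    thus ?thesis using M tri_equiv_refl[OF M] by blast
  qed
qed

lemma word_arc_Cons_Suc: "word_arc (x # w) (Suc i) (Suc j) \<longleftrightarrow> word_arc w i j"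
proof -
  have "(\<forall>k. Suc i < k \<and> k < Suc j \<longrightarrow> (x # w) ! k \<noteq> w ! i) \<longleftrightarrow> (\<forall>k. i < k \<and> k < j \<longrightarrow> w ! k \<noteq> w ! i)"
  proof (intro iffI allI impI)
    fix k assume "\<forall>k. Suc i < k \<and> k < Suc j \<longrightarrow> (x # w) ! k \<noteq> w ! i" "i < k \<and> k < j"
    thus "w ! k \<noteq> w ! i" by (elim allE[of _ "Suc k"]) simp
  next
    fix k assume "\<forall>k. i < k \<and> k < j \<longrightarrow> w ! k \<noteq> w ! i" "Suc i < k \<and> k < Suc j"
    thus "(x # w) ! k \<noteq> w ! i" by (cases k) auto
  qed
  thus ?thesis by (simp add: word_arc_def)
qed

lemma word_entry_Cons_Suc: "word_entry u (x # w) (Suc i) (Suc j) = word_entry u w i j"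
  by (simp add: word_entry_def word_arc_Cons_Suc)

lemma word_arc_Cons_0:
  "word_arc (x # w) 0 (Suc q) \<longleftrightarrow>
     q < length w \<and> w ! q = x \<and> x \<in> range Xvar \<and> (\<forall>p<q. w ! p \<noteq> x)"
proof -
  have "(\<forall>k. 0 < k \<and> k < Suc q \<longrightarrow> (x # w) ! k \<noteq> x) \<longleftrightarrow> (\<forall>p<q. w ! p \<noteq> x)"
  proof (intro iffI allI impI)
    fix p assume "\<forall>k. 0 < k \<and> k < Suc q \<longrightarrow> (x # w) ! k \<noteq> x" "p < q"
    thus "w ! p \<noteq> x" by (elim allE[of _ "Suc p"]) simp
  next
    fix k assume "\<forall>p<q. w ! p \<noteq> x" "0 < k \<and> k < Suc q"
    thus "(x # w) ! k \<noteq> x" by (cases k) auto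
  qed
  thus ?thesis by (auto simp: word_arc_def)
qed

lemma word_entry_Cons_below: "word_entry u (x # w) (Suc i) 0 = 0"
  by (simp add: word_entry_def word_arc_def)

text \<open>The rows are processed from the last one upwards, and each row contributes one letter to the
  front of the word: a \<open>Y\<close>-letter if its diagonal entry is nonzero, the letter of the column of its
  entry if that is off the diagonal, and a new \<open>X\<close>-letter if the row is zero.\<close>

lemma word_normal_form_rows:
  fixes M :: "'q::field mat"
  assumes u: "bij_betw u {..<r} (UNIV - {0, 1})"
    and M: "M \<in> carrier_mat n n" "upper_triangular M" and d: "\<And>i. i < n \<Longrightarrow> M $$ (i, i) \<noteq> - 1"
  shows "k \<le> n \<Longrightarrow> \<exists>M' w. M' \<in> carrier_mat n n \<and> tri_equiv n M M' \<and> length w = n - k \<and> w \<in> var_words r \<and>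
    (\<forall>i j. k \<le> i \<and> i < n \<and> k \<le> j \<and> j < n \<longrightarrow> M' $$ (i, j) = word_entry u w (i - k) (j - k))"
proof (induction rule: inc_induct)
  case base
  show ?case using M(1) tri_equiv_refl[OF M(1)] by (intro exI[of _ M] exI[of _ "[]"]) auto
next
  case (step k)
  then obtain M1 w where M1: "M1 \<in> carrier_mat n n" "tri_equiv n M M1"
    and w: "length w = n - Suc k" "w \<in> var_words r"
    and ent1: "\<And>i j. Suc k \<le> i \<Longrightarrow> i < n \<Longrightarrow> Suc k \<le> j \<Longrightarrow> j < n \<Longrightarrow>
      M1 $$ (i, j) = word_entry u w (i - Suc k) (j - Suc k)" by blast
  have k: "k < n" using step by simp
  have up1: "upper_triangular M1" by (rule tri_equiv_upper_triangular[OF M M1])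
  have low1: "Suc k \<le> j" if "Suc k \<le> i" "i < n" "j < n" "M1 $$ (i, j) \<noteq> 0" for i j
    using upper_triangular_zero[OF up1 M1(1), of j i] that by (meson le_trans not_less)
  have "rook_from n (Suc k) M1"
    unfolding rook_from_def
  proof (intro conjI allI impI; elim conjE)
    fix i j j' assume ij: "Suc k \<le> i" "i < n" "j < n" "j' < n" "M1 $$ (i, j) \<noteq> 0" "M1 $$ (i, j') \<noteq> 0"
    hence l: "Suc k \<le> j" "Suc k \<le> j'" using low1 by blast+
    have "j - Suc k = j' - Suc k"
      using ij l by (intro word_entry_row[of u w "i - Suc k"]) (simp_all add: ent1[symmetric])
    thus "j = j'" using l by linarith
  next
    fix i i' j assume ij: "Suc k \<le> i" "i < n" "Suc k \<le> i'" "i' < n" "j < n" "M1 $$ (i, j) \<noteq> 0" "M1 $$ (i', j) \<noteq> 0"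
    hence l: "Suc k \<le> j" using low1 by blast
    have "i - Suc k = i' - Suc k"
      using ij l by (intro word_entry_col[of u w _ "j - Suc k"]) (simp_all add: ent1[symmetric])
    thus "i = i'" using ij by linarith
  qed
  then obtain M2 where M2: "M2 \<in> carrier_mat n n" "tri_equiv n M1 M2" and R: "rook_from n k M2"
    and keep: "\<forall>i j. k < i \<and> i < n \<and> j < n \<longrightarrow> M2 $$ (i, j) = M1 $$ (i, j)"
    using row_reduction[OF M1(1) up1 k] by blast
  have e2: "tri_equiv n M M2" by (rule tri_equiv_trans[OF M(1) M1(1) M2(1) M1(2) M2(2)])
  have up2: "upper_triangular M2" by (rule tri_equiv_upper_triangular[OF M M2(1) e2])
  have ent2: "M2 $$ (i, j) = word_entry u w (i - Suc k) (j - Suc k)"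
    if "k < i" "i < n" "k < j" "j < n" for i j
    using keep that by (simp add: ent1)
  have low2: "M2 $$ (i, k) = 0" if "k < i" "i < n" for i
    by (rule upper_triangular_zero[OF up2 M2(1) that])
  have finish: ?case
    if N: "N \<in> carrier_mat n n" "tri_equiv n M N" and x: "x \<in> range Xvar \<union> Yvar ` {..<r}"
      and below: "\<And>i j. k < i \<Longrightarrow> i < n \<Longrightarrow> k \<le> j \<Longrightarrow> j < n \<Longrightarrow> N $$ (i, j) = M2 $$ (i, j)"
      and diag: "N $$ (k, k) = word_entry u (x # w) 0 0"
      and row: "\<And>j. k < j \<Longrightarrow> j < n \<Longrightarrow> N $$ (k, j) = word_entry u (x # w) 0 (j - k)" for N x
  proof (intro exI[of _ N] exI[of _ "x # w"] conjI allI impI; (elim conjE)?)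
    show "length (x # w) = n - k" using w k by simp
    show "x # w \<in> var_words r" using w x by simp
    fix i j assume ij: "k \<le> i" "i < n" "k \<le> j" "j < n"
    show "N $$ (i, j) = word_entry u (x # w) (i - k) (j - k)"
    proof (cases "i = k")
      case True
      thus ?thesis using diag row[of j] ij by (cases "j = k") auto
    next
      case False
      hence i: "k < i" "i - k = Suc (i - Suc k)" using ij by auto
      show ?thesis
      proof (cases "j = k")
        case True
        thus ?thesis using low2 below i ij by (simp add: word_entry_Cons_below)
      next
        case False
        hence "k < j" "j - k = Suc (j - Suc k)" using ij by auto
        thus ?thesis using below ent2 i ij by (simp add: word_entry_Cons_Suc)
      qed
    qed
  qed (use N in auto)
  consider (Y) "M2 $$ (k, k) \<noteq> 0" | (arc) s where "k < s" "s < n" "M2 $$ (k, s) \<noteq> 0"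
    | (zero) "\<And>s. k \<le> s \<Longrightarrow> s < n \<Longrightarrow> M2 $$ (k, s) = 0"
    by (metis le_neq_implies_less)
  thus ?case
  proof cases
    case Y
    have "M2 $$ (k, k) = M $$ (k, k)" by (rule tri_equiv_diag[OF M M2(1) up2 e2 k])
    hence "M2 $$ (k, k) + 1 \<noteq> 0" using d[OF k] by (simp add: add_eq_0_iff2)
    hence "M2 $$ (k, k) + 1 \<in> UNIV - {0, 1}" using Y by simp
    then obtain c where c: "c < r" "u c = M2 $$ (k, k) + 1"
      using u by (metis bij_betw_imp_surj_on imageE lessThan_iff)
    have z: "M2 $$ (k, j) = 0" if "k < j" "j < n" for j
      using rook_fromD(1)[OF R, of k k j] that k Y by auto
    show ?thesis
      by (rule finish[OF M2(1) e2, of "Yvar c"])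
         (use c z in \<open>auto simp: word_entry_def word_arc_def\<close>)
  next
    case zero
    obtain a where a: "a \<notin> {i. Xvar i \<in> set w}"
      using ex_new_if_finite[OF infinite_UNIV_nat finite_Xvar_indices[of w]] by blast
    have "\<not> word_arc (Xvar a # w) 0 (Suc q)" for q
    proof
      assume "word_arc (Xvar a # w) 0 (Suc q)"
      hence q: "q < length w" "w ! q = Xvar a" by (simp_all add: word_arc_Cons_0)
      with a nth_mem[OF q(1)] show False by simp
    qed
    hence "word_entry u (Xvar a # w) 0 (j - k) = 0" if "k < j" for j
      using that by (cases "j - k") (auto simp: word_entry_def)
    thus ?thesis
      by (intro finish[OF M2(1) e2, of "Xvar a"]) (use zero k in \<open>auto simp: word_entry_def\<close>)
  next
    case (arc s)
    define q where "q = s - Suc k"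
    have q: "q < length w" "s = k + Suc q" using arc w by (auto simp: q_def)
    have col: "M2 $$ (l, s) = 0" if "k < l" "l < n" for l
      using rook_fromD(2)[OF R, of k l s] that arc by auto
    have Xq: "w ! q \<in> range Xvar"
    proof (cases "w ! q")
      case (Yvar c)
      have "w ! q \<in> set w" using q by simp
      hence "c < r" using w(2) Yvar by auto
      hence "u c \<noteq> 1" using u by (auto simp: bij_betw_def)
      moreover have "M2 $$ (s, s) = u c - 1"
        using ent2[of s s] arc Yvar by (simp add: word_entry_def q_def)
      ultimately show ?thesis using col[of s] arc by simp
    qed simp
    have first: "w ! p \<noteq> w ! q" if p: "p < q" for p
    proof
      assume eq: "w ! p = w ! q"
      obtain m where m: "p \<le> m" "word_arc w m q"
        using word_arc_chain[OF p q(1) eq] Xq eq by metis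
      hence "m < q" by (simp add: word_arc_less)
      have l: "k < Suc k + m" "Suc k + m < n" using \<open>m < q\<close> q(2) arc(2) by simp_all
      have "M2 $$ (Suc k + m, s) = word_entry u w (Suc k + m - Suc k) (s - Suc k)"
        by (rule ent2[OF l arc(1,2)])
      also have "\<dots> = 1" using m(2) \<open>m < q\<close> by (simp add: word_entry_def q_def[symmetric])
      finally show False using col[OF l] by simp
    qed
    have arcs: "word_arc (w ! q # w) 0 (Suc p) \<longleftrightarrow> p = q" for p
    proof
      assume "word_arc (w ! q # w) 0 (Suc p)"
      hence p: "w ! p = w ! q" "\<forall>p'<p. w ! p' \<noteq> w ! q" by (auto simp: word_arc_Cons_0)
      thus "p = q" using first[of p] by (metis linorder_neqE_nat)
    qed (use q Xq first in \<open>simp add: word_arc_Cons_0\<close>)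
    have z: "M2 $$ (k, j) = 0" if "j \<noteq> s" "j < n" for j
      using rook_fromD(1)[OF R, of k s j] that k arc by auto
    \<comment> \<open>Conjugation by this diagonal matrix turns the entry at \<open>(k, s)\<close> into \<open>1\<close>. Column \<open>k\<close> vanishes below row \<open>k\<close>, so the rows below do not change.\<close>
    define t where "t i = (if i = k then 1 / M2 $$ (k, s) else 1)" for i
    define N where "N = mat n n (\<lambda>(i, j). t i * M2 $$ (i, j) / t j)"
    have t: "t i \<noteq> 0" for i using arc by (simp add: t_def)
    have N: "N \<in> carrier_mat n n" by (simp add: N_def)
    have "tri_equiv n M2 N" unfolding N_def by (rule tri_equiv_scale[OF M2(1)]) (rule t)
    hence eN: "tri_equiv n M N" by (rule tri_equiv_trans[OF M(1) M2(1) N e2])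
    show ?thesis
    proof (rule finish[OF N eN, of "w ! q"])
      show "w ! q \<in> range Xvar \<union> Yvar ` {..<r}" using Xq by blast
      show "N $$ (i, j) = M2 $$ (i, j)" if "k < i" "i < n" "k \<le> j" "j < n" for i j
        using that low2[of i] by (auto simp: N_def t_def)
      show "N $$ (k, k) = word_entry u (w ! q # w) 0 0"
        using z[of k] arc k Xq by (auto simp: N_def word_entry_def)
      show "N $$ (k, j) = word_entry u (w ! q # w) 0 (j - k)" if "k < j" "j < n" for j
      proof -
        have jk: "j - k = Suc (j - Suc k)" using that by simp
        have "word_entry u (w ! q # w) 0 (j - k) = (if j = s then 1 else 0)"
          unfolding jk using that q by (auto simp: word_entry_def arcs)
        moreover have "N $$ (k, j) = (if j = s then 1 else 0)"
          using that k arc z[of j] by (auto simp: N_def t_def)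
        ultimately show ?thesis by simp
      qed
    qed
  qed
qed

lemma word_normal_form:
  fixes g :: "'q::field mat"
  assumes u: "bij_betw u {..<r} (UNIV - {0, 1})" and g: "g \<in> tri_group n"
  obtains w where "length w = n" "w \<in> var_words r" "g \<in> superclass n (word_mat u w)"
proof -
  have g': "g \<in> carrier_mat n n" "upper_triangular g" "\<forall>i<n. g $$ (i, i) \<noteq> 0"
    using g by (simp_all add: tri_group_iff)
  let ?M = "g - 1\<^sub>m n"
  have M: "?M \<in> carrier_mat n n" by (simp add: minus_carrier_mat)
  have up: "upper_triangular ?M"
    by (rule upper_triangularI) (use g' in \<open>simp add: upper_triangular_zero\<close>)
  have d: "?M $$ (i, i) \<noteq> - 1" if "i < n" for i using g' that by simp
  obtain M' w where M': "M' \<in> carrier_mat n n" "tri_equiv n ?M M'" and w: "length w = n" "w \<in> var_words r"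
    and ent: "\<forall>i j. i < n \<and> j < n \<longrightarrow> M' $$ (i, j) = word_entry u w i j"
    using word_normal_form_rows[OF u M up d, of 0] by auto
  have "M' = word_rook u w"
    by (rule eq_matI) (use M'(1) w ent in \<open>auto simp: word_rook_def\<close>)
  hence "tri_equiv n (word_rook u w) ?M" using tri_equiv_sym[OF M M'] by simp
  hence "g \<in> superclass n (word_mat u w)"
    using superclass_iff[of "word_mat u w" n g] word_mat_carrier[of u w] word_mat_minus_one[of u w] w g'(1)
    by simp
  with w show thesis using that by blast
qed

section \<open>Diagonal blocks\<close>

definition diag_block :: "nat \<Rightarrow> nat \<Rightarrow> 'q mat \<Rightarrow> 'q mat" where
  "diag_block s m A = mat m m (\<lambda>(i, j). A $$ (i + s, j + s))"

lemma diag_block_carrier [simp]: "diag_block s m A \<in> carrier_mat m m"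
  by (simp add: diag_block_def)

text \<open>A product of entries of two upper triangular matrices vanishes if its middle index leaves the
  interval between the outer ones.\<close>

lemma diag_block_mult:
  fixes A B :: "'q::field mat"
  assumes A: "A \<in> carrier_mat n n" "upper_triangular A" and B: "B \<in> carrier_mat n n" "upper_triangular B"
    and s: "s + m \<le> n"
  shows "diag_block s m (A * B) = diag_block s m A * diag_block s m B"
proof (rule eq_matI)
  fix i j assume "i < dim_row (diag_block s m A * diag_block s m B)" "j < dim_col (diag_block s m A * diag_block s m B)"
  hence ij: "i < m" "j < m" by (simp_all add: diag_block_def)
  hence ij': "i + s < n" "j + s < n" using s by simp_all
  let ?f = "\<lambda>l. A $$ (i + s, l) * B $$ (l, j + s)"
  have "?f l = 0" if l: "l < n" "l \<notin> {s..<s + m}" for l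
  proof (cases "l < i + s")
    case True
    thus ?thesis using upper_triangular_zero[OF A(2,1), of l "i + s"] ij' by simp
  next
    case False
    hence "j + s < l" using l ij by auto
    thus ?thesis using upper_triangular_zero[OF B(2,1), of "j + s" l] l by simp
  qed
  hence "(\<Sum>l<n. ?f l) = (\<Sum>l\<in>{s..<s + m}. ?f l)"
    using s by (intro sum.mono_neutral_right) auto
  also have "\<dots> = (\<Sum>l<m. ?f (l + s))"
    using sum.shift_bounds_nat_ivl[of ?f 0 s m] by (simp add: atLeast0LessThan add.commute)
  also have "\<dots> = (diag_block s m A * diag_block s m B) $$ (i, j)"
    unfolding mult_mat_sum[OF diag_block_carrier diag_block_carrier ij]
    using ij by (simp add: diag_block_def)
  finally show "diag_block s m (A * B) $$ (i, j) = (diag_block s m A * diag_block s m B) $$ (i, j)"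
    unfolding mult_mat_sum[OF A(1) B(1) ij', symmetric] using ij by (simp add: diag_block_def)
qed (simp_all add: diag_block_def)

lemma upper_triangular_diag_block:
  assumes "A \<in> carrier_mat n n" "upper_triangular A" "s + m \<le> n"
  shows "upper_triangular (diag_block s m A)"
  by (rule upper_triangularI) (use assms in \<open>auto simp: diag_block_def intro!: upper_triangular_zero[of A n]\<close>)

lemma tri_equiv_diag_block:
  fixes M :: "'q::field mat"
  assumes M: "M \<in> carrier_mat n n" "upper_triangular M" and M': "M' \<in> carrier_mat n n" "upper_triangular M'"
    and e: "tri_equiv n M M'" and s: "s + m \<le> n"
  shows "tri_equiv m (diag_block s m M) (diag_block s m M')"
proof -
  obtain A B where AB': "A \<in> carrier_mat n n" "B \<in> carrier_mat n n" "upper_triangular A" "upper_triangular B"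
    "\<forall>i<n. A $$ (i, i) = B $$ (i, i)" "\<forall>i<n. A $$ (i, i) \<noteq> 0" "M' * B = A * M"
    using e unfolding tri_equiv_def by blast
  note AB = AB'[rule_format]
  have eq: "diag_block s m M' * diag_block s m B = diag_block s m A * diag_block s m M"
    unfolding diag_block_mult[OF M' AB(2,4) s, symmetric] diag_block_mult[OF AB(1,3) M s, symmetric] AB(7) ..
  show ?thesis
    by (rule tri_equivI[OF diag_block_carrier diag_block_carrier upper_triangular_diag_block[OF AB(1,3) s]
          upper_triangular_diag_block[OF AB(2,4) s] _ _ eq])
       (use AB(5,6) s in \<open>simp_all add: diag_block_def\<close>)
qed

lemma diag_block_minus_one:
  fixes g :: "'q::field mat"
  assumes "g \<in> carrier_mat n n" "s + m \<le> n"
  shows "diag_block s m (g - 1\<^sub>m n) = diag_block s m g - 1\<^sub>m m"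
  by (rule eq_matI) (use assms in \<open>auto simp: diag_block_def\<close>)

lemma upper_triangular_minus_one:
  fixes g :: "'q::field mat"
  assumes "g \<in> carrier_mat n n" "upper_triangular g"
  shows "upper_triangular (g - 1\<^sub>m n)"
  by (rule upper_triangularI) (use assms in \<open>simp add: upper_triangular_zero\<close>)

lemma diag_block_superclass:
  fixes g :: "'q::field mat"
  assumes g: "g \<in> tri_group n" and h: "h \<in> tri_group n" and e: "g \<in> superclass n h" and s: "s + m \<le> n"
  shows "diag_block s m g \<in> superclass m (diag_block s m h)"
proof -
  have c: "g \<in> carrier_mat n n" "upper_triangular g" "h \<in> carrier_mat n n" "upper_triangular h"
    using g h by (simp_all add: tri_group_iff)
  have "tri_equiv n (h - 1\<^sub>m n) (g - 1\<^sub>m n)" using e superclass_iff[OF c(3)] by blast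
  from tri_equiv_diag_block[OF minus_carrier_mat[OF one_carrier_mat] upper_triangular_minus_one[OF c(3,4)]
      minus_carrier_mat[OF one_carrier_mat] upper_triangular_minus_one[OF c(1,2)] this s]
  show ?thesis
    unfolding superclass_iff[OF diag_block_carrier] diag_block_minus_one[OF c(3) s] diag_block_minus_one[OF c(1) s]
    by simp
qed

lemma word_arc_take: "j < k \<Longrightarrow> word_arc (take k w) i j \<longleftrightarrow> word_arc w i j"
  by (simp add: word_arc_def cong: conj_cong imp_cong)

lemma word_arc_drop: "word_arc (drop k w) i j \<longleftrightarrow> word_arc w (i + k) (j + k)"
proof (induction k arbitrary: w)
  case (Suc k)
  show ?case
  proof (cases w)
    case Nil
    thus ?thesis by (simp add: word_arc_def)
  next
    case (Cons x w')
    thus ?thesis using Suc[of w'] by (simp add: word_arc_Cons_Suc)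
  qed
qed simp

lemma word_mat_index:
  "i < length w \<Longrightarrow> j < length w \<Longrightarrow> word_mat u w $$ (i, j) = (if i = j then 1 else 0) + word_entry u w i j"
  by (simp add: word_mat_def word_rook_def)

lemma dim_word_mat [simp]: "dim_row (word_mat u w) = length w" "dim_col (word_mat u w) = length w"
  using word_mat_carrier[of u w] by auto

lemma diag_block_word_mat_take:
  assumes k: "k \<le> length w"
  shows "diag_block 0 k (word_mat u w) = word_mat u (take k w)"
proof (rule eq_matI)
  fix i j assume "i < dim_row (word_mat u (take k w))" "j < dim_col (word_mat u (take k w))"
  hence ij: "i < k" "j < k" using k by auto
  hence "word_entry u (take k w) i j = word_entry u w i j"
    by (simp add: word_entry_def word_arc_take)
  thus "diag_block 0 k (word_mat u w) $$ (i, j) = word_mat u (take k w) $$ (i, j)"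
    using ij k by (simp add: diag_block_def word_mat_index)
qed (use k in \<open>simp_all add: diag_block_def\<close>)

lemma diag_block_word_mat_drop:
  assumes k: "k \<le> length w"
  shows "diag_block k (length w - k) (word_mat u w) = word_mat u (drop k w)"
proof (rule eq_matI)
  fix i j assume "i < dim_row (word_mat u (drop k w))" "j < dim_col (word_mat u (drop k w))"
  hence ij: "i < length w - k" "j < length w - k" by auto
  hence "word_entry u (drop k w) i j = word_entry u w (i + k) (j + k)"
    using k by (simp add: word_entry_def word_arc_drop add.commute)
  thus "diag_block k (length w - k) (word_mat u w) $$ (i, j) = word_mat u (drop k w) $$ (i, j)"
    using ij k by (simp add: diag_block_def word_mat_index)
qed (simp_all add: diag_block_def)

section \<open>Embedding two triangular groups on complementary index sets\<close>

text \<open>The inverse of \<^const>\<open>levi_iso\<close> (lemma \<open>levi_iso_embed\<close>), given by a formula for arbitrary matrices: it is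
  also applied to \<open>g - 1\<close> and to the matrices that witness \<^const>\<open>tri_equiv\<close>.\<close>

definition levi_embed :: "nat \<Rightarrow> nat set \<Rightarrow> 'q::zero mat \<Rightarrow> 'q mat \<Rightarrow> 'q mat" where
  "levi_embed n A g1 g2 = mat n n (\<lambda>(i, j).
     if i \<in> A \<and> j \<in> A then g1 $$ (rank_in A i, rank_in A j)
     else if i \<notin> A \<and> j \<notin> A then
       g2 $$ (rank_in ({..<n} - A) i, rank_in ({..<n} - A) j)
     else 0)"

context
  fixes n k m :: nat and A :: "nat set"
  assumes A: "A \<subseteq> {..<n}" and k: "card A = k" and n: "n = k + m"
begin

abbreviation "complement \<equiv> {..<n} - A"

lemma finite_complement: "finite A" "finite complement"
  using A by (auto intro: finite_subset)

lemma card_complement: "card complement = m"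
  using card_lessThan_Diff[of A k m] A k n by simp

lemma rank_less1: "i \<in> A \<Longrightarrow> rank_in A i < k" and rank_less2: "i \<in> complement \<Longrightarrow> rank_in complement i < m"
  using rank_in_less_card[OF finite_complement(1), of i] rank_in_less_card[OF finite_complement(2), of i] k card_complement by simp_all

lemma levi_embed_carrier: "levi_embed n A g1 g2 \<in> carrier_mat n n"
  by (simp add: levi_embed_def)

lemma levi_embed_index:
  assumes "i < n" "j < n"
  shows "i \<in> A \<Longrightarrow> j \<in> A \<Longrightarrow> levi_embed n A g1 g2 $$ (i, j) = g1 $$ (rank_in A i, rank_in A j)"
    and "i \<notin> A \<Longrightarrow> j \<notin> A \<Longrightarrow> levi_embed n A g1 g2 $$ (i, j) = g2 $$ (rank_in complement i, rank_in complement j)"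
    and "i \<in> A \<Longrightarrow> j \<notin> A \<Longrightarrow> levi_embed n A g1 g2 $$ (i, j) = 0"
    and "i \<notin> A \<Longrightarrow> j \<in> A \<Longrightarrow> levi_embed n A g1 g2 $$ (i, j) = 0"
  using assms by (simp_all add: levi_embed_def)

lemma levi_embed_mult:
  fixes a1 :: "'q::field mat"
  assumes 1: "a1 \<in> carrier_mat k k" "b1 \<in> carrier_mat k k"
    and 2: "a2 \<in> carrier_mat m m" "b2 \<in> carrier_mat m m"
  shows "levi_embed n A (a1 * b1) (a2 * b2) = levi_embed n A a1 a2 * levi_embed n A b1 b2"
proof (rule eq_matI)
  let ?X = "levi_embed n A a1 a2" and ?Y = "levi_embed n A b1 b2"
  fix i j assume "i < dim_row (?X * ?Y)" "j < dim_col (?X * ?Y)"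
  hence ij: "i < n" "j < n" by (simp_all add: levi_embed_def)
  have split: "(?X * ?Y) $$ (i, j) =
      (\<Sum>l\<in>A. ?X $$ (i, l) * ?Y $$ (l, j)) + (\<Sum>l\<in>complement. ?X $$ (i, l) * ?Y $$ (l, j))"
    unfolding mult_mat_sum[OF levi_embed_carrier levi_embed_carrier ij]
    using A by (subst sum.subset_diff[of A]) (auto simp: add.commute)
  have An: "l < n" if "l \<in> A" for l using that A by auto
  consider "i \<in> A" "j \<in> A" | "i \<notin> A" "j \<notin> A" | "i \<in> A" "j \<notin> A" | "i \<notin> A" "j \<in> A" by blast
  thus "levi_embed n A (a1 * b1) (a2 * b2) $$ (i, j) = (?X * ?Y) $$ (i, j)"
  proof cases
    case 1
    have "(\<Sum>l\<in>A. ?X $$ (i, l) * ?Y $$ (l, j)) = (\<Sum>l\<in>A. a1 $$ (rank_in A i, rank_in A l) * b1 $$ (rank_in A l, rank_in A j))"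
      using 1 ij An by (intro sum.cong) (simp_all add: levi_embed_index)
    also have "\<dots> = (\<Sum>l<k. a1 $$ (rank_in A i, l) * b1 $$ (l, rank_in A j))"
      using sum.reindex_bij_betw[OF bij_betw_rank_in[OF finite_complement(1)], of "\<lambda>l. a1 $$ (rank_in A i, l) * b1 $$ (l, rank_in A j)"] k
      by simp
    also have "\<dots> = (a1 * b1) $$ (rank_in A i, rank_in A j)"
      using mult_mat_sum[OF assms(1,2) rank_less1[OF 1(1)] rank_less1[OF 1(2)]] by simp
    moreover have "(\<Sum>l\<in>complement. ?X $$ (i, l) * ?Y $$ (l, j)) = 0"
      using 1 ij by (intro sum.neutral) (simp add: levi_embed_index)
    ultimately show ?thesis unfolding split using 1 ij by (simp add: levi_embed_index)
  next
    case 2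
    hence c: "i \<in> complement" "j \<in> complement" using ij by auto
    have "(\<Sum>l\<in>complement. ?X $$ (i, l) * ?Y $$ (l, j)) = (\<Sum>l\<in>complement. a2 $$ (rank_in complement i, rank_in complement l) * b2 $$ (rank_in complement l, rank_in complement j))"
      using 2 ij by (intro sum.cong) (simp_all add: levi_embed_index)
    also have "\<dots> = (\<Sum>l<m. a2 $$ (rank_in complement i, l) * b2 $$ (l, rank_in complement j))"
      using sum.reindex_bij_betw[OF bij_betw_rank_in[OF finite_complement(2)], of "\<lambda>l. a2 $$ (rank_in complement i, l) * b2 $$ (l, rank_in complement j)"]
      by (simp only: card_complement)
    also have "\<dots> = (a2 * b2) $$ (rank_in complement i, rank_in complement j)"
      using mult_mat_sum[OF assms(3,4) rank_less2[OF c(1)] rank_less2[OF c(2)]] by simp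
    moreover have "(\<Sum>l\<in>A. ?X $$ (i, l) * ?Y $$ (l, j)) = 0"
      using 2 ij An by (intro sum.neutral) (simp add: levi_embed_index)
    ultimately show ?thesis unfolding split using 2 ij by (simp add: levi_embed_index)
  next
    case 3
    have "(\<Sum>l\<in>A. ?X $$ (i, l) * ?Y $$ (l, j)) = 0" "(\<Sum>l\<in>complement. ?X $$ (i, l) * ?Y $$ (l, j)) = 0"
      using 3 ij An by (auto intro!: sum.neutral simp: levi_embed_index)
    thus ?thesis unfolding split using 3 ij by (simp add: levi_embed_index)
  next
    case 4
    have "(\<Sum>l\<in>A. ?X $$ (i, l) * ?Y $$ (l, j)) = 0" "(\<Sum>l\<in>complement. ?X $$ (i, l) * ?Y $$ (l, j)) = 0"
      using 4 ij An by (auto intro!: sum.neutral simp: levi_embed_index)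
    thus ?thesis unfolding split using 4 ij by (simp add: levi_embed_index)
  qed
qed (simp_all add: levi_embed_def)

lemma upper_triangular_levi_embed:
  fixes g1 :: "'q::field mat"
  assumes 1: "g1 \<in> carrier_mat k k" "upper_triangular g1" and 2: "g2 \<in> carrier_mat m m" "upper_triangular g2"
  shows "upper_triangular (levi_embed n A g1 g2)"
proof (rule upper_triangular_carrierI[OF levi_embed_carrier])
  fix i j assume ij: "i < n" "j < i"
  hence j: "j < n" by simp
  consider "i \<in> A" "j \<in> A" | "i \<notin> A" "j \<notin> A" | "i \<in> A" "j \<notin> A" | "i \<notin> A" "j \<in> A" by blast
  thus "levi_embed n A g1 g2 $$ (i, j) = 0"
  proof cases
    case 1
    have "g1 $$ (rank_in A i, rank_in A j) = 0"
      by (rule upper_triangular_zero[OF assms(2,1) rank_in_mono[OF finite_complement(1) 1(2) ij(2)] rank_less1[OF 1(1)]])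
    thus ?thesis using 1 ij j by (simp add: levi_embed_index)
  next
    case 2
    hence c: "i \<in> complement" "j \<in> complement" using ij by auto
    have "g2 $$ (rank_in complement i, rank_in complement j) = 0"
      by (rule upper_triangular_zero[OF assms(4,3) rank_in_mono[OF finite_complement(2) c(2) ij(2)] rank_less2[OF c(1)]])
    thus ?thesis using 2 ij j by (simp add: levi_embed_index)
  qed (use ij j in \<open>simp_all add: levi_embed_index\<close>)
qed

lemma levi_embed_minus_one:
  fixes g1 :: "'q::field mat"
  assumes 1: "g1 \<in> carrier_mat k k" and 2: "g2 \<in> carrier_mat m m"
  shows "levi_embed n A (g1 - 1\<^sub>m k) (g2 - 1\<^sub>m m) = levi_embed n A g1 g2 - 1\<^sub>m n"
proof (rule eq_matI)
  fix i j assume "i < dim_row (levi_embed n A g1 g2 - 1\<^sub>m n)" "j < dim_col (levi_embed n A g1 g2 - 1\<^sub>m n)"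
  hence ij: "i < n" "j < n" by (simp_all add: levi_embed_def)
  consider "i \<in> A" "j \<in> A" | "i \<notin> A" "j \<notin> A" | "i \<in> A" "j \<notin> A" | "i \<notin> A" "j \<in> A" by blast
  thus "levi_embed n A (g1 - 1\<^sub>m k) (g2 - 1\<^sub>m m) $$ (i, j) = (levi_embed n A g1 g2 - 1\<^sub>m n) $$ (i, j)"
  proof cases
    case 1
    thus ?thesis using ij rank_less1[of i] rank_less1[of j] rank_in_inject(1)[OF finite_complement(1), of i j]
      by (simp add: levi_embed_index)
  next
    case 2
    thus ?thesis using ij rank_less2[of i] rank_less2[of j] rank_in_inject(1)[OF finite_complement(2), of i j]
      by (simp add: levi_embed_index)
  qed (use ij in \<open>auto simp: levi_embed_index\<close>)
qed (simp_all add: levi_embed_def)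

lemma levi_embed_diag:
  fixes g1 :: "'q::field mat"
  shows "i \<in> A \<Longrightarrow> levi_embed n A g1 g2 $$ (i, i) = g1 $$ (rank_in A i, rank_in A i)"
    "i \<in> complement \<Longrightarrow> levi_embed n A g1 g2 $$ (i, i) = g2 $$ (rank_in complement i, rank_in complement i)"
  using A by (auto simp: levi_embed_index)

lemma levi_embed_tri_group:
  fixes g1 :: "'q::field mat"
  assumes 1: "g1 \<in> tri_group k" and 2: "g2 \<in> tri_group m"
  shows "levi_embed n A g1 g2 \<in> tri_group n"
proof -
  have c: "g1 \<in> carrier_mat k k" "upper_triangular g1" "g2 \<in> carrier_mat m m" "upper_triangular g2"
    using 1 2 by (simp_all add: tri_group_iff)
  have "levi_embed n A g1 g2 $$ (i, i) \<noteq> 0" if "i < n" for i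
  proof (cases "i \<in> A")
    case True
    thus ?thesis using 1 rank_less1[of i] by (simp add: levi_embed_diag tri_group_iff)
  next
    case False
    thus ?thesis using 2 rank_less2[of i] that by (simp add: levi_embed_diag tri_group_iff)
  qed
  thus ?thesis
    unfolding tri_group_iff using levi_embed_carrier upper_triangular_levi_embed[OF c] by blast
qed

text \<open>The embedding is multiplicative and compatible with subtracting the identity, so it maps witnesses
  of \<^const>\<open>tri_equiv\<close> to witnesses.\<close>

lemma levi_embed_superclass:
  fixes g1 :: "'q::field mat"
  assumes 1: "g1 \<in> superclass k h1" "h1 \<in> tri_group k" and 2: "g2 \<in> superclass m h2" "h2 \<in> tri_group m"
  shows "levi_embed n A g1 g2 \<in> superclass n (levi_embed n A h1 h2)"
proof -
  have h: "h1 \<in> carrier_mat k k" "h2 \<in> carrier_mat m m" using 1 2 by (simp_all add: tri_group_iff)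
  have g: "g1 \<in> carrier_mat k k" "g2 \<in> carrier_mat m m"
    and e: "tri_equiv k (h1 - 1\<^sub>m k) (g1 - 1\<^sub>m k)" "tri_equiv m (h2 - 1\<^sub>m m) (g2 - 1\<^sub>m m)"
    using 1 2 superclass_iff[OF h(1)] superclass_iff[OF h(2)] by blast+
  obtain A1 B1 where 1: "A1 \<in> carrier_mat k k" "B1 \<in> carrier_mat k k" "upper_triangular A1" "upper_triangular B1"
    "\<forall>i<k. A1 $$ (i, i) = B1 $$ (i, i)" "\<forall>i<k. A1 $$ (i, i) \<noteq> 0" "(g1 - 1\<^sub>m k) * B1 = A1 * (h1 - 1\<^sub>m k)"
    using e(1) unfolding tri_equiv_def by blast
  obtain A2 B2 where 2: "A2 \<in> carrier_mat m m" "B2 \<in> carrier_mat m m" "upper_triangular A2" "upper_triangular B2"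
    "\<forall>i<m. A2 $$ (i, i) = B2 $$ (i, i)" "\<forall>i<m. A2 $$ (i, i) \<noteq> 0" "(g2 - 1\<^sub>m m) * B2 = A2 * (h2 - 1\<^sub>m m)"
    using e(2) unfolding tri_equiv_def by blast
  have mc: "X - 1\<^sub>m l \<in> carrier_mat l l" for X :: "'q mat" and l by (simp add: minus_carrier_mat)
  have eq: "(levi_embed n A g1 g2 - 1\<^sub>m n) * levi_embed n A B1 B2 =
      levi_embed n A A1 A2 * (levi_embed n A h1 h2 - 1\<^sub>m n)"
    unfolding levi_embed_minus_one[OF g, symmetric] levi_embed_minus_one[OF h, symmetric]
      levi_embed_mult[OF mc 1(2) mc 2(2), symmetric] levi_embed_mult[OF 1(1) mc 2(1) mc, symmetric] 1(7) 2(7) ..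
  have "tri_equiv n (levi_embed n A h1 h2 - 1\<^sub>m n) (levi_embed n A g1 g2 - 1\<^sub>m n)"
  proof (rule tri_equivI[OF levi_embed_carrier levi_embed_carrier upper_triangular_levi_embed[OF 1(1,3) 2(1,3)]
        upper_triangular_levi_embed[OF 1(2,4) 2(2,4)] _ _ eq])
    fix i assume i: "i < n"
    have r: "i \<in> A \<Longrightarrow> rank_in A i < k" "i \<notin> A \<Longrightarrow> rank_in complement i < m" using rank_less1[of i] rank_less2[of i] i by auto
    show "levi_embed n A A1 A2 $$ (i, i) = levi_embed n A B1 B2 $$ (i, i)"
      using 1(5) 2(5) r i by (cases "i \<in> A") (simp_all add: levi_embed_diag)
    show "levi_embed n A A1 A2 $$ (i, i) \<noteq> 0"
      using 1(6) 2(6) r i by (cases "i \<in> A") (simp_all add: levi_embed_diag)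
  qed
  thus ?thesis unfolding superclass_iff[OF levi_embed_carrier] using levi_embed_carrier by blast
qed

lemma levi_embed_in_levi_group:
  fixes g1 :: "'q::field mat"
  assumes "g1 \<in> tri_group k" "g2 \<in> tri_group m"
  shows "levi_embed n A g1 g2 \<in> levi_group n A complement"
proof -
  have "(i \<in> A \<and> j \<in> A) \<or> (i \<in> complement \<and> j \<in> complement)"
    if "i < n" "j < n" "levi_embed n A g1 g2 $$ (i, j) \<noteq> 0" for i j
    using that by (cases "i \<in> A"; cases "j \<in> A") (simp_all add: levi_embed_index)
  thus ?thesis using levi_embed_tri_group[OF assms] unfolding levi_group_def by blast
qed

lemma levi_iso_embed:
  assumes 1: "g1 \<in> carrier_mat k k" and 2: "g2 \<in> carrier_mat m m"
  shows "levi_iso A complement (levi_embed n A g1 g2) = (g1, g2)"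
proof -
  have e: "{i. i < n \<and> i \<in> A} = A" "{i. i < n \<and> i \<in> complement} = complement" using A by auto
  have "submatrix (levi_embed n A g1 g2) A A = g1"
  proof (rule eq_matI)
    fix i j assume "i < dim_row g1" "j < dim_col g1"
    hence ij: "i < card A" "j < card A" using 1 k by auto
    have p: "pick A i \<in> A" "pick A j \<in> A" "pick A i < n" "pick A j < n"
      using ij A pick_in_set_le by blast+
    have "submatrix (levi_embed n A g1 g2) A A $$ (i, j) = levi_embed n A g1 g2 $$ (pick A i, pick A j)"
      using ij e by (subst submatrix_index) (simp_all add: levi_embed_def)
    thus "submatrix (levi_embed n A g1 g2) A A $$ (i, j) = g1 $$ (i, j)"
      using p ij by (simp add: levi_embed_index card_pick_le)
  qed (use 1 k e in \<open>simp_all add: dim_submatrix levi_embed_def\<close>)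
  moreover have "submatrix (levi_embed n A g1 g2) complement complement = g2"
  proof (rule eq_matI)
    fix i j assume "i < dim_row g2" "j < dim_col g2"
    hence ij: "i < card complement" "j < card complement" using 2 card_complement by auto
    have p: "pick complement i \<in> complement" "pick complement j \<in> complement"
      using ij pick_in_set_le by blast+
    hence p': "pick complement i \<notin> A" "pick complement j \<notin> A" "pick complement i < n" "pick complement j < n" by auto
    have "submatrix (levi_embed n A g1 g2) complement complement $$ (i, j) = levi_embed n A g1 g2 $$ (pick complement i, pick complement j)"
      using ij e by (subst submatrix_index) (simp_all add: levi_embed_def)
    also have "\<dots> = g2 $$ (rank_in complement (pick complement i), rank_in complement (pick complement j))"
      using p' by (simp add: levi_embed_index)
    also have "\<dots> = g2 $$ (i, j)"
      using card_pick_le[OF ij(1)] card_pick_le[OF ij(2)] by simp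
    finally show "submatrix (levi_embed n A g1 g2) complement complement $$ (i, j) = g2 $$ (i, j)" .
  qed (use 2 card_complement e in \<open>simp_all add: dim_submatrix levi_embed_def\<close>)
  ultimately show ?thesis by (simp add: levi_iso_def)
qed

lemma inj_on_levi_iso: "inj_on (levi_iso A complement) (levi_group n A complement :: 'q::field mat set)"
proof (rule inj_onI)
  fix g h :: "'q mat" assume g: "g \<in> levi_group n A complement" and h: "h \<in> levi_group n A complement"
    and eq: "levi_iso A complement g = levi_iso A complement h"
  have c: "g \<in> carrier_mat n n" "h \<in> carrier_mat n n"
    using g h by (simp_all add: levi_group_def tri_group_iff)
  show "g = h"
  proof (rule eq_matI)
    fix i j assume "i < dim_row h" "j < dim_col h"
    hence ij: "i < n" "j < n" using c by auto
    consider "i \<in> A" "j \<in> A" | "i \<in> complement" "j \<in> complement" | "\<not> ((i \<in> A \<and> j \<in> A) \<or> (i \<in> complement \<and> j \<in> complement))" by blast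
    thus "g $$ (i, j) = h $$ (i, j)"
    proof cases
      case 1
      thus ?thesis
        using submatrix_index_card[of i g j A A] submatrix_index_card[of i h j A A] ij c eq
        by (simp add: levi_iso_def)
    next
      case 2
      thus ?thesis
        using submatrix_index_card[of i g j complement complement] submatrix_index_card[of i h j complement complement] ij c eq
        by (simp add: levi_iso_def)
    next
      case 3
      hence "g $$ (i, j) = 0" "h $$ (i, j) = 0"
        using g h ij unfolding levi_group_def by blast+
      thus ?thesis by simp
    qed
  qed (use c in auto)
qed

lemma TRes_eq:
  fixes g1 :: "'q::field mat"
  assumes "g1 \<in> tri_group k" "g2 \<in> tri_group m"
  shows "TRes n A complement \<chi> (g1, g2) = \<chi> (levi_embed n A g1 g2)"
proof -
  have c: "g1 \<in> carrier_mat k k" "g2 \<in> carrier_mat m m" using assms by (simp_all add: tri_group_iff)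
  have "the_inv_into (levi_group n A complement) (levi_iso A complement) (g1, g2) = levi_embed n A g1 g2"
    using the_inv_into_f_f[OF inj_on_levi_iso levi_embed_in_levi_group[OF assms]] levi_iso_embed[OF c] by simp
  moreover have "(g1, g2) \<in> tri_group (card A) \<times> tri_group (card complement)"
    unfolding k card_complement using assms by simp
  ultimately show ?thesis unfolding TRes_def by simp
qed

end

section \<open>Word matrices: rigged partitions, renaming and shuffles\<close>

text \<open>Consecutive occurrences of an \<open>X\<close>-letter are adjacent elements of a block of the type.\<close>

lemma word_mat_eq_rigged:
  assumes n: "n = length w"
  shows "word_mat u w = rig_mat u n (word_type w) + arc_mat n (fst (word_type w))"
proof (rule eq_matI)
  let ?P = "word_type w"
  have arcs: "(i, j) \<in> arcs (fst ?P) \<longleftrightarrow> word_arc w i j" for i j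
  proof
    assume "(i, j) \<in> arcs (fst ?P)"
    then obtain B where ij: "i < j" and B: "B \<in> fst ?P" "i \<in> B" "j \<in> B" "\<forall>k\<in>B. \<not> (i < k \<and> k < j)"
      by (auto simp: arcs_def)
    then obtain x where x: "B = {k\<in>{..<length w}. w ! k = Xvar x}"
      unfolding fst_letter_type by blast
    have i: "w ! i = Xvar x" and j: "j < length w" "w ! j = Xvar x" using B x by simp_all
    have "w ! k \<noteq> Xvar x" if "i < k" "k < j" for k
    proof
      assume "w ! k = Xvar x"
      hence "k \<in> B" using x that j by simp
      with B(4) that show False by blast
    qed
    thus "word_arc w i j" using ij i j by (simp add: word_arc_def)
  next
    assume arc: "word_arc w i j"
    hence "w ! i \<in> range Xvar" unfolding word_arc_def by (elim conjE)
    then obtain x where x: "w ! i = Xvar x" by blast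
    let ?B = "{k\<in>{..<length w}. w ! k = Xvar x}"
    have B: "i \<in> ?B" "j \<in> ?B" "\<forall>k\<in>?B. \<not> (i < k \<and> k < j)"
      using arc x by (auto simp: word_arc_def)
    hence mem: "?B \<in> fst ?P" unfolding fst_letter_type by blast
    show "(i, j) \<in> arcs (fst ?P)"
      unfolding arcs_def mem_Collect_eq prod.case
      by (intro conjI word_arc_less[OF arc] bexI[OF _ mem] B)
  qed
  fix i j assume "i < dim_row (rig_mat u n ?P + arc_mat n (fst ?P))" "j < dim_col (rig_mat u n ?P + arc_mat n (fst ?P))"
  hence ij: "i < n" "j < n" by (simp_all add: arc_mat_def)
  show "word_mat u w $$ (i, j) = (rig_mat u n ?P + arc_mat n (fst ?P)) $$ (i, j)"
  proof (cases "i = j")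
    case True
    have no: "\<not> word_arc w i i" by (auto simp: word_arc_def)
    have "i \<in> supp ?P \<longleftrightarrow> w ! i \<in> range Xvar" using ij n by (simp add: supp_letter_type)
    moreover have "snd ?P i = Some c" if "w ! i = Yvar c" for c
      using that ij n by (simp add: snd_letter_type)
    ultimately show ?thesis
      using ij n True no arcs by (cases "w ! i") (auto simp: word_mat_index word_entry_def rig_mat_def arc_mat_def)
  next
    case False
    thus ?thesis using ij n arcs by (simp add: word_mat_index word_entry_def rig_mat_def arc_mat_def)
  qed
qed (use n in \<open>simp_all add: arc_mat_def\<close>)

lemma word_mat_cong_type:
  assumes "length w = length w'" "word_type w = word_type w'"
  shows "word_mat u w = word_mat u w'"
  using word_mat_eq_rigged[of "length w" w u] word_mat_eq_rigged[of "length w" w' u] assms by simp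

lemma word_mat_rename: "inj \<rho> \<Longrightarrow> word_mat u (map (act_var \<rho>) w) = word_mat u w"
  by (rule word_mat_cong_type) (simp, rule word_type_rename)

lemma word_mat_evens: "word_mat u (evens w) = word_mat u w"
  and word_mat_odds: "word_mat u (odds w) = word_mat u w"
  unfolding evens_def odds_def by (rule word_mat_rename, rule inj_evens inj_odds)+

text \<open>Here \<open>x\<close> is the subword of \<open>z\<close> at the positions \<open>C\<close>. The letters of \<open>z\<close> between two positions in \<open>C\<close> but
  outside \<open>C\<close> do not interrupt an arc, since they are different \<open>X\<close>-letters.\<close>

lemma word_arc_restrict:
  assumes C: "C \<subseteq> {..<length z}" and len: "length x = card C"
    and zx: "\<And>i. i \<in> C \<Longrightarrow> z ! i = x ! rank_in C i"
    and sep: "\<And>i j. i \<in> C \<Longrightarrow> j < length z \<Longrightarrow> j \<notin> C \<Longrightarrow> z ! i = z ! j \<Longrightarrow> z ! i \<in> range Yvar"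
    and ij: "i \<in> C" "j \<in> C"
  shows "word_arc z i j \<longleftrightarrow> word_arc x (rank_in C i) (rank_in C j)"
proof -
  let ?r = "\<lambda>i. rank_in C i"
  have fin: "finite C" using C by (rule finite_subset) simp
  have less: "?r i < ?r j \<longleftrightarrow> i < j" if "i \<in> C" "j \<in> C" for i j
    by (rule rank_in_inject(2)[OF fin that])
  have bounds: "j < length z" "?r j < length x"
    using C ij rank_in_less_card[OF fin ij(2)] len by auto
  have between: "(\<forall>k. i < k \<and> k < j \<longrightarrow> z ! k \<noteq> z ! i) \<longleftrightarrow>
      (\<forall>k. ?r i < k \<and> k < ?r j \<longrightarrow> x ! k \<noteq> x ! ?r i)" if X: "z ! i \<in> range Xvar"
  proof (intro iffI allI impI; elim conjE)
    fix k assume none: "\<forall>k. i < k \<and> k < j \<longrightarrow> z ! k \<noteq> z ! i" and k: "?r i < k" "k < ?r j"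
    hence "k < card C" using bounds len by simp
    hence p: "pick C k \<in> C" "?r (pick C k) = k" by (simp_all add: pick_in_set_le card_pick_le)
    hence "i < pick C k" "pick C k < j" using k less[of i "pick C k"] less[of "pick C k" j] ij by simp_all
    with none have "z ! pick C k \<noteq> z ! i" by blast
    thus "x ! k \<noteq> x ! ?r i" using zx[OF p(1)] zx[OF ij(1)] p(2) by simp
  next
    fix k assume none: "\<forall>k. ?r i < k \<and> k < ?r j \<longrightarrow> x ! k \<noteq> x ! ?r i" and k: "i < k" "k < j"
    show "z ! k \<noteq> z ! i"
    proof (cases "k \<in> C")
      case True
      hence "?r i < ?r k" "?r k < ?r j" using k less ij by simp_all
      with none have "x ! ?r k \<noteq> x ! ?r i" by blast
      thus ?thesis using zx[OF True] zx[OF ij(1)] by simp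
    next
      case False
      have "z ! i \<notin> range Yvar" using X range_Xvar_Yvar(1) by blast
      thus ?thesis using sep[OF ij(1) _ False] k bounds by auto
    qed
  qed
  show ?thesis
    unfolding word_arc_def
    using less[OF ij] bounds between zx[OF ij(1)] zx[OF ij(2)] by auto
qed

lemma levi_embed_word_mat:
  assumes A: "A \<in> subsets_of_card (length v1 + length v2) (length v1)"
  shows "levi_embed (length v1 + length v2) A (word_mat u v1) (word_mat u v2) =
    word_mat u (weave A (evens v1) (odds v2))" (is "_ = word_mat u ?sh")
proof (rule eq_matI)
  let ?n = "length v1 + length v2"
  let ?B = "{..<?n} - A"
  note pos = positions[OF A] and card_B = card_other_positions[OF A] and sh_nth1 = shuffled_nth1[OF A]
    and sh_nth2 = shuffled_nth2[OF A] and length_sh = length_shuffled[OF A]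
  have finB: "finite ?B" by simp
  note ind = levi_embed_index[OF pos(1,2) refl]
  fix i j assume "i < dim_row (word_mat u ?sh)" "j < dim_col (word_mat u ?sh)"
  hence ij: "i < ?n" "j < ?n" by (simp_all add: length_sh)
  have sep: "?sh ! i \<in> range Yvar" if "i \<in> A" "j \<in> ?B" "?sh ! i = ?sh ! j" for i j
    using shuffled_separated[OF A that] .
  have rhs: "word_mat u ?sh $$ (i, j) = (if i = j then 1 else 0) + word_entry u ?sh i j"
    using ij by (intro word_mat_index) (simp_all add: length_sh)
  consider "i \<in> A" "j \<in> A" | "i \<in> ?B" "j \<in> ?B" | "i \<in> A" "j \<in> ?B" | "i \<in> ?B" "j \<in> A" using ij by blast
  thus "levi_embed ?n A (word_mat u v1) (word_mat u v2) $$ (i, j) = word_mat u ?sh $$ (i, j)"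
  proof cases
    case 1
    let ?r = "\<lambda>i. rank_in A i"
    have r: "?r i < length (evens v1)" "?r j < length (evens v1)" "?r i = ?r j \<longleftrightarrow> i = j"
      using rank_in_less_card[OF pos(3) 1(1)] rank_in_less_card[OF pos(3) 1(2)]
        rank_in_inject(1)[OF pos(3) 1] pos by simp_all
    have "word_arc ?sh i j \<longleftrightarrow> word_arc (evens v1) (?r i) (?r j)"
      using pos sh_nth1 sep 1 by (intro word_arc_restrict) (simp_all add: length_sh)
    hence "word_entry u (evens v1) (?r i) (?r j) = word_entry u ?sh i j"
      using r(3) sh_nth1[OF 1(1)] sh_nth1[OF 1(2)] by (cases "i = j") (simp_all add: word_entry_def)
    hence "word_mat u (evens v1) $$ (?r i, ?r j) = word_mat u ?sh $$ (i, j)"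
      unfolding rhs word_mat_index[OF r(1,2)] using r(3) by simp
    thus ?thesis using ind(1)[OF ij 1, of "word_mat u v1" "word_mat u v2"] by (simp add: word_mat_evens)
  next
    case 2
    let ?r = "\<lambda>i. rank_in ?B i"
    have r: "?r i < length (odds v2)" "?r j < length (odds v2)" "?r i = ?r j \<longleftrightarrow> i = j"
      using rank_in_less_card[OF finB 2(1)] rank_in_less_card[OF finB 2(2)]
        rank_in_inject(1)[OF finB 2] card_B by simp_all
    have "word_arc ?sh i j \<longleftrightarrow> word_arc (odds v2) (?r i) (?r j)"
    proof (rule word_arc_restrict[OF _ _ _ _ 2])
      fix i j assume "i \<in> ?B" "j < length ?sh" "j \<notin> ?B" "?sh ! i = ?sh ! j"
      thus "?sh ! i \<in> range Yvar" using sep[of j i] by (simp add: length_sh)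
    qed (use card_B sh_nth2 in \<open>auto simp: length_sh\<close>)
    hence "word_entry u (odds v2) (?r i) (?r j) = word_entry u ?sh i j"
      using r(3) sh_nth2[OF 2(1)] sh_nth2[OF 2(2)] by (cases "i = j") (simp_all add: word_entry_def)
    hence "word_mat u (odds v2) $$ (?r i, ?r j) = word_mat u ?sh $$ (i, j)"
      unfolding rhs word_mat_index[OF r(1,2)] using r(3) by simp
    thus ?thesis using ind(2)[OF ij, of "word_mat u v1" "word_mat u v2"] 2 by (simp add: word_mat_odds)
  next
    case 3
    have "\<not> word_arc ?sh i j"
      using sep[OF 3] range_Xvar_Yvar(1) unfolding word_arc_def by blast
    thus ?thesis unfolding rhs using ind(3)[OF ij, of "word_mat u v1" "word_mat u v2"] 3 by (auto simp: word_entry_def)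
  next
    case 4
    have "\<not> word_arc ?sh i j"
      using sep[OF 4(2,1)] range_Xvar_Yvar(1) unfolding word_arc_def by (metis disjoint_iff)
    thus ?thesis unfolding rhs using ind(4)[OF ij, of "word_mat u v1" "word_mat u v2"] 4 by (auto simp: word_entry_def)
  qed
qed (simp_all add: levi_embed_def length_weave)

section \<open>Superclass functions\<close>

lemma superclass_tri_group:
  fixes g :: "'q::field mat"
  assumes g: "g \<in> tri_group n" and h: "h \<in> superclass n g"
  shows "h \<in> tri_group n"
proof -
  have c: "g \<in> carrier_mat n n" "upper_triangular g" "\<forall>i<n. g $$ (i, i) \<noteq> 0"
    using g by (simp_all add: tri_group_iff)
  have hc: "h \<in> carrier_mat n n" and e: "tri_equiv n (g - 1\<^sub>m n) (h - 1\<^sub>m n)"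
    using h superclass_iff[OF c(1)] by blast+
  have m: "X - 1\<^sub>m n \<in> carrier_mat n n" for X :: "'q mat" by (simp add: minus_carrier_mat)
  have up: "upper_triangular (h - 1\<^sub>m n)"
    by (rule tri_equiv_upper_triangular[OF m upper_triangular_minus_one[OF c(1,2)] m e])
  have diag: "h $$ (i, i) = g $$ (i, i)" if "i < n" for i
    using tri_equiv_diag[OF m upper_triangular_minus_one[OF c(1,2)] m up e that] that c hc by simp
  have "upper_triangular h"
  proof (rule upper_triangular_carrierI[OF hc])
    fix i j assume "i < n" "j < i"
    thus "h $$ (i, j) = 0" using upper_triangular_zero[OF up m, of j i] hc by simp
  qed
  thus ?thesis using hc diag c(3) by (simp add: tri_group_iff)
qed

lemma superclass_refl: "g \<in> tri_group n \<Longrightarrow> g \<in> superclass n g" for g :: "'q::field mat"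
  by (simp add: superclass_iff tri_group_iff tri_equiv_refl minus_carrier_mat)

lemma superclass_sym:
  fixes g :: "'q::field mat"
  assumes "g \<in> tri_group n" "h \<in> superclass n g"
  shows "g \<in> superclass n h"
proof -
  have c: "g \<in> carrier_mat n n" "h \<in> carrier_mat n n"
    using assms superclass_tri_group[OF assms] by (simp_all add: tri_group_iff)
  have m: "X - 1\<^sub>m n \<in> carrier_mat n n" for X :: "'q mat" by (simp add: minus_carrier_mat)
  show ?thesis
    using assms(2) tri_equiv_sym[OF m m] c unfolding superclass_iff[OF c(1)] superclass_iff[OF c(2)] by blast
qed

lemma superclass_trans:
  fixes g :: "'q::field mat"
  assumes "g \<in> tri_group n" "h \<in> superclass n g" "k \<in> superclass n h"
  shows "k \<in> superclass n g"
proof -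
  have c: "g \<in> carrier_mat n n" "h \<in> carrier_mat n n"
    using assms superclass_tri_group[OF assms(1,2)] by (simp_all add: tri_group_iff)
  have m: "X - 1\<^sub>m n \<in> carrier_mat n n" for X :: "'q mat" by (simp add: minus_carrier_mat)
  show ?thesis
    using assms(2,3) tri_equiv_trans[OF m m m] unfolding superclass_iff[OF c(1)] superclass_iff[OF c(2)] by blast
qed

abbreviation tri_groups :: "'q::field mat set" where
  "tri_groups \<equiv> \<Union>n. tri_group n"

lemma tri_groups_iff: "g \<in> tri_groups \<longleftrightarrow> g \<in> tri_group (dim_row g)"
proof
  assume "g \<in> tri_groups"
  then obtain n where "g \<in> tri_group n" by blast
  thus "g \<in> tri_group (dim_row g)" by (auto simp: tri_group_def)
qed blast

lemma tri_group_dim: "g \<in> tri_group n \<Longrightarrow> dim_row g = n"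
  by (auto simp: tri_group_def)

text \<open>The supports of the homogeneous components of \<open>f\<close> are disjoint, so each component is the restriction
  of \<open>f\<close> to the matrices of one size.\<close>

lemma SCB_space_iff:
  "f \<in> SCB_space \<longleftrightarrow> (\<forall>g. g \<notin> tri_groups \<longrightarrow> f g = 0) \<and> (\<exists>N. \<forall>g. dim_row g > N \<longrightarrow> f g = 0) \<and>
     (\<forall>n. \<forall>g\<in>tri_group n. \<forall>h\<in>superclass n g. f h = f g)"
  for f :: "'q::field mat \<Rightarrow> complex"
proof -
  let ?V = "{f :: 'q mat \<Rightarrow> complex. (\<forall>g. g \<notin> tri_groups \<longrightarrow> f g = 0) \<and> (\<exists>N. \<forall>g. dim_row g > N \<longrightarrow> f g = 0) \<and>
     (\<forall>n. \<forall>g\<in>tri_group n. \<forall>h\<in>superclass n g. f h = f g)}"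
  have sub: "fvs.subspace ?V"
  proof (rule fvs.subspaceI)
    fix a b assume a: "a \<in> ?V" and b: "b \<in> ?V"
    obtain N M where "\<forall>g. dim_row g > N \<longrightarrow> a g = 0" "\<forall>g. dim_row g > M \<longrightarrow> b g = 0"
      using a b by blast
    hence "\<exists>N. \<forall>g. dim_row g > N \<longrightarrow> (a + b) g = 0" by (intro exI[of _ "max N M"]) simp
    with a b show "a + b \<in> ?V" by simp
  qed (auto simp: fscale_apply)
  have "(\<Union>n. SCB_deg n) \<subseteq> ?V"
  proof clarify
    fix n and a :: "'q mat \<Rightarrow> complex" assume a: "a \<in> SCB_deg n"
    hence z: "a g = 0" if "g \<notin> tri_group n" for g using that by (simp add: SCB_deg_def)
    have "\<exists>N. \<forall>g. dim_row g > N \<longrightarrow> a g = 0"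
      by (intro exI[of _ n]) (use z tri_group_dim in force)
    moreover have "a h = a g" if g: "g \<in> tri_group m" and h: "h \<in> superclass m g" for m g h
    proof (cases "m = n")
      case True
      thus ?thesis using a g h by (simp add: SCB_deg_def)
    next
      case False
      hence "g \<notin> tri_group n" "h \<notin> tri_group n"
        using tri_group_dim[OF g] tri_group_dim[OF superclass_tri_group[OF g h]] tri_group_dim by metis+
      thus ?thesis by (simp add: z)
    qed
    ultimately show "(\<forall>g. g \<notin> tri_groups \<longrightarrow> a g = 0) \<and> (\<exists>N. \<forall>g. N < dim_row g \<longrightarrow> a g = 0) \<and>
      (\<forall>n. \<forall>g\<in>tri_group n. \<forall>h\<in>superclass n g. a h = a g)" using z by blast
  qed
  hence 1: "SCB_space \<subseteq> ?V" unfolding SCB_space_def by (rule fvs.span_minimal[OF _ sub])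
  have 2: "f \<in> SCB_space" if f: "f \<in> ?V" for f
  proof -
    obtain N where N: "\<forall>g. dim_row g > N \<longrightarrow> f g = 0" using f by blast
    define c where "c n g = (if g \<in> tri_group n then f g else 0)" for n g
    have "f g = (\<Sum>n\<le>N. c n g)" for g
    proof (cases "g \<in> tri_groups")
      case True
      have "(\<Sum>n\<le>N. c n g) = (\<Sum>n\<le>N. if n = dim_row g then f g else 0)"
        by (rule sum.cong[OF refl]) (use True tri_group_dim in \<open>auto simp: c_def tri_groups_iff\<close>)
      thus ?thesis using N by simp
    next
      case False
      hence "c n g = 0" for n by (auto simp: c_def)
      thus ?thesis using False f by simp
    qed
    hence "f = (\<Sum>n\<le>N. c n)" by (simp add: fun_eq_iff sum_fun_apply)
    moreover have "c n \<in> SCB_deg n" for n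
      using f superclass_tri_group by (auto simp: SCB_deg_def c_def)
    hence "(\<Sum>n\<le>N. c n) \<in> SCB_space"
      unfolding SCB_space_def by (intro fvs.span_sum fvs.span_base) blast
    ultimately show ?thesis by simp
  qed
  have "f \<in> SCB_space \<longleftrightarrow> f \<in> ?V" by (rule iffI[OF subsetD[OF 1] 2])
  thus ?thesis by (simp only: mem_Collect_eq)
qed

lemma SCB_spaceD:
  assumes "f \<in> SCB_space"
  shows "g \<notin> tri_groups \<Longrightarrow> f g = 0" "\<exists>N. \<forall>g. dim_row g > N \<longrightarrow> f g = 0"
    "g \<in> tri_group n \<Longrightarrow> h \<in> superclass n g \<Longrightarrow> f h = f g"
  using assms unfolding SCB_space_iff by blast+

lemma subspace_SCB_space: "fvs.subspace SCB_space"
  unfolding SCB_space_def by (rule fvs.subspace_span)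

lemma SCB_simps [simp]:
  "hspace SCB = SCB_space" "hmult SCB = SCB_mult" "hunit SCB = SCB_unit"
  "hcomult SCB = SCB_comult" "hcounit SCB = SCB_counit"
  by (simp_all add: SCB_def)

section \<open>The isomorphism\<close>

lemma renaming_invariant_type:
  assumes "renaming_invariant f" "length w = length w'" "word_type w = word_type w'"
  shows "f w = f w'"
proof -
  obtain \<sigma> where "finite_perm \<sigma>" "w' = map (act_var \<sigma>) w" using word_type_eqD[OF assms(2,3)] .
  thus ?thesis using renaming_invariantD[OF assms(1) inj_finite_perm] by simp
qed

context
  fixes u :: "nat \<Rightarrow> 'q::field" and r :: nat
  assumes u: "bij_betw u {..<r} (UNIV - {0, 1})"
begin

text \<open>This is the isomorphism, described by the coefficients of the power series that it assigns to \<open>f\<close>.\<close>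

definition coeff_fun :: "('q mat \<Rightarrow> complex) \<Rightarrow> nc_var list \<Rightarrow> complex" where
  "coeff_fun f = (\<lambda>w. if w \<in> var_words r then f (word_mat u w) else 0)"

definition normal_word :: "'q mat \<Rightarrow> nc_var list" where
  "normal_word g = (SOME w. length w = dim_row g \<and> w \<in> var_words r \<and>
     g \<in> superclass (dim_row g) (word_mat u w))"

lemma word_mat_tri: "w \<in> var_words r \<Longrightarrow> word_mat u w \<in> tri_group (length w)"
  by (rule word_mat_tri_group[OF u])

lemma normal_word:
  assumes g: "g \<in> tri_group n"
  shows "length (normal_word g) = n" "normal_word g \<in> var_words r"
    "g \<in> superclass n (word_mat u (normal_word g))"
proof -
  have n: "dim_row g = n" by (rule tri_group_dim[OF g])
  have "\<exists>w. length w = n \<and> w \<in> var_words r \<and> g \<in> superclass n (word_mat u w)"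
    by (rule word_normal_form[OF u g]) blast
  hence "length (normal_word g) = n \<and> normal_word g \<in> var_words r \<and>
      g \<in> superclass n (word_mat u (normal_word g))"
    unfolding normal_word_def n by (rule someI_ex)
  thus "length (normal_word g) = n" "normal_word g \<in> var_words r"
    "g \<in> superclass n (word_mat u (normal_word g))" by blast+
qed

lemma superclass_word_type:
  assumes w: "w \<in> var_words r" "w' \<in> var_words r" and len: "length w = n" "length w' = n"
    and s: "word_mat u w \<in> superclass n (word_mat u w')"
  shows "word_type w = word_type w'"
proof -
  have "tri_equiv n (word_rook u w') (word_rook u w)"
    using s superclass_iff[of "word_mat u w'" n] word_mat_carrier[of u w'] len
      word_mat_minus_one[of u w] word_mat_minus_one[of u w'] by simp
  thus ?thesis using tri_equiv_word_rook_imp_type[OF u w(2,1)] len by simp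
qed

lemma superclass_normal_word:
  assumes g: "g \<in> tri_group n" and h: "h \<in> superclass n g"
  shows "word_type (normal_word g) = word_type (normal_word h)"
proof -
  have h': "h \<in> tri_group n" by (rule superclass_tri_group[OF g h])
  have t: "word_mat u (normal_word g) \<in> tri_group n" "word_mat u (normal_word h) \<in> tri_group n"
    using word_mat_tri[OF normal_word(2)[OF g]] word_mat_tri[OF normal_word(2)[OF h']]
      normal_word(1)[OF g] normal_word(1)[OF h'] by simp_all
  have "h \<in> superclass n (word_mat u (normal_word g))"
    by (rule superclass_trans[OF t(1) normal_word(3)[OF g] h])
  moreover have "word_mat u (normal_word h) \<in> superclass n h"
    by (rule superclass_sym[OF t(2) normal_word(3)[OF h']])
  ultimately have "word_mat u (normal_word h) \<in> superclass n (word_mat u (normal_word g))"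
    by (rule superclass_trans[OF t(1)])
  from superclass_word_type[OF normal_word(2)[OF h'] normal_word(2)[OF g] normal_word(1)[OF h'] normal_word(1)[OF g] this]
  show ?thesis by simp
qed

lemma normal_word_word_mat:
  assumes w: "w \<in> var_words r"
  shows "word_type (normal_word (word_mat u w)) = word_type w" "length (normal_word (word_mat u w)) = length w"
proof -
  note t = word_mat_tri[OF w]
  show "length (normal_word (word_mat u w)) = length w" by (rule normal_word(1)[OF t])
  show "word_type (normal_word (word_mat u w)) = word_type w"
    using superclass_word_type[OF w normal_word(2)[OF t] refl normal_word(1)[OF t] normal_word(3)[OF t]] by simp
qed

lemma SCB_normal_word:
  assumes f: "f \<in> SCB_space" and g: "g \<in> tri_group n"
  shows "f g = coeff_fun f (normal_word g)"
proof -
  have "word_mat u (normal_word g) \<in> tri_group n"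
    using word_mat_tri[OF normal_word(2)[OF g]] normal_word(1)[OF g] by simp
  from SCB_spaceD(3)[OF f this normal_word(3)[OF g]] show ?thesis
    using normal_word(2)[OF g] by (simp add: coeff_fun_def)
qed

lemma coeff_fun_in_NPS:
  assumes f: "f \<in> SCB_space"
  shows "coeff_fun f \<in> NPS_space r"
proof -
  obtain N where "\<forall>g. dim_row g > N \<longrightarrow> f g = 0" using SCB_spaceD(2)[OF f] by blast
  hence "\<exists>N. \<forall>w. length w > N \<longrightarrow> coeff_fun f w = 0"
    by (intro exI[of _ N]) (simp add: coeff_fun_def)
  moreover have "renaming_invariant (coeff_fun f)"
    unfolding renaming_invariant_def coeff_fun_def map_act_var_in_words
    by (simp add: word_mat_rename)
  moreover have "coeff_fun f w = 0" if "w \<notin> var_words r" for w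
    unfolding coeff_fun_def using that by (rule if_not_P)
  ultimately show ?thesis unfolding NPS_space_iff by blast
qed

lemma coeff_fun_inverse:
  assumes f: "f \<in> SCB_space"
  shows "f = pull tri_groups normal_word (coeff_fun f)"
proof
  fix g show "f g = pull tri_groups normal_word (coeff_fun f) g"
  proof (cases "g \<in> tri_groups")
    case True
    hence "g \<in> tri_group (dim_row g)" by (simp only: tri_groups_iff)
    from SCB_normal_word[OF f this] show ?thesis using True by (simp add: pull_def)
  next
    case False
    thus ?thesis using SCB_spaceD(1)[OF f False] by (simp add: pull_def)
  qed
qed

lemma pull_in_SCB:
  assumes h: "h \<in> NPS_space r"
  shows "pull tri_groups normal_word h \<in> SCB_space" "coeff_fun (pull tri_groups normal_word h) = h"
proof -
  note inv = NPS_spaceD(2)[OF h]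
  obtain N where N: "\<forall>w. length w > N \<longrightarrow> h w = 0" using NPS_spaceD(3)[OF h] by blast
  have "pull tri_groups normal_word h g = 0" if "dim_row g > N" for g
  proof (cases "g \<in> tri_groups")
    case True
    hence "g \<in> tri_group (dim_row g)" by (simp only: tri_groups_iff)
    thus ?thesis using N normal_word(1) that by (simp add: pull_def)
  qed (simp add: pull_def)
  moreover have "pull tri_groups normal_word h g' = pull tri_groups normal_word h g"
    if g: "g \<in> tri_group n" and g': "g' \<in> superclass n g" for n g g'
  proof -
    have t: "g' \<in> tri_group n" by (rule superclass_tri_group[OF g g'])
    have "h (normal_word g) = h (normal_word g')"
      by (rule renaming_invariant_type[OF inv _ superclass_normal_word[OF g g']])
         (simp add: normal_word(1)[OF g] normal_word(1)[OF t])
    moreover have "g \<in> tri_groups" "g' \<in> tri_groups" using g t by blast+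
    ultimately show ?thesis by (simp add: pull_def)
  qed
  moreover have "pull tri_groups normal_word h g = 0" if "g \<notin> tri_groups" for g
    using that by (simp add: pull_def)
  ultimately show "pull tri_groups normal_word h \<in> SCB_space"
    unfolding SCB_space_iff by blast
  show "coeff_fun (pull tri_groups normal_word h) = h"
  proof
    fix w show "coeff_fun (pull tri_groups normal_word h) w = h w"
    proof (cases "w \<in> var_words r")
      case True
      have "h (normal_word (word_mat u w)) = h w"
        by (rule renaming_invariant_type[OF inv normal_word_word_mat(2,1)[OF True]])
      moreover have "word_mat u w \<in> tri_groups" using word_mat_tri[OF True] by blast
      ultimately show ?thesis using True by (simp add: coeff_fun_def pull_def)
    next
      case False
      thus ?thesis using NPS_spaceD(1)[OF h False] by (simp add: coeff_fun_def)
    qed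
  qed
qed

lemma coeff_fun_linear: "linear_on SCB_space (NPS_space r) coeff_fun"
  by (rule linear_onI[OF coeff_fun_in_NPS]) (auto simp: coeff_fun_def fscale_def)

lemma coeff_fun_bij: "bij_betw coeff_fun SCB_space (NPS_space r)"
proof (rule bij_betwI[of _ _ _ "pull tri_groups normal_word"])
  show "coeff_fun \<in> SCB_space \<rightarrow> NPS_space r" using coeff_fun_in_NPS by blast
  show "pull tri_groups normal_word \<in> NPS_space r \<rightarrow> SCB_space" using pull_in_SCB(1) by blast
qed (simp_all add: coeff_fun_inverse[symmetric] pull_in_SCB(2))

lemma coeff_fun_word: "w \<in> var_words r \<Longrightarrow> f (word_mat u w) = coeff_fun f w"
  unfolding coeff_fun_def by simp

lemma take_drop_in_words:
  assumes "w \<in> var_words r"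
  shows "take k w \<in> var_words r" "drop k w \<in> var_words r"
  using assms set_take_subset[of k w] set_drop_subset[of k w] by blast+

text \<open>The diagonal blocks of the matrix of a word are the matrices of its prefix and suffix, so
  inflation becomes concatenation.\<close>

lemma SCB_mult_transport:
  assumes x: "x \<in> SCB_space" and y: "y \<in> SCB_space"
  shows "SCB_mult x y = pull tri_groups normal_word (NPS_mult (coeff_fun x) (coeff_fun y))"
proof
  fix g :: "'q mat"
  let ?n = "dim_row g"
  show "SCB_mult x y g = pull tri_groups normal_word (NPS_mult (coeff_fun x) (coeff_fun y)) g"
  proof (cases "g \<in> tri_groups")
    case False
    hence "inflation k (?n - k) x y g = 0" if "k \<le> ?n" for k
      using that by (auto simp: inflation_def)
    thus ?thesis using False by (simp add: SCB_mult_def pull_def)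
  next
    case True
    hence g: "g \<in> tri_group ?n" by (simp only: tri_groups_iff)
    define w where "w = normal_word g"
    note w = normal_word[OF g, folded w_def]
    have wt: "word_mat u w \<in> tri_group ?n" using word_mat_tri[OF w(2)] w(1) by simp
    have "inflation k (?n - k) x y g = coeff_fun x (take k w) * coeff_fun y (drop k w)" if k: "k \<le> ?n" for k
    proof -
      have "diag_block 0 k g \<in> superclass k (diag_block 0 k (word_mat u w))"
        by (rule diag_block_superclass[OF g wt w(3)]) (use k in simp)
      hence s1: "diag_block 0 k g \<in> superclass k (word_mat u (take k w))"
        using diag_block_word_mat_take[of k w u] w(1) k by simp
      have "diag_block k (?n - k) g \<in> superclass (?n - k) (diag_block k (?n - k) (word_mat u w))"
        by (rule diag_block_superclass[OF g wt w(3)]) (use k in simp)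
      hence s2: "diag_block k (?n - k) g \<in> superclass (?n - k) (word_mat u (drop k w))"
        using diag_block_word_mat_drop[of k w u] w(1) k by simp
      note td = take_drop_in_words[OF w(2), of k]
      have "length (take k w) = k" using w(1) k by simp
      with word_mat_tri[OF td(1)] have t1: "word_mat u (take k w) \<in> tri_group k" by (simp only:)
      have t2: "word_mat u (drop k w) \<in> tri_group (?n - k)" using word_mat_tri[OF td(2)] w(1) by simp
      have "inflation k (?n - k) x y g = x (diag_block 0 k g) * y (diag_block k (?n - k) g)"
      proof -
        have dim: "dim_col g = ?n" using g by (auto simp: tri_group_def)
        have "diag_block 0 k g = mat k k (\<lambda>ij. g $$ ij)" by (simp add: diag_block_def)
        thus ?thesis using g k dim by (simp add: inflation_def split_block_def Let_def diag_block_def)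
      qed
      also have "x (diag_block 0 k g) = coeff_fun x (take k w)"
        unfolding SCB_spaceD(3)[OF x t1 s1] by (rule coeff_fun_word[OF td(1)])
      also have "y (diag_block k (?n - k) g) = coeff_fun y (drop k w)"
        unfolding SCB_spaceD(3)[OF y t2 s2] by (rule coeff_fun_word[OF td(2)])
      finally show ?thesis .
    qed
    hence "SCB_mult x y g = NPS_mult (coeff_fun x) (coeff_fun y) w"
      unfolding SCB_mult_def NPS_mult_def w(1) by (intro sum.cong) simp_all
    thus ?thesis using True by (simp add: pull_def w_def)
  qed
qed

text \<open>Placing the matrices of two words on complementary index sets gives the matrix of their shuffle,
  so the restrictions become the terms of the coproduct of words.\<close>

lemma SCB_comult_transport:
  assumes f: "f \<in> SCB_space"
  shows "SCB_comult f =
    pull (tri_groups \<times> tri_groups) (map_prod normal_word normal_word) (NPS_comult r (coeff_fun f))"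
proof (rule ext, clarify)
  fix g1 g2 :: "'q mat"
  let ?k = "dim_row g1" and ?m = "dim_row g2"
  let ?n = "?k + ?m"
  let ?S = "{(A1, A2). A1 \<union> A2 = {..<?n} \<and> A1 \<inter> A2 = {}}"
  have S: "?S = (\<lambda>A. (A, {..<?n} - A)) ` Pow {..<?n}"
    by (auto simp: image_iff)
  have inj: "inj_on (\<lambda>A. (A, {..<?n} - A)) (Pow {..<?n})" by (auto simp: inj_on_def)
  have "SCB_comult f (g1, g2) = (\<Sum>(A1, A2)\<in>?S. TRes ?n A1 A2 f) (g1, g2)"
    by (simp add: SCB_comult_def SCB_comult_deg_def)
  also have "\<dots> = (\<Sum>A\<in>Pow {..<?n}. TRes ?n A ({..<?n} - A) f (g1, g2))"
    unfolding S by (subst sum.reindex[OF inj]) (simp add: sum_fun_apply)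
  also have "\<dots> = (\<Sum>A\<in>subsets_of_card ?n ?k. TRes ?n A ({..<?n} - A) f (g1, g2))"
  proof (rule sum.mono_neutral_right)
    show "\<forall>A\<in>Pow {..<?n} - subsets_of_card ?n ?k. TRes ?n A ({..<?n} - A) f (g1, g2) = 0"
      by (auto simp: TRes_def dest: tri_group_dim)
  qed auto
  finally have eq: "SCB_comult f (g1, g2) = (\<Sum>A\<in>subsets_of_card ?n ?k. TRes ?n A ({..<?n} - A) f (g1, g2))" .
  show "SCB_comult f (g1, g2) =
    pull (tri_groups \<times> tri_groups) (map_prod normal_word normal_word) (NPS_comult r (coeff_fun f)) (g1, g2)"
  proof (cases "g1 \<in> tri_groups \<and> g2 \<in> tri_groups")
    case False
    hence "TRes ?n A ({..<?n} - A) f (g1, g2) = 0" for A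
      by (auto simp: TRes_def)
    thus ?thesis using False unfolding eq by (auto simp: pull_def)
  next
    case True
    hence g: "g1 \<in> tri_group ?k" "g2 \<in> tri_group ?m" by (simp_all only: tri_groups_iff)
    define v1 where "v1 = normal_word g1"
    define v2 where "v2 = normal_word g2"
    note v1 = normal_word[OF g(1), folded v1_def] and v2 = normal_word[OF g(2), folded v2_def]
    have t: "word_mat u v1 \<in> tri_group ?k" "word_mat u v2 \<in> tri_group ?m"
      using word_mat_tri[OF v1(2)] word_mat_tri[OF v2(2)] v1(1) v2(1) by simp_all
    have "TRes ?n A ({..<?n} - A) f (g1, g2) = coeff_fun f (weave A (evens v1) (odds v2))"
      if A: "A \<in> subsets_of_card ?n ?k" for A
    proof -
      have A': "A \<subseteq> {..<?n}" "card A = ?k" using A by auto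
      have A'': "A \<in> subsets_of_card (length v1 + length v2) (length v1)" using A v1(1) v2(1) by simp
      have "TRes ?n A ({..<?n} - A) f (g1, g2) = f (levi_embed ?n A g1 g2)"
        by (rule TRes_eq[OF A' refl g])
      also have "\<dots> = f (levi_embed ?n A (word_mat u v1) (word_mat u v2))"
        by (rule SCB_spaceD(3)[OF f levi_embed_tri_group[OF A' refl t]
              levi_embed_superclass[OF A' refl v1(3) t(1) v2(3) t(2)]])
      also have "\<dots> = f (word_mat u (weave A (evens v1) (odds v2)))"
        using levi_embed_word_mat[OF A'', of u] v1(1) v2(1) by simp
      also have "\<dots> = coeff_fun f (weave A (evens v1) (odds v2))"
        by (rule coeff_fun_word[OF shuffled_in_var_words[OF A'' v1(2) v2(2)]])
      finally show ?thesis .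
    qed
    hence "SCB_comult f (g1, g2) =
        (\<Sum>A\<in>subsets_of_card ?n ?k. coeff_fun f (weave A (evens v1) (odds v2)))"
      unfolding eq by (intro sum.cong) simp_all
    also have "\<dots> = word_comult (coeff_fun f) (v1, v2)"
      using v1(1) v2(1) by (simp add: word_comult_def shuf_sum_eq_weave)
    also have "\<dots> = NPS_comult r (coeff_fun f) (v1, v2)"
      by (simp add: NPS_comult_eq coeff_fun_in_NPS f)
    finally show ?thesis using True by (simp add: pull_def v1_def v2_def)
  qed
qed

lemma hopf_transport_SCB: "hopf_transport (NPS r) (SCB :: 'q mat hopf_data) coeff_fun tri_groups normal_word"
proof -
  interpret NPS: hopf_algebra "NPS r" by (rule hopf_algebra_NPS)
  show ?thesis
  proof (unfold_locales, unfold SCB_simps NPS_simps)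
    show "fvs.subspace (SCB_space :: ('q mat \<Rightarrow> complex) set)" by (rule subspace_SCB_space)
    show "linear_on SCB_space (NPS_space r) coeff_fun" by (rule coeff_fun_linear)
    show "bij_betw coeff_fun SCB_space (NPS_space r)" by (rule coeff_fun_bij)
    show "SCB_unit = pull (tri_groups :: 'q mat set) normal_word NPS_unit"
    proof
      fix g :: "'q mat"
      show "SCB_unit g = pull tri_groups normal_word NPS_unit g"
      proof (cases "g \<in> tri_groups")
        case True
        hence g: "g \<in> tri_group (dim_row g)" by (simp only: tri_groups_iff)
        have "normal_word g = [] \<longleftrightarrow> dim_row g = 0" using normal_word(1)[OF g] by (metis length_0_conv)
        moreover have "g \<in> tri_group 0 \<longleftrightarrow> dim_row g = 0" using g tri_group_dim[of g 0] by auto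
        ultimately show ?thesis using True by (simp add: SCB_unit_def pull_def NPS_unit_def)
      next
        case False
        thus ?thesis by (auto simp: SCB_unit_def pull_def)
      qed
    qed
    fix x :: "'q mat \<Rightarrow> complex" assume x: "x \<in> SCB_space"
    show "x = pull tri_groups normal_word (coeff_fun x)" by (rule coeff_fun_inverse[OF x])
    show "SCB_comult x = pull (tri_groups \<times> tri_groups) (map_prod normal_word normal_word) (NPS_comult r (coeff_fun x))"
      by (rule SCB_comult_transport[OF x])
    have "word_mat u [] = 1\<^sub>m 0" by (rule eq_matI) simp_all
    thus "SCB_counit x = NPS_counit (coeff_fun x)"
      by (simp add: SCB_counit_def NPS_counit_def coeff_fun_def)
    fix y :: "'q mat \<Rightarrow> complex" assume y: "y \<in> SCB_space"
    show "SCB_mult x y = pull tri_groups normal_word (NPS_mult (coeff_fun x) (coeff_fun y))"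
      by (rule SCB_mult_transport[OF x y])
  qed
qed

lemma kappa_eq:
  assumes P: "rigged_partition r {..<n} \<P>"
  shows "kappa u n \<P> g = (if g \<in> superclass n (word_mat u (rigged_word n \<P>)) then 1 else 0)"
  using word_mat_eq_rigged[of n "rigged_word n \<P>" u] word_type_rigged_word[OF P] by (simp add: kappa_def)

lemma coeff_fun_kappa:
  assumes P: "rigged_partition r {..<n} \<P>"
  shows "coeff_fun (kappa u n \<P>) = m_rigged n \<P>"
proof
  fix w
  let ?v = "rigged_word n \<P>"
  have v: "?v \<in> var_words r" by (rule rigged_word_in_words[OF P])
  have vt: "word_mat u ?v \<in> tri_group n" using word_mat_tri[OF v] by simp
  show "coeff_fun (kappa u n \<P>) w = m_rigged n \<P> w"
  proof (cases "w \<in> var_words r")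
    case True
    have "word_mat u w \<in> superclass n (word_mat u ?v) \<longleftrightarrow> length w = n \<and> word_type w = \<P>"
    proof
      assume s: "word_mat u w \<in> superclass n (word_mat u ?v)"
      have len: "length w = n" using tri_group_dim[OF superclass_tri_group[OF vt s]] by simp
      have "word_type w = word_type ?v"
        by (rule superclass_word_type[OF True v len _ s]) simp
      thus "length w = n \<and> word_type w = \<P>" using len word_type_rigged_word[OF P] by simp
    next
      assume "length w = n \<and> word_type w = \<P>"
      hence "length w = length ?v" and "word_type w = word_type ?v"
        unfolding word_type_rigged_word[OF P] by (simp, elim conjE)
      hence "word_mat u w = word_mat u ?v" by (rule word_mat_cong_type)
      thus "word_mat u w \<in> superclass n (word_mat u ?v)" using superclass_refl[OF vt] by simp
    qed
    thus ?thesis using True by (simp add: coeff_fun_def kappa_eq[OF P] m_rigged_eq[OF P])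
  next
    case False
    thus ?thesis using NPS_spaceD(1)[OF m_rigged_in_NPS[OF P] False] by (simp add: coeff_fun_def)
  qed
qed

lemma kappa_in_SCB:
  assumes P: "rigged_partition r {..<n} \<P>"
  shows "kappa u n \<P> \<in> SCB_space"
proof -
  let ?v = "word_mat u (rigged_word n \<P>)"
  have vt: "?v \<in> tri_group n" using word_mat_tri[OF rigged_word_in_words[OF P]] by simp
  have "h \<in> superclass n ?v \<longleftrightarrow> g \<in> superclass n ?v" if g: "g \<in> tri_group n" and h: "h \<in> superclass n g" for g h
  proof
    assume s: "h \<in> superclass n ?v"
    show "g \<in> superclass n ?v" by (rule superclass_trans[OF vt s superclass_sym[OF g h]])
  next
    assume s: "g \<in> superclass n ?v"
    show "h \<in> superclass n ?v" by (rule superclass_trans[OF vt s h])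
  qed
  moreover have "g \<notin> superclass n ?v" if "g \<notin> tri_group n" for g
    using superclass_tri_group[OF vt] that by blast
  ultimately have "kappa u n \<P> \<in> SCB_deg n"
    unfolding SCB_deg_def mem_Collect_eq kappa_eq[OF P] by simp
  thus ?thesis unfolding SCB_space_def by (intro fvs.span_base) blast
qed

text \<open>The functions \<open>\<kappa>\<^sub>\<P>\<close> span the superclass functions, because their images span.\<close>

lemma linear_eq_on_kappa:
  assumes G: "linear_on SCB_space (NPS_space r) G"
    and k: "\<And>n \<P>. rigged_partition r {..<n} \<P> \<Longrightarrow> G (kappa u n \<P>) = m_rigged n \<P>"
    and f: "f \<in> SCB_space"
  shows "G f = coeff_fun f"
proof -
  obtain J a where J: "finite J" "J \<subseteq> rigged_index r"
    "coeff_fun f = (\<Sum>i\<in>J. fscale (a i) (case i of (n, \<P>) \<Rightarrow> m_rigged n \<P>))"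
    using NPS_expansion'[OF coeff_fun_in_NPS[OF f]] .
  let ?s = "\<Sum>i\<in>J. fscale (a i) (case i of (n, \<P>) \<Rightarrow> kappa u n \<P>)"
  have mem: "(case i of (n, \<P>) \<Rightarrow> kappa u n \<P>) \<in> SCB_space" if "i \<in> J" for i
    using that J(2) kappa_in_SCB by auto
  hence mem': "fscale (a i) (case i of (n, \<P>) \<Rightarrow> kappa u n \<P>) \<in> SCB_space" if "i \<in> J" for i
    using that by (intro fvs.subspace_scale[OF subspace_SCB_space])
  have image: "L ?s = (\<Sum>i\<in>J. fscale (a i) (case i of (n, \<P>) \<Rightarrow> m_rigged n \<P>))"
    if L: "linear_on SCB_space (NPS_space r) L"
      and Lk: "\<And>n \<P>. rigged_partition r {..<n} \<P> \<Longrightarrow> L (kappa u n \<P>) = m_rigged n \<P>" for L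
  proof -
    have "L ?s = (\<Sum>i\<in>J. L (fscale (a i) (case i of (n, \<P>) \<Rightarrow> kappa u n \<P>)))"
      by (rule linear_on_sum[OF L subspace_SCB_space mem'])
    also have "\<dots> = (\<Sum>i\<in>J. fscale (a i) (L (case i of (n, \<P>) \<Rightarrow> kappa u n \<P>)))"
      by (rule sum.cong[OF refl]) (rule linear_onD(3)[OF L mem])
    also have "\<dots> = (\<Sum>i\<in>J. fscale (a i) (case i of (n, \<P>) \<Rightarrow> m_rigged n \<P>))"
      by (rule sum.cong[OF refl]) (use J(2) Lk in auto)
    finally show ?thesis .
  qed
  have s: "?s \<in> SCB_space" by (rule fvs.subspace_sum[OF subspace_SCB_space mem'])
  have "coeff_fun ?s = coeff_fun f"
    unfolding J(3) by (rule image[OF coeff_fun_linear coeff_fun_kappa])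
  hence "?s = f" using inj_onD[OF bij_betw_imp_inj_on[OF coeff_fun_bij] _ s f] by simp
  moreover have "G ?s = coeff_fun f" unfolding J(3) by (rule image[OF G k])
  ultimately show ?thesis by simp
qed

end

theorem theorem6p5:
  fixes u :: "nat \<Rightarrow> 'q :: {field, finite}" and r :: nat
  assumes r: "r = CARD('q) - 2"
    and u: "bij_betw u {..<r} (UNIV - {0, 1})"
  shows "hopf_algebra (SCB :: 'q mat hopf_data) \<and>
         hopf_algebra (NPS r) \<and>
         (\<exists>F. hopf_isomorphism (SCB :: 'q mat hopf_data) (NPS r) F \<and>
              (\<forall>n \<P>. rigged_partition r {..<n} \<P> \<longrightarrow> F (kappa u n \<P>) = m_rigged n \<P>) \<and>
              (\<forall>G. linear_on (hspace (SCB :: 'q mat hopf_data)) (hspace (NPS r)) G \<and>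
                   (\<forall>n \<P>. rigged_partition r {..<n} \<P> \<longrightarrow> G (kappa u n \<P>) = m_rigged n \<P>) \<longrightarrow>
                   (\<forall>\<chi>\<in>hspace SCB. G \<chi> = F \<chi>)))"
proof -
  interpret hopf_transport "NPS r" "SCB :: 'q mat hopf_data" "coeff_fun u r" tri_groups "normal_word u r"
    by (rule hopf_transport_SCB[OF u])
  show ?thesis
  proof (intro conjI exI[of _ "coeff_fun u r"] allI impI ballI)
    show "hopf_algebra (SCB :: 'q mat hopf_data)" by (rule hopf_algebra_H)
    show "hopf_algebra (NPS r)" by (rule hopf_algebra_NPS)
    show "hopf_isomorphism (SCB :: 'q mat hopf_data) (NPS r) (coeff_fun u r)" by (rule hopf_isomorphism_F)
    show "coeff_fun u r (kappa u n \<P>) = m_rigged n \<P>" if "rigged_partition r {..<n} \<P>" for n \<P>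
      by (rule coeff_fun_kappa[OF u that])
    fix G and \<chi> :: "'q mat \<Rightarrow> complex"
    assume G: "linear_on (hspace (SCB :: 'q mat hopf_data)) (hspace (NPS r)) G \<and>
        (\<forall>n \<P>. rigged_partition r {..<n} \<P> \<longrightarrow> G (kappa u n \<P>) = m_rigged n \<P>)"
      and \<chi>: "\<chi> \<in> hspace SCB"
    show "G \<chi> = coeff_fun u r \<chi>"
      by (rule linear_eq_on_kappa[OF u G[THEN conjunct1, unfolded SCB_simps NPS_simps]
            G[THEN conjunct2, rule_format] \<chi>[unfolded SCB_simps]])
  qed
qed

end
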